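(* Let $\Omega\subset\mathbb{C}$ be a hyperbolic planar domain. Suppose there exists a totally disconnected subset $S\subset\partial\Omega$ such that, for every $p\in\partial\Omega\setminus S$, $\partial\Omega$ is locally connected at $p$ and the connected component of $\partial\Omega$ containing $p$ is not a singleton. Then $\Omega$ is a visibility domain.
   Context: $\partial\Omega$ is the boundary of $\Omega$ in $\mathbb{C}$. For a domain $\Omega\subset\mathbb{C}$, $\mathsf{k}_\Omega$ is the Kobayashi (pseudo)distance and $\kappa_\Omega(z;v)$ the Kobayashi--Royden (pseudo)metric; $\Omega$ is hyperbolic if $\mathsf{k}_\Omega$ is a distance (in the plane, $\mathsf{k}_\Omega$ is then the hyperbolic distance). Almost-geodesics: for $\lambda\ge1,\kappa\ge0$ and an interval $I\subset\mathbb{R}$, a map $\sigma:I\to\Omega$ is a $(\lambda,\kappa)$-almost-geodesic if (i) $\frac1\lambda|s-t|-\kappa\le \mathsf{k}_\Omega(\sigma(s),\sigma(t))\le\lambda|s-t|+\kappa$ for all $s,t\in I$; (ii) $\sigma$ is absolutely continuous and $\kappa_\Omega(\sigma(t);\sigma'(t))\le\lambda$ for a.e. $t\in I$. End compactification: if $\Omega$ is bounded, $\overline{\Omega}^{End}:=\overline{\Omega}$. If $\Omega$ is unbounded, fix an exhaustion $(K_j)_{j\ge1}$ of $\overline\Omega$ by compact sets with $K_j$ contained in the interior (in $\overline\Omega$) of $K_{j+1}$. An end of $\overline\Omega$ is a sequence $(F_j)_{j\ge1}$ with $F_j$ a connected component of $\overline\Omega\setminus K_j$ and $F_{j+1}\subset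 F_j$. As a set, $\overline{\Omega}^{End}$ is $\overline\Omega$ together with all ends. Points of $\overline\Omega$ have their Euclidean neighbourhoods in $\overline\Omega$ as neighbourhood basis; an end $(F_j)_j$ has the neighbourhood basis $(\widehat F_j)_j$, where $\widehat F_j$ is $F_j$ together with all ends $(G_\nu)_\nu$ with $G_\nu=F_\nu$ for $\nu=1,\dots,j$. (Up to natural homeomorphism this does not depend on the exhaustion.) $\partial\overline{\Omega}^{End}:=\overline{\Omega}^{End}\setminus\Omega$. Visibility: distinct $\zeta,\eta\in\partial\overline{\Omega}^{End}$ satisfy the $(\lambda,\kappa)$-visibility property if there exist neighbourhoods $V_\zeta$, $V_\eta$ of $\zeta,\eta$ in $\overline{\Omega}^{End}$ with $\overline{V_\zeta}\cap\overline{V_\eta}=\emptyset$ and a compact $K\subset\Omega$ such that every $(\lambda,\kappa)$-almost-geodesic $\sigma:[0,T]\to\Omega$ with $\sigma(0)\in V_\zeta$, $\sigma(T)\in V_\eta$ satisfies $\sigma([0,T])\cap K\ne\emptyset$. A hyperbolic domain $\Omega$ is a visibility domain if for all $\lambda\ge1$ and $\kappa>0$ every pair of distinct points of $\partial\overline{\Omega}^{End}$ satisfies the $(\lambda,\kappa)$-visibility property. *)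

theory Defs
  imports "HOL-Complex_Analysis.Complex_Analysis"
begin

section \<open>The Kobayashi distance and the Kobayashi--Royden metric\<close>

text \<open>The Poincare metric of the unit disc is normalised to be \<open>|dz| / (1 - |z|^2)\<close>, so that it
  agrees with the Kobayashi--Royden metric of the disc.\<close>

definition poincare_dist :: "complex \<Rightarrow> complex \<Rightarrow> real" where
  "poincare_dist a b = artanh (norm ((a - b) / (1 - cnj b * a)))"

text \<open>A chain of \<open>n\<close> analytic discs in \<open>\<Omega>\<close> joins \<open>z\<close> to \<open>w\<close>; the \<open>i\<close>-th disc \<open>f i\<close> leads from
  \<open>f i (a i)\<close> to \<open>f i (b i)\<close>.\<close>

definition disc_chain ::
  "complex set \<Rightarrow> complex \<Rightarrow> complex \<Rightarrow> nat \<Rightarrow> (nat \<Rightarrow> complex \<Rightarrow> complex)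
    \<Rightarrow> (nat \<Rightarrow> complex) \<Rightarrow> (nat \<Rightarrow> complex) \<Rightarrow> bool" where
  "disc_chain \<Omega> z w n f a b \<longleftrightarrow>
     n > 0 \<and>
     (\<forall>i<n. f i holomorphic_on ball 0 1 \<and> f i ` ball 0 1 \<subseteq> \<Omega> \<and> a i \<in> ball 0 1 \<and> b i \<in> ball 0 1) \<and>
     f 0 (a 0) = z \<and> f (n - 1) (b (n - 1)) = w \<and>
     (\<forall>i. Suc i < n \<longrightarrow> f i (b i) = f (Suc i) (a (Suc i)))"

text \<open>Meaningful for \<open>z, w\<close> in a domain \<open>\<Omega>\<close>: then the set of chain lengths is nonempty, and it is
  bounded below by \<open>0\<close>.\<close>

definition kobayashi_dist :: "complex set \<Rightarrow> complex \<Rightarrow> complex \<Rightarrow> real" where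
  "kobayashi_dist \<Omega> z w =
     Inf {\<Sum>i<n. poincare_dist (a i) (b i) | n f a b. disc_chain \<Omega> z w n f a b}"

definition kobayashi_metric :: "complex set \<Rightarrow> complex \<Rightarrow> complex \<Rightarrow> real" where
  "kobayashi_metric \<Omega> z v =
     Inf {norm \<xi> | \<xi> f. f holomorphic_on ball 0 1 \<and> f ` ball 0 1 \<subseteq> \<Omega> \<and> f 0 = z \<and> deriv f 0 * \<xi> = v}"

text \<open>The Kobayashi pseudodistance of a domain is always finite, nonnegative, symmetric and
  satisfies the triangle inequality; it is a distance iff it separates points.\<close>

definition hyperbolic_domain :: "complex set \<Rightarrow> bool" where
  "hyperbolic_domain \<Omega> \<longleftrightarrow>
     open \<Omega> \<and> connected \<Omega> \<and> \<Omega> \<noteq> {} \<and>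
     (\<forall>z\<in>\<Omega>. \<forall>w\<in>\<Omega>. kobayashi_dist \<Omega> z w = 0 \<longrightarrow> z = w)"

section \<open>Almost-geodesics\<close>

definition absolutely_continuous_path :: "real set \<Rightarrow> (real \<Rightarrow> complex) \<Rightarrow> bool" where
  "absolutely_continuous_path I \<sigma> \<longleftrightarrow>
     (\<forall>\<epsilon>>0. \<exists>\<delta>>0. \<forall>(n::nat) a b.
        (\<forall>i<n. a i \<in> I \<and> b i \<in> I \<and> a i \<le> b i) \<and>
        (\<forall>i<n. \<forall>j<n. i \<noteq> j \<longrightarrow> {a i<..<b i} \<inter> {a j<..<b j} = {}) \<and>
        (\<Sum>i<n. b i - a i) < \<delta> \<longrightarrow>
        (\<Sum>i<n. norm (\<sigma> (b i) - \<sigma> (a i))) < \<epsilon>)"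

definition almost_geodesic ::
  "complex set \<Rightarrow> real \<Rightarrow> real \<Rightarrow> real set \<Rightarrow> (real \<Rightarrow> complex) \<Rightarrow> bool" where
  "almost_geodesic \<Omega> lam kap I \<sigma> \<longleftrightarrow>
     is_interval I \<and> \<sigma> ` I \<subseteq> \<Omega> \<and>
     (\<forall>s\<in>I. \<forall>t\<in>I. \<bar>s - t\<bar> / lam - kap \<le> kobayashi_dist \<Omega> (\<sigma> s) (\<sigma> t) \<and>
                  kobayashi_dist \<Omega> (\<sigma> s) (\<sigma> t) \<le> lam * \<bar>s - t\<bar> + kap) \<and>
     absolutely_continuous_path I \<sigma> \<and>
     (AE t in lborel. t \<in> I \<longrightarrow>
        (\<exists>v. (\<sigma> has_vector_derivative v) (at t within I) \<and> kobayashi_metric \<Omega> (\<sigma> t) v \<le> lam))"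

section \<open>The end compactification\<close>

definition exhaustion :: "complex set \<Rightarrow> (nat \<Rightarrow> complex set) \<Rightarrow> bool" where
  "exhaustion X K \<longleftrightarrow>
     (\<forall>j. compact (K j) \<and> K j \<subseteq> X \<and> K j \<subseteq> (top_of_set X) interior_of (K (Suc j))) \<and>
     (\<Union>j. K j) = X"

datatype end_point = Pt complex | End "nat \<Rightarrow> complex set"

definition ends :: "complex set \<Rightarrow> (nat \<Rightarrow> complex set) \<Rightarrow> (nat \<Rightarrow> complex set) set" where
  "ends \<Omega> K =
     (if bounded \<Omega> then {}
      else {F. \<forall>j. F j \<in> components (closure \<Omega> - K j) \<and> F (Suc j) \<subseteq> F j})"

definition end_space :: "complex set \<Rightarrow> (nat \<Rightarrow> complex set) \<Rightarrow> end_point set" where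
  "end_space \<Omega> K = Pt ` closure \<Omega> \<union> End ` ends \<Omega> K"

definition end_nbhd ::
  "complex set \<Rightarrow> (nat \<Rightarrow> complex set) \<Rightarrow> (nat \<Rightarrow> complex set) \<Rightarrow> nat \<Rightarrow> end_point set" where
  "end_nbhd \<Omega> K F j = Pt ` F j \<union> End ` {G \<in> ends \<Omega> K. \<forall>\<nu>\<le>j. G \<nu> = F \<nu>}"

text \<open>A set is open iff it contains a basic neighbourhood of each of its points.\<close>

definition end_open :: "complex set \<Rightarrow> (nat \<Rightarrow> complex set) \<Rightarrow> end_point set \<Rightarrow> bool" where
  "end_open \<Omega> K U \<longleftrightarrow>
     U \<subseteq> end_space \<Omega> K \<and>
     (\<forall>x. Pt x \<in> U \<longrightarrow> (\<exists>r>0. Pt ` (ball x r \<inter> closure \<Omega>) \<subseteq> U)) \<and>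
     (\<forall>F. End F \<in> U \<longrightarrow> (\<exists>j. end_nbhd \<Omega> K F j \<subseteq> U))"

definition end_compactification ::
  "complex set \<Rightarrow> (nat \<Rightarrow> complex set) \<Rightarrow> end_point topology" where
  "end_compactification \<Omega> K = topology (end_open \<Omega> K)"

lemma ends_antimono:
  assumes "F \<in> ends \<Omega> K" "i \<le> j"
  shows "F j \<subseteq> F i"
proof -
  have "F (Suc n) \<subseteq> F n" for n
    using assms(1) by (simp add: ends_def split: if_splits)
  then show ?thesis
    using assms(2) by (rule lift_Suc_antimono_le)
qed

lemma end_nbhd_antimono:
  assumes "F \<in> ends \<Omega> K" "i \<le> j"
  shows "end_nbhd \<Omega> K F j \<subseteq> end_nbhd \<Omega> K F i"
  using ends_antimono[OF assms] assms(2) by (auto simp: end_nbhd_def)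

lemma end_open_subset: "end_open \<Omega> K U \<Longrightarrow> U \<subseteq> end_space \<Omega> K"
  unfolding end_open_def by (elim conjE)

lemma end_open_Pt:
  "end_open \<Omega> K U \<Longrightarrow> Pt x \<in> U \<Longrightarrow> \<exists>r>0. Pt ` (ball x r \<inter> closure \<Omega>) \<subseteq> U"
  unfolding end_open_def by (elim conjE) (drule spec, drule mp)

lemma end_open_End:
  "end_open \<Omega> K U \<Longrightarrow> End F \<in> U \<Longrightarrow> \<exists>j. end_nbhd \<Omega> K F j \<subseteq> U"
  unfolding end_open_def by (elim conjE) (drule spec, drule mp)

lemma end_openI:
  assumes "U \<subseteq> end_space \<Omega> K"
    and "\<And>x. Pt x \<in> U \<Longrightarrow> \<exists>r>0. Pt ` (ball x r \<inter> closure \<Omega>) \<subseteq> U"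
    and "\<And>F. End F \<in> U \<Longrightarrow> \<exists>j. end_nbhd \<Omega> K F j \<subseteq> U"
  shows "end_open \<Omega> K U"
  unfolding end_open_def by (intro conjI allI impI assms)

lemma istopology_end_open: "istopology (end_open \<Omega> K)"
  unfolding istopology_def
proof (intro conjI allI impI)
  fix U V assume U: "end_open \<Omega> K U" and V: "end_open \<Omega> K V"
  show "end_open \<Omega> K (U \<inter> V)"
  proof (rule end_openI)
    show "U \<inter> V \<subseteq> end_space \<Omega> K" using end_open_subset[OF U] by blast
  next
    fix x assume x: "Pt x \<in> U \<inter> V"
    obtain r where r: "r > 0" "Pt ` (ball x r \<inter> closure \<Omega>) \<subseteq> U"
      using end_open_Pt[OF U] x by (meson IntD1)
    obtain s where s: "s > 0" "Pt ` (ball x s \<inter> closure \<Omega>) \<subseteq> V"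
      using end_open_Pt[OF V] x by (meson IntD2)
    have "Pt ` (ball x (min r s) \<inter> closure \<Omega>) \<subseteq> U \<inter> V"
      using r(2) s(2) by (simp add: image_subset_iff)
    then show "\<exists>r>0. Pt ` (ball x r \<inter> closure \<Omega>) \<subseteq> U \<inter> V"
      using r(1) s(1) by (intro exI[of _ "min r s"]) simp
  next
    fix F assume F: "End F \<in> U \<inter> V"
    then have "End F \<in> end_space \<Omega> K" using end_open_subset[OF U] by blast
    then have FE: "F \<in> ends \<Omega> K" by (auto simp: end_space_def)
    obtain i where i: "end_nbhd \<Omega> K F i \<subseteq> U"
      using end_open_End[OF U] F by (meson IntD1)
    obtain j where j: "end_nbhd \<Omega> K F j \<subseteq> V"
      using end_open_End[OF V] F by (meson IntD2)
    have "end_nbhd \<Omega> K F (max i j) \<subseteq> U \<inter> V"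
      using end_nbhd_antimono[OF FE max.cobounded1[of i j]]
        end_nbhd_antimono[OF FE max.cobounded2[of j i]] i j by blast
    then show "\<exists>j. end_nbhd \<Omega> K F j \<subseteq> U \<inter> V" ..
  qed
next
  fix \<U> assume *: "\<forall>U\<in>\<U>. end_open \<Omega> K U"
  show "end_open \<Omega> K (\<Union>\<U>)"
  proof (rule end_openI)
    show "\<Union>\<U> \<subseteq> end_space \<Omega> K" using * by (intro Union_least end_open_subset) simp
  next
    fix x assume "Pt x \<in> \<Union>\<U>"
    then obtain U where "U \<in> \<U>" "Pt x \<in> U" by (rule UnionE)
    moreover obtain r where "r > 0" "Pt ` (ball x r \<inter> closure \<Omega>) \<subseteq> U"
      using end_open_Pt * calculation by meson
    ultimately show "\<exists>r>0. Pt ` (ball x r \<inter> closure \<Omega>) \<subseteq> \<Union>\<U>"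
      by (meson Union_upper order_trans)
  next
    fix F assume "End F \<in> \<Union>\<U>"
    then obtain U where "U \<in> \<U>" "End F \<in> U" by (rule UnionE)
    moreover obtain j where "end_nbhd \<Omega> K F j \<subseteq> U"
      using end_open_End * calculation by meson
    ultimately show "\<exists>j. end_nbhd \<Omega> K F j \<subseteq> \<Union>\<U>"
      by (meson Union_upper order_trans)
  qed
qed

lemma openin_end_compactification [simp]:
  "openin (end_compactification \<Omega> K) U \<longleftrightarrow> end_open \<Omega> K U"
  by (simp add: end_compactification_def istopology_end_open)

lemma topspace_end_compactification [simp]:
  "topspace (end_compactification \<Omega> K) = end_space \<Omega> K"
proof -
  have "F j \<subseteq> closure \<Omega>" if "F \<in> ends \<Omega> K" for F j
  proof -
    have "F j \<in> components (closure \<Omega> - K j)"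
      using that by (simp add: ends_def split: if_splits)
    then show ?thesis using in_components_subset by blast
  qed
  then have "end_nbhd \<Omega> K F 0 \<subseteq> end_space \<Omega> K" if "F \<in> ends \<Omega> K" for F
    using that by (auto simp: end_nbhd_def end_space_def)
  moreover have "Pt ` (ball x 1 \<inter> closure \<Omega>) \<subseteq> end_space \<Omega> K" for x
    by (auto simp: end_space_def)
  moreover have "F \<in> ends \<Omega> K" if "End F \<in> end_space \<Omega> K" for F
    using that by (auto simp: end_space_def)
  ultimately have "end_open \<Omega> K (end_space \<Omega> K)"
    by (intro end_openI) (meson order_refl zero_less_one)+
  moreover have "U \<subseteq> end_space \<Omega> K" if "end_open \<Omega> K U" for U
    using that by (rule end_open_subset)
  ultimately show ?thesis
    unfolding topspace_def openin_end_compactification by blast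
qed

lemma exhaustion_cball: "exhaustion (closure \<Omega>) (\<lambda>j. closure \<Omega> \<inter> cball 0 (real j))"
  unfolding exhaustion_def
proof (intro conjI allI)
  fix j
  show "compact (closure \<Omega> \<inter> cball 0 (real j))"
    by (simp add: closed_Int_compact)
  have "closure \<Omega> \<inter> cball 0 (real j) \<subseteq> closure \<Omega> \<inter> ball 0 (real (Suc j))" by auto
  also have "\<dots> \<subseteq> (top_of_set (closure \<Omega>)) interior_of (closure \<Omega> \<inter> cball 0 (real (Suc j)))"
  proof (rule interior_of_maximal)
    show "closure \<Omega> \<inter> ball 0 (real (Suc j)) \<subseteq> closure \<Omega> \<inter> cball 0 (real (Suc j))"
      using ball_subset_cball by blast
    show "openin (top_of_set (closure \<Omega>)) (closure \<Omega> \<inter> ball 0 (real (Suc j)))"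
      by (simp add: openin_open_Int)
  qed
  finally show "closure \<Omega> \<inter> cball 0 (real j) \<subseteq>
      (top_of_set (closure \<Omega>)) interior_of (closure \<Omega> \<inter> cball 0 (real (Suc j)))" .
next
  show "(\<Union>j. closure \<Omega> \<inter> cball 0 (real j)) = closure \<Omega>"
  proof (intro equalityI subsetI)
    fix z assume "z \<in> closure \<Omega>"
    moreover obtain j where "norm z \<le> real j" using real_arch_simple by blast
    ultimately show "z \<in> (\<Union>j. closure \<Omega> \<inter> cball 0 (real j))" by auto
  qed blast
qed auto

definition end_boundary :: "complex set \<Rightarrow> (nat \<Rightarrow> complex set) \<Rightarrow> end_point set" where
  "end_boundary \<Omega> K = end_space \<Omega> K - Pt ` \<Omega>"

section \<open>Visibility\<close>

definition neighbourhood_in :: "'a topology \<Rightarrow> 'a \<Rightarrow> 'a set \<Rightarrow> bool" where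
  "neighbourhood_in X x V \<longleftrightarrow> V \<subseteq> topspace X \<and> (\<exists>U. openin X U \<and> x \<in> U \<and> U \<subseteq> V)"

definition visibility_property ::
  "complex set \<Rightarrow> (nat \<Rightarrow> complex set) \<Rightarrow> real \<Rightarrow> real \<Rightarrow> end_point \<Rightarrow> end_point \<Rightarrow> bool" where
  "visibility_property \<Omega> K lam kap \<zeta> \<eta> \<longleftrightarrow>
     (\<exists>V W C. neighbourhood_in (end_compactification \<Omega> K) \<zeta> V \<and>
        neighbourhood_in (end_compactification \<Omega> K) \<eta> W \<and>
        (end_compactification \<Omega> K) closure_of V \<inter> (end_compactification \<Omega> K) closure_of W = {} \<and>
        compact C \<and> C \<subseteq> \<Omega> \<and>
        (\<forall>T\<ge>0. \<forall>\<sigma>. almost_geodesic \<Omega> lam kap {0..T} \<sigma> \<and> Pt (\<sigma> 0) \<in> V \<and> Pt (\<sigma> T) \<in> W \<longrightarrow>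
           \<sigma> ` {0..T} \<inter> C \<noteq> {}))"

text \<open>The end compactification is independent of the exhaustion up to homeomorphism fixing
  \<open>closure \<Omega>\<close>; the property is required for every choice.  By \<open>exhaustion_cball\<close> there is one.\<close>

definition visibility_domain :: "complex set \<Rightarrow> bool" where
  "visibility_domain \<Omega> \<longleftrightarrow>
     hyperbolic_domain \<Omega> \<and>
     (\<forall>K. exhaustion (closure \<Omega>) K \<longrightarrow>
        (\<forall>lam\<ge>1. \<forall>kap>0. \<forall>\<zeta>\<in>end_boundary \<Omega> K. \<forall>\<eta>\<in>end_boundary \<Omega> K.
           \<zeta> \<noteq> \<eta> \<longrightarrow> visibility_property \<Omega> K lam kap \<zeta> \<eta>))"

definition totally_disconnected :: "'a::topological_space set \<Rightarrow> bool" where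
  "totally_disconnected S \<longleftrightarrow> (\<forall>x\<in>S. connected_component_set S x = {x})"

end

theory Submission
  imports Defs "HOL-Real_Asymp.Real_Asymp"
begin

text \<open>Near a boundary point \<open>p\<close> outside \<open>S\<close> the boundary lies on one nondegenerate continuum, so by
  Schottky's theorem the Kobayashi--Royden metric is comparable to the reciprocal of the distance to
  the boundary. Every component of \<open>\<Omega>\<close> inside a small disc about \<open>p\<close> is simply connected, and its Riemann map
  turns almost-geodesics into quasi-geodesics of the unit disc, which stay close to hyperbolic
  geodesics. If an almost-geodesic came very close to \<open>p\<close> in between two distant ends, the length-area
  method would give a short crosscut near \<open>p\<close> separating these ends; as its endpoints are joined by a small
  connected piece of the boundary, Janiszewski's theorem is contradicted. Hence no almost-geodesic
  with ends far from \<open>p\<close> comes close to \<open>p\<close>.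

  If visibility failed, almost-geodesics leaving every compact subset of \<open>\<Omega>\<close> would accumulate at a
  nondegenerate continuum in the boundary. Such a continuum is not contained in \<open>S\<close>, and one of its points
  outside \<open>S\<close> contradicts the local statement. The same limit continua show that the closure of \<open>\<Omega>\<close> is
  locally connected where needed, so that distinct ends have disjoint closed neighbourhoods.\<close>

section \<open>The Poincare distance of the unit disc\<close>

text \<open>Analytic discs bound the Kobayashi distance of the domain only from above, so the
  pull-back to the disc inherits just the lower bound on almost-geodesics. Control from above has to
  come from their speed: the metric bounds it by the distance to the boundary, and Schwarz's lemma
  on a round disc inside \<open>U\<close> turns this into speed in the unit disc. Stability is
  therefore proved for curves that are Lipschitz over short times and satisfy a linear lower bound.

  The local argument assumes local connectedness of the boundary at \<open>p\<close> alone, so no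
  boundary values of the Riemann map are at hand. A strip replaces them: a stretch of length
  \<open>M\<close> of its real axis, a geodesic, stays at bounded hyperbolic distance from a curve
  point and is mapped close to \<open>p\<close>, while one of the vertical crosscuts over this
  stretch is short because the image has bounded area. Hence \<open>M\<close> is fixed first and the
  required closeness to \<open>p\<close> last.

  Total disconnectedness of \<open>S\<close> enters only through limits of connected sets: a
  connected limit set with two points cannot lie in \<open>S\<close>.\<close>

definition pseudo_dist :: "complex \<Rightarrow> complex \<Rightarrow> real" where
  "pseudo_dist a b = norm ((a - b) / (1 - cnj b * a))"

lemma poincare_dist_alt: "poincare_dist a b = artanh (pseudo_dist a b)"
  by (simp add: poincare_dist_def pseudo_dist_def)

text \<open>The identity behind \<open>pseudo_dist_less_1\<close> and the triangle inequality. On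
  the disc the right-hand side is positive, and the arguments of \<open>a\<close> and
  \<open>b\<close> affect \<open>1 - (pseudo_dist a b)^2\<close> only through
  \<open>norm (1 - cnj b * a)\<close>.\<close>

lemma norm_one_minus_cnj_mult:
  "(norm (1 - cnj b * a))\<^sup>2 - (norm (a - b))\<^sup>2 = (1 - (norm a)\<^sup>2) * (1 - (norm b)\<^sup>2)"
  unfolding cmod_power2 by (simp add: power2_eq_square algebra_simps)

lemma one_minus_cnj_mult_nonzero:
  assumes "norm a < 1" "norm b < 1"
  shows "1 - cnj b * a \<noteq> 0"
proof
  assume "1 - cnj b * a = 0"
  hence "norm (cnj b * a) = 1" by (metis eq_iff_diff_eq_0 norm_one)
  moreover have "norm b * norm a < 1 * 1"
    using assms by (intro mult_strict_mono') auto
  ultimately show False by (simp add: norm_mult)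
qed

lemma one_minus_pseudo_dist_sq:
  assumes "norm a < 1" "norm b < 1"
  shows "1 - (pseudo_dist a b)\<^sup>2 = (1 - (norm a)\<^sup>2) * (1 - (norm b)\<^sup>2) / (norm (1 - cnj b * a))\<^sup>2"
proof -
  have "(norm (1 - cnj b * a))\<^sup>2 \<noteq> 0" using one_minus_cnj_mult_nonzero[OF assms] by simp
  thus ?thesis unfolding norm_one_minus_cnj_mult[symmetric] pseudo_dist_def norm_divide power_divide
    by (simp add: diff_divide_distrib)
qed

lemma pseudo_dist_nonneg [simp]: "0 \<le> pseudo_dist a b"
  by (simp add: pseudo_dist_def)

lemma pseudo_dist_self [simp]: "pseudo_dist a a = 0"
  by (simp add: pseudo_dist_def)

lemma pseudo_dist_0 [simp]: "pseudo_dist a 0 = norm a" "pseudo_dist 0 a = norm a"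
  by (simp_all add: pseudo_dist_def)

lemma pseudo_dist_less_1:
  assumes "norm a < 1" "norm b < 1"
  shows "pseudo_dist a b < 1"
proof -
  have "0 < 1 - (pseudo_dist a b)\<^sup>2"
    unfolding one_minus_pseudo_dist_sq[OF assms]
    using assms one_minus_cnj_mult_nonzero[OF assms]
    by (intro divide_pos_pos mult_pos_pos) (auto simp: power_less_one_iff abs_square_less_1)
  thus ?thesis by (simp add: abs_square_less_1)
qed

lemma pseudo_dist_commute: "pseudo_dist a b = pseudo_dist b a"
proof -
  have "norm (1 - cnj a * b) = norm (cnj (1 - cnj a * b))" by (metis complex_mod_cnj)
  also have "\<dots> = norm (1 - cnj b * a)" by (simp add: mult.commute)
  finally show ?thesis by (simp add: pseudo_dist_def norm_divide norm_minus_commute)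
qed

lemma norm_diff_le_pseudo_dist:
  assumes "norm a < 1" "norm b < 1"
  shows "norm (a - b) = pseudo_dist a b * norm (1 - cnj b * a)"
  using one_minus_cnj_mult_nonzero[OF assms] by (simp add: pseudo_dist_def norm_divide)

lemma tanh_artanh_real:
  assumes "\<bar>x::real\<bar> < 1" shows "tanh (artanh x) = x"
proof -
  have q: "(1 + x) / (1 - x) > 0" using assms by (auto simp: abs_if split: if_splits)
  have "artanh x = ln (sqrt ((1 + x) / (1 - x)))"
    using q by (simp add: artanh_def ln_sqrt)
  hence "tanh (artanh x) = ((sqrt ((1 + x) / (1 - x)))\<^sup>2 - 1) / ((sqrt ((1 + x) / (1 - x)))\<^sup>2 + 1)"
    using q by (simp only:) (rule tanh_ln_real, simp)
  also have "\<dots> = ((1 + x) / (1 - x) - 1) / ((1 + x) / (1 - x) + 1)" using q by simp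
  also have "\<dots> = x"
  proof -
    have nz: "1 - x \<noteq> 0" using assms by auto
    have "(1 + x) / (1 - x) - 1 = 2 * x / (1 - x)" "(1 + x) / (1 - x) + 1 = 2 / (1 - x)"
      using nz by (simp_all add: field_simps)
    thus ?thesis using nz by simp
  qed
  finally show ?thesis .
qed

text \<open>Since \<open>tanh\<close> is increasing and inverts \<open>artanh\<close> here,
  estimates of the Poincare distance become estimates of an algebraic quantity.\<close>

lemma poincare_dist_le_iff:
  assumes "norm a < 1" "norm b < 1"
  shows "poincare_dist a b \<le> D \<longleftrightarrow> pseudo_dist a b \<le> tanh D"
proof -
  have "\<bar>pseudo_dist a b\<bar> < 1" using pseudo_dist_less_1[OF assms] by simp
  from tanh_artanh_real[OF this] show ?thesis
    unfolding poincare_dist_alt by (metis tanh_real_le_iff)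
qed

lemma poincare_dist_nonneg:
  assumes "norm a < 1" "norm b < 1" shows "0 \<le> poincare_dist a b"
proof -
  have "\<bar>pseudo_dist a b\<bar> < 1" using pseudo_dist_less_1[OF assms] by simp
  from tanh_artanh_real[OF this] show ?thesis
    unfolding poincare_dist_alt by (metis tanh_real_nonneg_iff pseudo_dist_nonneg)
qed

lemma poincare_dist_commute: "poincare_dist a b = poincare_dist b a"
  by (simp add: poincare_dist_alt pseudo_dist_commute)

lemma Moebius_pseudo_dist:
  assumes w: "norm w < 1" and a: "norm a < 1" and b: "norm b < 1"
  shows "pseudo_dist (Moebius_function 0 w a) (Moebius_function 0 w b) = pseudo_dist a b"
proof -
  define A B where "A = 1 - cnj w * a" and "B = 1 - cnj w * b"
  have nz: "A \<noteq> 0" "B \<noteq> 0" "1 - cnj b * a \<noteq> 0" "cnj B \<noteq> 0"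
    using one_minus_cnj_mult_nonzero[OF a w] one_minus_cnj_mult_nonzero[OF b w]
      one_minus_cnj_mult_nonzero[OF a b] one_minus_cnj_mult_nonzero[OF w b]
    by (auto simp: A_def B_def mult.commute)
  have w0: "1 - w * cnj w \<noteq> 0" using one_minus_cnj_mult_nonzero[OF w w] by (simp add: mult.commute)
  \<comment> \<open>Numerator and denominator of the transformed quotient acquire the same factor
    \<open>1 - w * cnj w\<close>, divided by \<open>A * B\<close> and \<open>A * cnj B\<close>,
    which have equal modulus.\<close>
  have 1: "(a - w) / A - (b - w) / B = (a - b) * (1 - w * cnj w) / (A * B)"
    using nz by (simp add: field_simps) (simp add: A_def B_def algebra_simps)
  have 2: "1 - cnj ((b - w) / B) * ((a - w) / A) = (1 - cnj b * a) * (1 - w * cnj w) / (A * cnj B)"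
    using nz by (simp add: field_simps) (simp add: A_def B_def algebra_simps)
  have "norm (cnj B) = norm B" by simp
  thus ?thesis
    unfolding pseudo_dist_def Moebius_function_simple A_def[symmetric] B_def[symmetric] 1 2
    using nz w0 by (simp add: norm_divide norm_mult)
qed

text \<open>Among points of given moduli those on opposite radii are farthest apart, because
  \<open>norm (1 - cnj b * a)\<close> is then largest. The bound is the addition formula of
  \<open>tanh\<close>: this is the triangle inequality through the centre.\<close>

lemma pseudo_dist_le_centre:
  assumes "norm a < 1" "norm b < 1"
  shows "pseudo_dist a b \<le> (norm a + norm b) / (1 + norm a * norm b)"
proof -
  define x y where "x = norm a" and "y = norm b"
  have xy: "0 \<le> x" "x < 1" "0 \<le> y" "y < 1" using assms by (auto simp: x_def y_def)
  hence p: "1 + x * y > 0" by (simp add: add_pos_nonneg)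
  have n: "norm (1 - cnj b * a) \<le> 1 + x * y"
    using norm_triangle_ineq4[of 1 "cnj b * a"] by (simp add: norm_mult x_def y_def mult.commute)
  have "(1 - x\<^sup>2) * (1 - y\<^sup>2) / (1 + x * y)\<^sup>2 \<le> (1 - x\<^sup>2) * (1 - y\<^sup>2) / (norm (1 - cnj b * a))\<^sup>2"
    using xy n one_minus_cnj_mult_nonzero[OF assms]
    by (intro divide_left_mono mult_nonneg_nonneg power_mono mult_pos_pos)
       (auto simp: power_le_one p)
  hence "(1 - x\<^sup>2) * (1 - y\<^sup>2) / (1 + x * y)\<^sup>2 \<le> 1 - (pseudo_dist a b)\<^sup>2"
    unfolding one_minus_pseudo_dist_sq[OF assms] by (simp add: x_def y_def)
  moreover have "(1 - x\<^sup>2) * (1 - y\<^sup>2) / (1 + x * y)\<^sup>2 = 1 - ((x + y) / (1 + x * y))\<^sup>2"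
  proof -
    have "(1 - x\<^sup>2) * (1 - y\<^sup>2) = (1 + x * y)\<^sup>2 - (x + y)\<^sup>2"
      by (simp add: power2_eq_square algebra_simps)
    thus ?thesis using p by (simp add: power_divide diff_divide_distrib)
  qed
  ultimately have "(pseudo_dist a b)\<^sup>2 \<le> ((x + y) / (1 + x * y))\<^sup>2" by simp
  thus ?thesis unfolding x_def[symmetric] y_def[symmetric]
    by (rule power2_le_imp_le) (use xy p in auto)
qed

text \<open>A disc automorphism carries \<open>c\<close> to the centre.\<close>

lemma poincare_dist_triangle:
  assumes a: "norm a < 1" and b: "norm b < 1" and c: "norm c < 1"
  shows "poincare_dist a b \<le> poincare_dist a c + poincare_dist c b"
proof -
  let ?M = "Moebius_function 0 c"
  have n: "norm (?M a) < 1" "norm (?M b) < 1"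
    using Moebius_function_norm_lt_1 assms by auto
  have M0: "?M c = 0" by (rule Moebius_function_eq_zero)
  have 1: "norm (?M a) = pseudo_dist a c" "norm (?M b) = pseudo_dist c b"
    using Moebius_pseudo_dist[OF c a c] Moebius_pseudo_dist[OF c c b] M0 by simp_all
  let ?x = "artanh (norm (?M a))" and ?y = "artanh (norm (?M b))"
  have t: "tanh ?x = norm (?M a)" "tanh ?y = norm (?M b)" using n by (auto intro!: tanh_artanh_real)
  have "pseudo_dist a b \<le> (tanh ?x + tanh ?y) / (1 + tanh ?x * tanh ?y)"
    unfolding t using pseudo_dist_le_centre[OF n] Moebius_pseudo_dist[OF c a b] by simp
  also have "\<dots> = tanh (?x + ?y)" by (rule tanh_add[symmetric]) auto
  finally show ?thesis using poincare_dist_le_iff[OF a b] 1 by (simp add: poincare_dist_alt)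
qed

section \<open>Stability of coarse quasi-geodesics in the disc\<close>

lemma lipschitz_from_local:
  fixes f :: "real \<Rightarrow> 'a::real_normed_vector"
  assumes h: "0 < h"
    and loc: "\<And>s t. s \<in> {a..b} \<Longrightarrow> t \<in> {a..b} \<Longrightarrow> s \<le> t \<Longrightarrow> t - s \<le> h \<Longrightarrow> norm (f s - f t) \<le> K * (t - s)"
    and st: "s \<in> {a..b}" "t \<in> {a..b}" "s \<le> t"
  shows "norm (f s - f t) \<le> K * (t - s)"
proof -
  have "norm (f s - f t) \<le> K * (t - s)"
    if "s \<in> {a..b}" "t \<in> {a..b}" "s \<le> t" "t - s \<le> real n * h" for n s t
    using that
  proof (induction n arbitrary: s)
    case 0
    then show ?case by simp
  next
    case (Suc n)
    show ?case
    proof (cases "t - s \<le> h")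
      case True
      then show ?thesis using loc Suc by auto
    next
      case False
      define r where "r = s + h"
      have r: "r \<in> {a..b}" "r \<le> t" "s \<le> r" "r - s = h" "t - r \<le> real n * h"
        using False Suc.prems h by (auto simp: r_def algebra_simps)
      have "norm (f s - f t) \<le> norm (f s - f r) + norm (f r - f t)"
        by (metis add_diff_cancel_right' diff_add_cancel norm_triangle_ineq add_diff_eq)
      also have "\<dots> \<le> K * (r - s) + K * (t - r)"
        using loc[of s r] Suc.IH[of r] Suc.prems r by (intro add_mono) auto
      finally show ?thesis by (simp add: algebra_simps)
    qed
  qed
  moreover obtain n where "(t - s) / h \<le> real n" using real_arch_simple by blast
  hence "t - s \<le> real n * h" using h by (simp add: pos_divide_le_eq)
  ultimately show ?thesis using st by blast
qed

text \<open>Close to the unit circle small hyperbolic steps are tiny in the Euclidean sense.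
  Expanding \<open>1 - cnj y * x\<close> about \<open>x = y\<close> bounds it by
  \<open>1 - r^2 + norm (x - y)\<close>; as \<tau> is at most 1/2, the last term is absorbed on the
  left.\<close>

lemma norm_diff_le_of_pseudo_dist:
  assumes "norm x < 1" "norm y < 1" "0 \<le> r" "r \<le> norm y" "pseudo_dist x y \<le> \<tau>" "\<tau> \<le> 1/2"
  shows "norm (x - y) \<le> 2 * \<tau> * (1 - r\<^sup>2)"
proof -
  have "1 - cnj y * x = of_real (1 - (norm y)\<^sup>2) - cnj y * (x - y)"
    by (simp only: of_real_diff complex_norm_square of_real_1) (simp add: algebra_simps)
  hence "norm (1 - cnj y * x) \<le> norm (of_real (1 - (norm y)\<^sup>2) :: complex) + norm (cnj y * (x - y))"
    using norm_triangle_ineq4 by metis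
  also have "norm (of_real (1 - (norm y)\<^sup>2) :: complex) = 1 - (norm y)\<^sup>2"
    using assms by (simp only: norm_of_real) (simp add: power_le_one)
  also have "1 - (norm y)\<^sup>2 \<le> 1 - r\<^sup>2" using assms by (simp add: power_mono)
  also have "norm (cnj y * (x - y)) \<le> norm (x - y)"
    using assms by (simp add: norm_mult mult_left_le_one_le)
  finally have *: "norm (1 - cnj y * x) \<le> 1 - r\<^sup>2 + norm (x - y)" by simp
  have tau: "0 \<le> \<tau>" using assms(5) pseudo_dist_nonneg order_trans by blast
  have "norm (x - y) = pseudo_dist x y * norm (1 - cnj y * x)"
    using assms by (intro norm_diff_le_pseudo_dist)
  also have "\<dots> \<le> \<tau> * (1 - r\<^sup>2 + norm (x - y))"
    by (intro mult_mono assms(5) * tau norm_ge_zero)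
  also have "\<dots> \<le> \<tau> * (1 - r\<^sup>2) + 1/2 * norm (x - y)"
    unfolding distrib_left using assms(6) by (intro add_left_mono mult_right_mono) auto
  finally show ?thesis by simp
qed

lemma tanh_ge_half: "1 \<le> x \<Longrightarrow> 1/2 \<le> tanh (x::real)"
proof -
  assume x: "1 \<le> x"
  have "3 \<le> exp (2::real)" using exp_ge_add_one_self[of 2] by simp
  hence "3 * exp (-2::real) \<le> 1" by (simp add: exp_minus field_simps)
  hence "1/2 \<le> tanh (1::real)" by (simp add: tanh_real_altdef field_simps add_pos_pos)
  also have "\<dots> \<le> tanh x" using x by simp
  finally show ?thesis .
qed

lemma pseudo_dist_uminus [simp]: "pseudo_dist (- a) (- b) = pseudo_dist a b"
  by (simp add: pseudo_dist_def norm_divide norm_minus_commute)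

lemma poincare_dist_uminus [simp]: "poincare_dist (- a) (- b) = poincare_dist a b"
  by (simp add: poincare_dist_alt)

text \<open>The ball has radius \<open>S\<close> and its centre is at Poincare distance
  \<open>2 * S\<close> from 0. With \<open>s = tanh S\<close> and
  \<open>t = tanh (2 * S) = 2 s / (1 + s^2)\<close>, the Euclidean deviation \<open>e\<close> from
  the centre is at most \<open>s (1 - t^2) / (1 - s t) = s q\<close>, where
  \<open>q = (1 - s^2) / (1 + s^2)\<close>, and this is at most \<open>t / 2\<close>.\<close>

lemma Re_le_of_poincare_dist:
  assumes w: "norm w < 1" and S: "0 < S"
    and d: "poincare_dist (of_real (- tanh (2 * S))) w \<le> S"
  shows "Re w \<le> - tanh (2 * S) / 2"
proof -
  define s t where "s = tanh S" and "t = tanh (2 * S)"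
  have s: "0 < s" "s < 1" using S tanh_real_lt_1 by (auto simp: s_def)
  have t: "0 < t" "t < 1" using S tanh_real_lt_1 by (auto simp: t_def)
  have ts: "t = 2 * s / (1 + s\<^sup>2)"
    using tanh_add[of S S] by (simp add: s_def t_def power2_eq_square mult_2[symmetric])
  have p: "1 + s\<^sup>2 > 0" by (simp add: add_pos_nonneg)
  define e where "e = norm (w + of_real t)"
  have nt: "norm (of_real (- t) :: complex) < 1" using t by simp
  have "pseudo_dist w (of_real (- t)) \<le> s"
    using d poincare_dist_le_iff[OF w nt, of S] poincare_dist_commute[of w] by (simp add: s_def t_def)
  hence "norm (w - of_real (- t)) \<le> s * norm (1 - cnj (of_real (- t)) * w)"
    unfolding norm_diff_le_pseudo_dist[OF w nt] by (rule mult_right_mono) simp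
  also have "1 - cnj (of_real (- t)) * w = of_real (1 - t\<^sup>2) + of_real t * (w + of_real t)"
    by (simp add: algebra_simps power2_eq_square)
  also have "norm \<dots> \<le> (1 - t\<^sup>2) + t * e"
  proof -
    have "norm (of_real (1 - t\<^sup>2) :: complex) = 1 - t\<^sup>2"
      using t by (simp only: norm_of_real) (simp add: power_le_one)
    moreover have "norm (of_real t * (w + of_real t)) = t * e" using t by (simp add: e_def norm_mult)
    ultimately show ?thesis using norm_triangle_ineq[of "of_real (1 - t\<^sup>2)" "of_real t * (w + of_real t)"] by simp
  qed
  finally have "e \<le> s * ((1 - t\<^sup>2) + t * e)" using s by (simp add: e_def)
  hence e: "e * (1 - s * t) \<le> s * (1 - t\<^sup>2)" by (simp add: algebra_simps)
  have 1: "1 - s * t = (1 - s\<^sup>2) / (1 + s\<^sup>2)" using p by (simp add: ts field_simps power2_eq_square)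
  have 2: "1 - t\<^sup>2 = ((1 - s\<^sup>2) / (1 + s\<^sup>2))\<^sup>2"
  proof -
    have "(1 - s\<^sup>2)\<^sup>2 = (1 + s\<^sup>2)\<^sup>2 - (2 * s)\<^sup>2" by (simp add: power2_eq_square algebra_simps)
    thus ?thesis unfolding ts power_divide using p by (simp add: diff_divide_distrib)
  qed
  define q where "q = (1 - s\<^sup>2) / (1 + s\<^sup>2)"
  have q: "0 < q" "q \<le> 1 / (1 + s\<^sup>2)" using s p by (auto simp: q_def divide_simps power_less_one_iff)
  have "e * q \<le> (s * q) * q" using e unfolding 1 2 q_def[symmetric] by (simp add: power2_eq_square mult.assoc)
  hence "e \<le> s * q" using q(1) by (simp add: mult_le_cancel_right)
  also have "\<dots> \<le> s * (1 / (1 + s\<^sup>2))" using q s by (intro mult_left_mono) auto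
  also have "\<dots> = t / 2" proof -
    have "s * (1 / c) = 2 * s / c / 2" for c by simp
    thus ?thesis unfolding ts .
  qed
  finally have "e \<le> t / 2" .
  moreover have "\<bar>Re (w + of_real t)\<bar> \<le> e" unfolding e_def by (rule abs_Re_le_cmod)
  ultimately show ?thesis by (simp add: t_def)
qed

text \<open>Outside the ball of Poincare radius \<open>S / 2\<close> about 0 the curve has Euclidean
  speed at most \<open>2 * L * (1 - tanh (S / 2)^2)\<close>, which decays exponentially in
  \<open>S\<close>. The other factor, linear in \<open>S\<close>, bounds the time between two points
  at Poincare distance at most \<open>6 * S\<close>.\<close>

definition morse_bound :: "real \<Rightarrow> real \<Rightarrow> real \<Rightarrow> real \<Rightarrow> real" where
  "morse_bound L lam kap S = 2 * L * (1 - (tanh (S / 2))\<^sup>2) * (lam * (6 * S + kap))"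

text \<open>Quasi-geodesics in the form that a conformal pull-back provides: \<open>qi\<close> is
  the lower estimate, while control from above is the speed bound \<open>lip\<close>, available for
  times up to \<open>h\<close>.\<close>

locale disc_quasi_geodesic =
  fixes G :: "real \<Rightarrow> complex" and a b L h lam kap :: real
  assumes ab: "a \<le> b" and in_disc: "\<And>t. t \<in> {a..b} \<Longrightarrow> norm (G t) < 1"
    and params: "0 < h" "0 < L" "L * h \<le> 1/2" "0 < lam" "0 \<le> kap"
    and lip: "\<And>s t. s \<in> {a..b} \<Longrightarrow> t \<in> {a..b} \<Longrightarrow> s \<le> t \<Longrightarrow> t - s \<le> h \<Longrightarrow>
                pseudo_dist (G s) (G t) \<le> L * (t - s)"
    and qi: "\<And>s t. s \<in> {a..b} \<Longrightarrow> t \<in> {a..b} \<Longrightarrow> \<bar>s - t\<bar> \<le> lam * (poincare_dist (G s) (G t) + kap)"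
begin

lemma lipschitz_outside_ball:
  assumes st: "s \<in> {a..b}" "t \<in> {a..b}" "s \<le> t" and r: "0 \<le> r" "\<And>u. u \<in> {s..t} \<Longrightarrow> r \<le> norm (G u)"
  shows "norm (G s - G t) \<le> 2 * L * (1 - r\<^sup>2) * (t - s)"
proof (rule lipschitz_from_local[where a = s and b = t and h = h])
  fix x y assume xy: "x \<in> {s..t}" "y \<in> {s..t}" "x \<le> y" "y - x \<le> h"
  have "L * (y - x) \<le> L * h" using xy params by (intro mult_left_mono) auto
  hence "L * (y - x) \<le> 1/2" using params(3) by (rule order_trans)
  moreover have "pseudo_dist (G x) (G y) \<le> L * (y - x)" using xy st by (intro lip) auto
  ultimately have "norm (G x - G y) \<le> 2 * (L * (y - x)) * (1 - r\<^sup>2)"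
    using xy st r in_disc by (intro norm_diff_le_of_pseudo_dist) auto
  thus "norm (G x - G y) \<le> 2 * L * (1 - r\<^sup>2) * (y - x)" by (simp only: mult_ac)
qed (use st params in auto)

lemma continuous: "continuous_on {a..b} G"
proof (rule lipschitz_on_continuous_on)
  show "(2 * L)-lipschitz_on {a..b} G"
  proof (rule lipschitz_onI)
    fix x y assume xy: "x \<in> {a..b}" "y \<in> {a..b}"
    show "dist (G x) (G y) \<le> 2 * L * dist x y"
      using lipschitz_outside_ball[of x y 0] lipschitz_outside_ball[of y x 0] xy
      by (cases "x \<le> y") (auto simp: dist_norm norm_minus_commute)
  qed (use params in auto)
qed

text \<open>A step of length \<open>h\<close> moves by pseudohyperbolic distance at most 1/2, hence
  by Poincare distance at most 1. The summand 1 pays for rounding up the number of steps.\<close>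

lemma poincare_dist_le_steps:
  assumes st: "s \<in> {a..b}" "t \<in> {a..b}" "s \<le> t"
  shows "poincare_dist (G s) (G t) \<le> (t - s) / h + 1"
proof -
  have "poincare_dist (G s) (G t) \<le> real n"
    if "s \<in> {a..b}" "t \<in> {a..b}" "s \<le> t" "t - s \<le> real n * h" for n s t
    using that
  proof (induction n arbitrary: s)
    case 0
    then show ?case by (simp add: poincare_dist_alt)
  next
    case (Suc n)
    define r where "r = min t (s + h)"
    have r: "r \<in> {a..b}" "r \<le> t" "s \<le> r" "r - s \<le> h" "t - r \<le> real n * h"
      using Suc.prems params by (auto simp: r_def algebra_simps min_def)
    have "L * (r - s) \<le> L * h" using r params by (intro mult_left_mono) auto
    moreover have "pseudo_dist (G s) (G r) \<le> L * (r - s)" using Suc.prems r by (intro lip) auto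
    ultimately have "pseudo_dist (G s) (G r) \<le> 1/2" using params(3) by linarith
    also have "\<dots> \<le> tanh 1" by (rule tanh_ge_half) simp
    finally have "poincare_dist (G s) (G r) \<le> 1"
      using Suc.prems r in_disc by (subst poincare_dist_le_iff) auto
    moreover have "poincare_dist (G r) (G t) \<le> real n" using Suc.IH[of r] Suc.prems r by auto
    moreover have "poincare_dist (G s) (G t) \<le> poincare_dist (G s) (G r) + poincare_dist (G r) (G t)"
      using Suc.prems r in_disc by (intro poincare_dist_triangle) auto
    ultimately show ?case by simp
  qed
  from this[OF st, of "nat \<lceil>(t - s) / h\<rceil>"]
  have "poincare_dist (G s) (G t) \<le> real (nat \<lceil>(t - s) / h\<rceil>)"
    using real_nat_ceiling_ge[of "(t - s) / h"] params by (simp add: field_simps)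
  also have "\<dots> \<le> (t - s) / h + 1"
  proof -
    have "0 \<le> (t - s) / h" using st params by simp
    thus ?thesis by linarith
  qed
  finally show ?thesis .
qed

lemma Moebius_image:
  assumes "norm w < 1"
  shows "disc_quasi_geodesic (\<lambda>t. Moebius_function 0 w (G t)) a b L h lam kap"
proof
  show "norm (Moebius_function 0 w (G t)) < 1" if "t \<in> {a..b}" for t
    using that assms in_disc Moebius_function_norm_lt_1 by blast
  show "pseudo_dist (Moebius_function 0 w (G s)) (Moebius_function 0 w (G t)) \<le> L * (t - s)"
    if "s \<in> {a..b}" "t \<in> {a..b}" "s \<le> t" "t - s \<le> h" for s t
    using that lip[of s t] Moebius_pseudo_dist[OF assms in_disc in_disc, of s t] by simp
  show "\<bar>s - t\<bar> \<le> lam * (poincare_dist (Moebius_function 0 w (G s)) (Moebius_function 0 w (G t)) + kap)"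
    if "s \<in> {a..b}" "t \<in> {a..b}" for s t
    using that qi[of s t] Moebius_pseudo_dist[OF assms in_disc in_disc, of s t]
    by (simp add: poincare_dist_alt)
qed (use ab params in auto)

lemma uminus_image: "disc_quasi_geodesic (\<lambda>t. - G t) a b L h lam kap"
  using ab in_disc params lip qi by unfold_locales auto

text \<open>The point found is clearly left of 0 but not too deep. If the end lies deeper than
  \<open>tanh (2 * S)\<close>, the diameter point at Poincare distance \<open>2 * S\<close> from 0
  has a curve point within \<open>S\<close>, whence \<open>3 * S\<close>.\<close>

lemma far_left_point:
  assumes te: "te \<in> {a..b}" "G te = of_real (- \<alpha>)" and al: "tanh (S / 2) < \<alpha>" "\<alpha> < 1" and S: "2 \<le> S"
    and close: "\<And>x. x \<in> {- \<alpha>..0} \<Longrightarrow> \<exists>t\<in>{a..b}. poincare_dist (of_real x) (G t) \<le> S"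
  shows "\<exists>t\<in>{a..b}. Re (G t) \<le> - 1/4 \<and> poincare_dist 0 (G t) \<le> 3 * S"
proof (cases "\<alpha> \<le> tanh (2 * S)")
  case True
  have "1/2 \<le> tanh (S / 2)" using S by (intro tanh_ge_half) simp
  hence "1/2 < \<alpha>" using al by simp
  moreover have "poincare_dist 0 (G te) \<le> 3 * S"
    using True in_disc[OF te(1)] \<open>1/2 < \<alpha>\<close> S tanh_real_le_iff[of "2 * S" "3 * S"]
    by (subst poincare_dist_le_iff) (auto simp: te intro: order_trans)
  ultimately show ?thesis using te by (intro bexI[of _ te]) auto
next
  case False
  have p: "1/2 \<le> tanh (2 * S)" using S by (intro tanh_ge_half) simp
  obtain t where t: "t \<in> {a..b}" "poincare_dist (of_real (- tanh (2 * S))) (G t) \<le> S"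
    using close[of "- tanh (2 * S)"] False p S by auto
  have n: "norm (of_real (- tanh (2 * S)) :: complex) < 1" using False al p by simp
  have "Re (G t) \<le> - tanh (2 * S) / 2"
    using Re_le_of_poincare_dist[OF in_disc[OF t(1)] _ t(2)] S by simp
  moreover have "poincare_dist 0 (G t) \<le> poincare_dist 0 (of_real (- tanh (2 * S))) + S"
    using poincare_dist_triangle[OF _ in_disc[OF t(1)] n, of 0] t by simp
  moreover have "poincare_dist 0 (of_real (- tanh (2 * S))) \<le> 2 * S"
    using n p S by (subst poincare_dist_le_iff) auto
  ultimately show ?thesis using t p by (intro bexI[of _ t]) auto
qed

text \<open>A curve avoiding the ball has to go round it near the unit circle, from a left point to
  a right point at Euclidean distance at least 1/2, in time at most
  \<open>lam * (6 * S + kap)\<close>. Its Euclidean speed there is too small unless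
  \<open>morse_bound\<close> is large.\<close>

lemma avoiding_ball_estimate:
  assumes ends: "G a = of_real (- \<alpha>)" "G b = of_real \<beta>" "0 \<le> \<alpha>" "0 \<le> \<beta>" and S: "2 \<le> S"
    and close: "\<And>x. x \<in> {- \<alpha>..\<beta>} \<Longrightarrow> \<exists>t\<in>{a..b}. poincare_dist (of_real x) (G t) \<le> S"
    and avoid: "\<And>t. t \<in> {a..b} \<Longrightarrow> tanh (S / 2) < norm (G t)"
  shows "1/2 \<le> morse_bound L lam kap S"
proof -
  have mem: "a \<in> {a..b}" "b \<in> {a..b}" using ab by auto
  obtain t1 where t1: "t1 \<in> {a..b}" "Re (G t1) \<le> - 1/4" "poincare_dist 0 (G t1) \<le> 3 * S"
    using far_left_point[OF mem(1) ends(1) _ _ S] close avoid[OF mem(1)] in_disc[OF mem(1)] ends by auto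
  \<comment> \<open>The right point is the left point of the reflected curve.\<close>
  interpret neg: disc_quasi_geodesic "\<lambda>t. - G t" a b L h lam kap by (rule uminus_image)
  have "\<exists>t\<in>{a..b}. poincare_dist (of_real x) (- G t) \<le> S" if "x \<in> {- \<beta>..0}" for x
    using close[of "- x"] that ends poincare_dist_uminus[of "of_real (- x)"]
    by (auto simp del: poincare_dist_uminus)
  then obtain t2 where t2: "t2 \<in> {a..b}" "1/4 \<le> Re (G t2)" "poincare_dist 0 (G t2) \<le> 3 * S"
    using neg.far_left_point[OF mem(2), of \<beta> S] avoid[OF mem(2)] in_disc[OF mem(2)] ends S
      poincare_dist_uminus[of 0] by auto
  have "poincare_dist (G t1) (G t2) \<le> 6 * S"
    using poincare_dist_triangle[OF in_disc[OF t1(1)] in_disc[OF t2(1)], of 0] t1 t2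
    by (simp add: poincare_dist_commute[of _ 0])
  hence "lam * (poincare_dist (G t1) (G t2) + kap) \<le> lam * (6 * S + kap)"
    using params by (intro mult_left_mono) auto
  hence T: "\<bar>t1 - t2\<bar> \<le> lam * (6 * S + kap)" using qi[OF t1(1) t2(1)] by simp
  let ?r = "tanh (S / 2)"
  have r: "0 \<le> ?r" using S by simp
  have "1/2 \<le> \<bar>Re (G t1 - G t2)\<bar>" using t1 t2 by simp
  also have "\<dots> \<le> norm (G t1 - G t2)" by (rule abs_Re_le_cmod)
  also have "\<dots> \<le> 2 * L * (1 - ?r\<^sup>2) * \<bar>t1 - t2\<bar>"
  proof (cases "t1 \<le> t2")
    case True
    have "norm (G t1 - G t2) \<le> 2 * L * (1 - ?r\<^sup>2) * (t2 - t1)"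
      using t1 t2 by (intro lipschitz_outside_ball True r less_imp_le[OF avoid]) auto
    thus ?thesis using True by simp
  next
    case False
    hence "t2 \<le> t1" by simp
    have "norm (G t2 - G t1) \<le> 2 * L * (1 - ?r\<^sup>2) * (t1 - t2)"
      using t1 t2 by (intro lipschitz_outside_ball \<open>t2 \<le> t1\<close> r less_imp_le[OF avoid]) auto
    thus ?thesis using \<open>t2 \<le> t1\<close> by (simp add: norm_minus_commute)
  qed
  also have "\<dots> \<le> 2 * L * (1 - ?r\<^sup>2) * (lam * (6 * S + kap))"
    using T r params tanh_real_lt_1[of "S/2"] by (intro mult_left_mono) (auto simp: power_le_one)
  finally show ?thesis by (simp add: morse_bound_def)
qed

text \<open>The self-improving step: after moving \<open>x0\<close> to 0 by a disc automorphism, a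
  curve that stays farther than \<open>S / 2\<close> from it contradicts
  \<open>avoiding_ball_estimate\<close>.\<close>

lemma close_halving:
  assumes ends: "G a = 0" "G b = of_real Y" "0 \<le> Y" and S: "2 \<le> S"
    and big: "morse_bound L lam kap S < 1/2"
    and close: "\<And>x. x \<in> {0..Y} \<Longrightarrow> \<exists>t\<in>{a..b}. poincare_dist (of_real x) (G t) \<le> S"
    and x0: "x0 \<in> {0..Y}"
  shows "\<exists>t\<in>{a..b}. poincare_dist (of_real x0) (G t) \<le> S / 2"
proof (rule ccontr)
  assume "\<not> ?thesis"
  hence far: "\<not> poincare_dist (of_real x0) (G t) \<le> S / 2" if "t \<in> {a..b}" for t using that by blast
  have Y: "Y < 1" using in_disc[of b] ab ends by auto
  have n0: "norm (of_real x0 :: complex) < 1" using x0 Y by simp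
  let ?M = "Moebius_function 0 (of_real x0)"
  interpret M: disc_quasi_geodesic "\<lambda>t. ?M (G t)" a b L h lam kap using Moebius_image[OF n0] .
  have d: "1 - x0 * Y > 0" using x0 Y by (smt (verit) atLeastAtMost_iff mult_left_le)
  have "1/2 \<le> morse_bound L lam kap S"
  proof (rule M.avoiding_ball_estimate)
    show "?M (G a) = of_real (- x0)" by (simp add: ends Moebius_function_simple)
    show "?M (G b) = of_real ((Y - x0) / (1 - x0 * Y))" by (simp add: ends Moebius_function_simple)
    show "0 \<le> x0" "0 \<le> (Y - x0) / (1 - x0 * Y)" using x0 d by auto
    show "tanh (S / 2) < norm (?M (G t))" if t: "t \<in> {a..b}" for t
    proof -
      have "norm (?M (G t)) = pseudo_dist (of_real x0) (G t)"
        using Moebius_pseudo_dist[OF n0 n0 in_disc[OF t]] by (simp add: Moebius_function_eq_zero)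
      thus ?thesis using far[OF t] unfolding poincare_dist_le_iff[OF n0 in_disc[OF t]] by linarith
    qed
    fix x assume x: "x \<in> {- x0..(Y - x0) / (1 - x0 * Y)}"
    \<comment> \<open>The preimage of \<open>x\<close> under the automorphism. It lies between 0 and
      \<open>Y\<close>, so that the hypothesis \<open>close\<close> applies to it.\<close>
    define y where "y = (x + x0) / (1 + x0 * x)"
    have "x * (1 - x0 * Y) \<le> Y - x0" using x d by (simp add: field_simps)
    hence xY: "x + x0 \<le> Y * (1 + x0 * x)" by (simp add: algebra_simps)
    have x1: "\<bar>x\<bar> < 1"
    proof -
      have "(Y - x0) / (1 - x0 * Y) < 1"
      proof -
        have "0 < (1 - Y) * (1 + x0)" using Y x0 by (intro mult_pos_pos) auto
        thus ?thesis using d by (simp add: field_simps)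
      qed
      thus ?thesis using x x0 Y by auto
    qed
    have "\<bar>x0 * x\<bar> < 1" using x1 x0 Y by (simp add: abs_mult) (smt (verit) mult_left_le)
    hence e: "1 + x0 * x > 0" by auto
    have y: "y \<in> {0..Y}" using xY e x by (auto simp: y_def field_simps)
    have "?M (of_real y) = of_real x"
    proof -
      have "(y - x0) / (1 - x0 * y) = x"
      proof -
        have "1 - x0 * y = (1 - x0\<^sup>2) / (1 + x0 * x)" "y - x0 = x * (1 - x0\<^sup>2) / (1 + x0 * x)"
          using e by (simp_all add: y_def field_simps power2_eq_square)
        moreover have "1 - x0\<^sup>2 > 0" using x0 Y by (simp add: power_less_one_iff abs_square_less_1)
        ultimately show ?thesis using e by simp
      qed
      hence "of_real ((y - x0) / (1 - x0 * y)) = (of_real x :: complex)" by simp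
      thus ?thesis by (simp add: Moebius_function_simple)
    qed
    moreover obtain t where t: "t \<in> {a..b}" "poincare_dist (of_real y) (G t) \<le> S" using close y by blast
    moreover have "norm (of_real y :: complex) < 1" using y Y by simp
    ultimately show "\<exists>t\<in>{a..b}. poincare_dist (of_real x) (?M (G t)) \<le> S"
      using Moebius_pseudo_dist[OF n0 _ in_disc[OF t(1)], of "of_real y"]
      by (intro bexI[OF _ t(1)]) (simp add: poincare_dist_alt)
  qed (use S in auto)
  thus False using big by simp
qed

text \<open>The starting point \<open>G a = 0\<close> alone gives closeness within the Poincare
  distance from 0 to \<open>Y\<close>. Repeated halving brings this down to \<open>N\<close>, which
  does not depend on \<open>Y\<close>.\<close>

lemma geodesic_close:
  assumes ends: "G a = 0" "G b = of_real Y" "0 \<le> Y" and N: "2 \<le> N"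
    and big: "\<And>S. N \<le> S \<Longrightarrow> morse_bound L lam kap S < 1/2"
    and x: "x \<in> {0..Y}"
  shows "\<exists>t\<in>{a..b}. poincare_dist (of_real x) (G t) \<le> N"
proof -
  have Y: "Y < 1" using in_disc[of b] ab ends by auto
  have step: "\<forall>x\<in>{0..Y}. \<exists>t\<in>{a..b}. poincare_dist (of_real x) (G t) \<le> N" if "S \<le> 2 ^ n * N"
      "\<forall>x\<in>{0..Y}. \<exists>t\<in>{a..b}. poincare_dist (of_real x) (G t) \<le> S" for S n
    using that
  proof (induction n arbitrary: S)
    case 0
    then show ?case by force
  next
    case (Suc n)
    show ?case
    proof (cases "S \<le> N")
      case True
      then show ?thesis using Suc.prems by force
    next
      case False
      have "\<forall>x\<in>{0..Y}. \<exists>t\<in>{a..b}. poincare_dist (of_real x) (G t) \<le> S / 2"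
        using close_halving[OF ends, of S] False N big[of S] Suc.prems by auto
      then show ?thesis using Suc.IH[of "S / 2"] Suc.prems by simp
    qed
  qed
  have start: "\<forall>x\<in>{0..Y}. \<exists>t\<in>{a..b}. poincare_dist (of_real x) (G t) \<le> poincare_dist (of_real Y) 0"
  proof
    fix x assume x: "x \<in> {0..Y}"
    have "\<bar>Y\<bar> < 1" using Y ends by auto
    hence "x \<le> tanh (artanh Y)" using x by (simp add: tanh_artanh_real)
    hence "poincare_dist (of_real x) (G a) \<le> poincare_dist (of_real Y) 0"
      using x Y ends by (subst poincare_dist_le_iff) (auto simp: poincare_dist_alt)
    thus "\<exists>t\<in>{a..b}. poincare_dist (of_real x) (G t) \<le> poincare_dist (of_real Y) 0"
      using ab by (intro bexI[of _ a]) auto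
  qed
  obtain n where "poincare_dist (of_real Y) 0 < 2 ^ n"
    using real_arch_pow[of 2 "poincare_dist (of_real Y) 0"] by auto
  moreover have "(2::real) ^ n * 1 \<le> 2 ^ n * N" using N by (intro mult_left_mono) auto
  ultimately have "poincare_dist (of_real Y) 0 \<le> 2 ^ n * N" by linarith
  from step[OF this start] x show ?thesis by (rule bspec)
qed

text \<open>The points of the segment close to the past of \<open>u\<close> and those close to its
  future form two nonempty closed sets covering the segment, so some \<open>x\<close> is close to
  both. The two curve points close to \<open>x\<close> are then within \<open>2 * N\<close> of each
  other, hence close in time, and \<open>u\<close> lies between their times.\<close>

lemma close_to_geodesic:
  assumes ends: "G a = 0" "G b = of_real Y" "0 \<le> Y" and N: "2 \<le> N"
    and big: "\<And>S. N \<le> S \<Longrightarrow> morse_bound L lam kap S < 1/2"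
    and u: "u \<in> {a..b}"
  shows "\<exists>x\<in>{0..Y}. poincare_dist (of_real x) (G u) \<le> N + (lam * (2 * N + kap) / h + 1)"
proof -
  have Y: "Y < 1" using in_disc[of b] ab ends by auto
  define P where "P I = {x \<in> {0..Y}. \<exists>t\<in>I. poincare_dist (of_real x) (G t) \<le> N}" for I
  have closed: "closed (P {c..d})" if "{c..d} \<subseteq> {a..b}" for c d
  proof -
    \<comment> \<open>Closedness of the set of \<open>x\<close> comes from projecting a compact set
      of pairs.\<close>
    define K where "K = {0..Y} \<times> {c..d} \<inter> (\<lambda>(x, t). pseudo_dist (of_real x) (G t)) -` {..tanh N}"
    have "continuous_on ({0..Y} \<times> {c..d}) (\<lambda>(x, t). pseudo_dist (of_real x) (G t))"
    proof -
      have G: "continuous_on ({0..Y} \<times> {c..d}) (\<lambda>z. G (snd z))"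
        using that by (intro continuous_on_compose2[OF continuous]) (auto intro!: continuous_intros)
      have nz: "\<forall>z\<in>{0..Y} \<times> {c..d}. 1 - cnj (G (snd z)) * of_real (fst z) \<noteq> 0"
      proof
        fix z assume z: "z \<in> {0..Y} \<times> {c..d}"
        hence "snd z \<in> {a..b}" "fst z \<in> {0..Y}" using that by auto
        thus "1 - cnj (G (snd z)) * of_real (fst z) \<noteq> 0"
          using Y by (intro one_minus_cnj_mult_nonzero in_disc) auto
      qed
      have c: "continuous_on ({0..Y} \<times> {c..d}) (\<lambda>z. complex_of_real (fst z))"
        by (intro continuous_on_of_real continuous_on_fst continuous_on_id)
      have n: "continuous_on ({0..Y} \<times> {c..d}) (\<lambda>z. of_real (fst z) - G (snd z))"
        by (rule continuous_on_diff[OF c G])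
      have m: "continuous_on ({0..Y} \<times> {c..d}) (\<lambda>z. 1 - cnj (G (snd z)) * of_real (fst z))"
        by (rule continuous_on_diff[OF continuous_on_const continuous_on_mult[OF continuous_on_cnj[OF G] c]])
      show ?thesis using continuous_on_norm[OF continuous_on_divide[OF n m nz]]
        by (simp only: pseudo_dist_def split_def)
    qed
    hence "closed K" unfolding K_def
      by (intro continuous_closed_preimage closed_Times) auto
    hence "compact (({0..Y} \<times> {c..d}) \<inter> K)" by (intro compact_Int_closed compact_Times) auto
    hence "compact (fst ` (({0..Y} \<times> {c..d}) \<inter> K))"
      by (intro compact_continuous_image continuous_intros)
    also have "fst ` (({0..Y} \<times> {c..d}) \<inter> K) = P {c..d}"
    proof -
      have "poincare_dist (of_real x) (G t) \<le> N \<longleftrightarrow> pseudo_dist (of_real x) (G t) \<le> tanh N"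
        if "x \<in> {0..Y}" "t \<in> {c..d}" for x t
        using that \<open>{c..d} \<subseteq> {a..b}\<close> Y in_disc by (intro poincare_dist_le_iff) auto
      hence "z \<in> K \<longleftrightarrow> poincare_dist (of_real (fst z)) (G (snd z)) \<le> N"
        if "z \<in> {0..Y} \<times> {c..d}" for z
        using that by (auto simp: K_def)
      hence "({0..Y} \<times> {c..d}) \<inter> K = {z \<in> {0..Y} \<times> {c..d}. poincare_dist (of_real (fst z)) (G (snd z)) \<le> N}"
        by blast
      moreover have img: "fst ` {z \<in> A \<times> B. Q (fst z) (snd z)} = {x \<in> A. \<exists>t\<in>B. Q x t}"
        for A B and Q :: "real \<Rightarrow> real \<Rightarrow> bool"
        by force
      ultimately show ?thesis unfolding P_def
        by (simp only: img[of "{0..Y}" "{c..d}" "\<lambda>x t. poincare_dist (of_real x) (G t) \<le> N"])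
    qed
    finally show ?thesis by (rule compact_imp_closed)
  qed
  have cl: "closed (P {a..u})" "closed (P {u..b})" using u by (auto intro!: closed)
  have nn: "0 \<le> N" using N by simp
  have "0 \<in> P {a..u}" using u ends nn by (auto simp: P_def poincare_dist_alt intro!: bexI[of _ a])
  moreover have "Y \<in> P {u..b}" using u ends nn by (auto simp: P_def poincare_dist_alt intro!: bexI[of _ b])
  moreover have "0 \<in> {0..Y}" "Y \<in> {0..Y}" using ends by auto
  moreover have "{0..Y} \<subseteq> P {a..u} \<union> P {u..b}"
  proof
    fix x assume x: "x \<in> {0..Y}"
    obtain t where "t \<in> {a..b}" "poincare_dist (of_real x) (G t) \<le> N"
      using geodesic_close[OF ends N big x] by blast
    thus "x \<in> P {a..u} \<union> P {u..b}" using x by (cases "t \<le> u") (auto simp: P_def)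
  qed
  ultimately have "P {a..u} \<inter> P {u..b} \<inter> {0..Y} \<noteq> {}"
    using connected_closedD[OF connected_Icc[of 0 Y] _ _ cl] by blast
  then obtain x t1 t2 where x: "x \<in> {0..Y}" and t1: "t1 \<in> {a..u}" "poincare_dist (of_real x) (G t1) \<le> N"
    and t2: "t2 \<in> {u..b}" "poincare_dist (of_real x) (G t2) \<le> N"
    unfolding P_def by blast
  have m: "t1 \<in> {a..b}" "t2 \<in> {a..b}" using t1 t2 u by auto
  have nx: "norm (of_real x :: complex) < 1" using x Y by simp
  have "poincare_dist (G t1) (G t2) \<le> 2 * N"
    using poincare_dist_triangle[OF in_disc[OF m(1)] in_disc[OF m(2)] nx] t1 t2
    by (simp add: poincare_dist_commute[of "G t1"])
  hence "lam * (poincare_dist (G t1) (G t2) + kap) \<le> lam * (2 * N + kap)"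
    using params by (intro mult_left_mono) auto
  hence "u - t1 \<le> lam * (2 * N + kap)" using qi[OF m] t2 t1 by auto
  hence "(u - t1) / h \<le> lam * (2 * N + kap) / h" using params by (intro divide_right_mono) auto
  moreover have "poincare_dist (G t1) (G u) \<le> (u - t1) / h + 1"
    using poincare_dist_le_steps[OF m(1) u] t1 by auto
  moreover have "poincare_dist (of_real x) (G u) \<le> poincare_dist (of_real x) (G t1) + poincare_dist (G t1) (G u)"
    using nx in_disc u m by (intro poincare_dist_triangle) auto
  ultimately show ?thesis using x t1 by (intro bexI[of _ x]) auto
qed

end

lemma exists_Morse_constant:
  fixes L lam kap :: real
  shows "\<exists>N\<ge>2. \<forall>S\<ge>N. morse_bound L lam kap S < 1/2"
proof -
  have "((\<lambda>S. morse_bound L lam kap S) \<longlongrightarrow> 0) at_top"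
    unfolding morse_bound_def tanh_real_altdef by real_asymp
  hence "\<forall>\<^sub>F S in at_top. morse_bound L lam kap S < 1/2"
    by (rule order_tendstoD) simp
  then obtain N where "\<forall>S\<ge>N. morse_bound L lam kap S < 1/2"
    unfolding eventually_at_top_linorder by blast
  thus ?thesis by (intro exI[of _ "max 2 N"]) auto
qed

section \<open>Absolutely continuous curves\<close>

text \<open>Absolute continuity is stated for numbered families of intervals; this form fits the
  intervals of a tagged division.\<close>

lemma absolutely_continuous_path_finite_sum:
  assumes bound: "\<forall>(n::nat) a b. (\<forall>i<n. a i \<in> I \<and> b i \<in> I \<and> a i \<le> b i) \<and>
        (\<forall>i<n. \<forall>j<n. i \<noteq> j \<longrightarrow> {a i<..<b i} \<inter> {a j<..<b j} = {}) \<and>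
        (\<Sum>i<n. b i - a i) < \<delta> \<longrightarrow> (\<Sum>i<n. norm (\<sigma> (b i) - \<sigma> (a i))) < \<epsilon>"
    and fin: "finite P" and I: "\<And>x. x \<in> P \<Longrightarrow> c x \<in> I \<and> d x \<in> I \<and> c x \<le> d x"
    and disj: "\<And>x y. x \<in> P \<Longrightarrow> y \<in> P \<Longrightarrow> x \<noteq> y \<Longrightarrow> {c x<..<d x} \<inter> {c y<..<d y} = {}"
    and len: "(\<Sum>x\<in>P. d x - c x) < \<delta>"
  shows "(\<Sum>x\<in>P. norm (\<sigma> (d x) - \<sigma> (c x :: real) :: complex)) < \<epsilon>"
proof -
  obtain g where g: "bij_betw g {..<card P} P"
    using ex_bij_betw_nat_finite[OF fin] by (auto simp: atLeast0LessThan)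
  have gP: "g i \<in> P" if "i < card P" for i using g that by (auto simp: bij_betw_def)
  have gne: "g i \<noteq> g j" if "i < card P" "j < card P" "i \<noteq> j" for i j
    using g that by (auto simp: bij_betw_def inj_on_def)
  have s: "(\<Sum>i<card P. f (g i)) = (\<Sum>x\<in>P. f x)" for f :: "_ \<Rightarrow> real"
    using sum.reindex_bij_betw[OF g, of f] .
  have "(\<Sum>i<card P. norm (\<sigma> (d (g i)) - \<sigma> (c (g i)))) < \<epsilon>"
    using I[OF gP] disj[OF gP gP gne] len
    by (intro bound[rule_format, of "card P" "\<lambda>i. c (g i)" "\<lambda>i. d (g i)"])
       (auto simp: s[of "\<lambda>x. d x - c x"])
  thus ?thesis by (simp add: s[of "\<lambda>x. norm (\<sigma> (d x) - \<sigma> (c x))"])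
qed

text \<open>Cousin's lemma: the exceptional tags lie in an open set so small that absolute continuity
  controls the increments of \<open>\<sigma>\<close> over the corresponding intervals.\<close>

lemma absolutely_continuous_path_lipschitz:
  assumes AC: "absolutely_continuous_path I \<sigma>" and sub: "{a..b} \<subseteq> I" and ab: "a \<le> b" and M: "0 \<le> M"
    and AE: "AE t in lborel. t \<in> {a..b} \<longrightarrow> (\<exists>v. (\<sigma> has_vector_derivative v) (at t within I) \<and> norm v \<le> M)"
  shows "norm (\<sigma> b - \<sigma> a) \<le> M * (b - a)"
proof -
  have main: "norm (\<sigma> b - \<sigma> a) \<le> (M + e) * (b - a) + e" if e: "e > 0" for e
  proof -
    obtain \<delta> where \<delta>: "\<delta> > 0" and bound: "\<forall>(n::nat) a b. (\<forall>i<n. a i \<in> I \<and> b i \<in> I \<and> a i \<le> b i) \<and>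
        (\<forall>i<n. \<forall>j<n. i \<noteq> j \<longrightarrow> {a i<..<b i} \<inter> {a j<..<b j} = {}) \<and>
        (\<Sum>i<n. b i - a i) < \<delta> \<longrightarrow> (\<Sum>i<n. norm (\<sigma> (b i) - \<sigma> (a i))) < e"
      using AC e unfolding absolutely_continuous_path_def by blast
    obtain N where N: "N \<in> null_sets lborel"
      "{t. \<not> (t \<in> {a..b} \<longrightarrow> (\<exists>v. (\<sigma> has_vector_derivative v) (at t within I) \<and> norm v \<le> M))} \<subseteq> N"
      using AE unfolding eventually_ae_filter by auto
    have N0: "N \<in> null_sets lebesgue" using N(1) by (rule null_sets_completionI)
    obtain Q where Q0: "open Q" "N \<subseteq> Q" "emeasure lebesgue (Q - N) < ennreal \<delta>"
      using sets_lebesgue_outer_open[OF null_setsD2[OF N0] \<delta>] by metis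
    have Qs: "Q \<in> sets lebesgue" using Q0(1) by (simp add: borel_open)
    have "emeasure lebesgue Q < ennreal \<delta>" using Q0(3) emeasure_Diff_null_set[OF N0 Qs] by simp
    moreover from this have "Q \<in> lmeasurable"
      using Qs by (intro fmeasurableI) (auto elim: order_less_trans)
    ultimately have Q: "open Q" "N \<subseteq> Q" "Q \<in> lmeasurable" "measure lebesgue Q < \<delta>"
      using Q0 \<delta> by (auto simp: emeasure_eq_measure2 ennreal_less_iff)
    have "\<exists>r>0. \<forall>y\<in>I. \<bar>y - x\<bar> < r \<longrightarrow> norm (\<sigma> y - \<sigma> x) \<le> (M + e) * \<bar>y - x\<bar>"
      if x: "x \<in> {a..b}" "x \<notin> N" for x
    proof -
      obtain v where v: "(\<sigma> has_vector_derivative v) (at x within I)" "norm v \<le> M" using x N by auto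
      then obtain r where r: "r > 0"
        "\<And>y. y \<in> I \<Longrightarrow> norm (y - x) < r \<Longrightarrow> norm (\<sigma> y - \<sigma> x - (y - x) *\<^sub>R v) \<le> e * norm (y - x)"
        unfolding has_vector_derivative_def has_derivative_within_alt using e by blast
      have "norm (\<sigma> y - \<sigma> x) \<le> (M + e) * \<bar>y - x\<bar>" if y: "y \<in> I" "\<bar>y - x\<bar> < r" for y
      proof -
        have "norm (\<sigma> y - \<sigma> x) \<le> norm (\<sigma> y - \<sigma> x - (y - x) *\<^sub>R v) + norm ((y - x) *\<^sub>R v)"
          by (metis diff_add_cancel norm_triangle_ineq)
        also have "\<dots> \<le> e * \<bar>y - x\<bar> + \<bar>y - x\<bar> * M"
          using r(2)[of y] y v by (intro add_mono) (auto intro: mult_left_mono)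
        finally show ?thesis by (simp add: algebra_simps)
      qed
      thus ?thesis using r by blast
    qed
    then obtain r where r: "\<And>x. x \<in> {a..b} \<Longrightarrow> x \<notin> N \<Longrightarrow> r x > 0"
      "\<And>x y. x \<in> {a..b} \<Longrightarrow> x \<notin> N \<Longrightarrow> y \<in> I \<Longrightarrow> \<bar>y - x\<bar> < r x \<Longrightarrow> norm (\<sigma> y - \<sigma> x) \<le> (M + e) * \<bar>y - x\<bar>"
      by metis
    \<comment> \<open>Around a good tag the derivative controls the increments; at an exceptional
      tag the interval is forced into \<open>Q\<close>. The radius 1 is a default value at points
      outside \<open>{a..b}\<close>.\<close>
    define \<gamma> where "\<gamma> x = (if x \<in> N then Q else if x \<in> {a..b} then ball x (r x) else ball x 1)" for x
    have "gauge \<gamma>" unfolding gauge_def \<gamma>_def using Q r by auto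
    then obtain p where p: "p tagged_division_of {a..b}" "\<gamma> fine p"
      using fine_division_exists_real by blast
    have fin: "finite p" using p(1) by blast
    have K: "x \<in> K \<and> K = {Inf K..Sup K} \<and> Inf K \<le> Sup K \<and> K \<subseteq> {a..b} \<and> x \<in> {a..b}" if xKp: "(x, K) \<in> p" for x K
    proof -
      obtain c d where K: "K = {c..d}" using tagged_division_ofD(4)[OF p(1) xKp] by (metis cbox_interval)
      have xK: "x \<in> K" "K \<subseteq> {a..b}" using tagged_division_ofD(2,3)[OF p(1) xKp] by auto
      hence "c \<le> d" using K by auto
      thus ?thesis using K xK by auto
    qed
    have disj: "{Inf K<..<Sup K} \<inter> {Inf L<..<Sup L} = {}" if "(x, K) \<in> p" "(y, L) \<in> p" "(x, K) \<noteq> (y, L)" for x y K L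
    proof -
      have "interior K \<inter> interior L = {}" using tagged_division_ofD(5)[OF p(1)] that by blast
      thus ?thesis using K[OF that(1)] K[OF that(2)] interior_atLeastAtMost_real by metis
    qed
    define P where "P = {z \<in> p. fst z \<in> N}"
    let ?f = "\<lambda>z. norm (\<sigma> (Sup (snd z)) - \<sigma> (Inf (snd z)))"
    let ?l = "\<lambda>z. Sup (snd z) - Inf (snd z) :: real"
    have "(\<Sum>z\<in>P. ?f z) < e"
    proof (rule absolutely_continuous_path_finite_sum[OF bound])
      show finP: "finite P" using fin by (simp add: P_def)
      show "Inf (snd z) \<in> I \<and> Sup (snd z) \<in> I \<and> Inf (snd z) \<le> Sup (snd z)" if "z \<in> P" for z
      proof -
        have "(fst z, snd z) \<in> p" using that by (simp add: P_def)
        from K[OF this] have "{Inf (snd z)..Sup (snd z)} \<subseteq> I" "Inf (snd z) \<le> Sup (snd z)"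
          using sub by (metis order_trans)+
        thus ?thesis by (auto simp: subset_iff)
      qed
      show dP: "{Inf (snd z)<..<Sup (snd z)} \<inter> {Inf (snd w)<..<Sup (snd w)} = {}"
        if "z \<in> P" "w \<in> P" "z \<noteq> w" for z w
        using disj[of "fst z" "snd z" "fst w" "snd w"] that by (auto simp: P_def)
      have "(\<Sum>z\<in>P. ?l z) = (\<Sum>z\<in>P. measure lebesgue {Inf (snd z)<..<Sup (snd z)})"
        using K by (intro sum.cong) (auto simp: P_def)
      also have "\<dots> = measure lebesgue (\<Union>z\<in>P. {Inf (snd z)<..<Sup (snd z)})"
      proof (rule measure_finite_Union[symmetric])
        show "disjoint_family_on (\<lambda>z. {Inf (snd z)<..<Sup (snd z)}) P"
          unfolding disjoint_family_on_def by (intro ballI impI dP)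
        fix z assume "z \<in> P"
        hence "(fst z, snd z) \<in> p" by (simp add: P_def)
        hence "Inf (snd z) \<le> Sup (snd z)" using K by blast
        thus "emeasure lebesgue {Inf (snd z)<..<Sup (snd z)} \<noteq> \<infinity>" by simp
      qed (use finP in auto)
      also have "\<dots> \<le> measure lebesgue Q"
      proof (rule measure_mono_fmeasurable)
        show "(\<Union>z\<in>P. {Inf (snd z)<..<Sup (snd z)}) \<subseteq> Q"
        proof (rule UN_least)
          fix z assume z: "z \<in> P"
          hence "snd z \<subseteq> \<gamma> (fst z)" using p(2) unfolding P_def fine_def by fastforce
          hence "snd z \<subseteq> Q" using z by (auto simp: P_def \<gamma>_def)
          thus "{Inf (snd z)<..<Sup (snd z)} \<subseteq> Q"
          proof -
            have "(fst z, snd z) \<in> p" using z by (simp add: P_def)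
            from K[OF this] have "snd z = {Inf (snd z)..Sup (snd z)}" by blast
            thus ?thesis using \<open>snd z \<subseteq> Q\<close> greaterThanLessThan_subseteq_atLeastAtMost_iff
              by (metis order_refl order_trans)
          qed
        qed
      qed (use Q finP in auto)
      finally show "(\<Sum>z\<in>P. ?l z) < \<delta>" using Q by simp
    qed
    moreover have "(\<Sum>z\<in>p - P. ?f z) \<le> (M + e) * (b - a)"
    proof -
      have "?f z \<le> (M + e) * ?l z" if z: "z \<in> p - P" for z
      proof -
        obtain x L where zz: "z = (x, L)" by (cases z)
        have xL: "(x, L) \<in> p" "x \<notin> N" using z by (auto simp: zz P_def)
        note KL = K[OF xL(1)]
        have "L \<subseteq> \<gamma> x" using p(2) xL unfolding fine_def by fastforce
        hence "L \<subseteq> ball x (r x)" using xL KL by (simp add: \<gamma>_def)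
        moreover have "Inf L \<in> L" "Sup L \<in> L" using KL by (metis atLeastAtMost_iff order_refl)+
        ultimately have "\<bar>Inf L - x\<bar> < r x" "\<bar>Sup L - x\<bar> < r x" "Inf L \<in> I" "Sup L \<in> I"
          using KL sub by (auto simp: subset_iff dist_real_def abs_minus_commute)
        hence "norm (\<sigma> (Sup L) - \<sigma> x) \<le> (M + e) * \<bar>Sup L - x\<bar>" "norm (\<sigma> (Inf L) - \<sigma> x) \<le> (M + e) * \<bar>Inf L - x\<bar>"
          using r(2)[of x] xL KL by auto
        moreover have "x \<in> {Inf L..Sup L}" using KL by blast
        moreover have "norm (\<sigma> (Sup L) - \<sigma> (Inf L)) \<le> norm (\<sigma> (Sup L) - \<sigma> x) + norm (\<sigma> (Inf L) - \<sigma> x)"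
          using norm_triangle_ineq4[of "\<sigma> (Sup L) - \<sigma> x" "\<sigma> (Inf L) - \<sigma> x"] by simp
        ultimately show ?thesis by (simp add: zz algebra_simps)
      qed
      hence "(\<Sum>z\<in>p - P. ?f z) \<le> (\<Sum>z\<in>p - P. (M + e) * ?l z)" by (rule sum_mono)
      also have "\<dots> \<le> (\<Sum>z\<in>p. (M + e) * ?l z)"
        using fin K M e by (intro sum_mono2) (auto simp: P_def)
      also have "\<dots> = (M + e) * (\<Sum>(x, K)\<in>p. id (Sup K) - id (Inf K))"
        by (simp add: sum_distrib_left case_prod_beta)
      also have "\<dots> = (M + e) * (b - a)"
        using additive_tagged_division_1[OF ab p(1), of "id :: real \<Rightarrow> real"] by simp
      finally show ?thesis .
    qed
    moreover have "norm (\<sigma> b - \<sigma> a) \<le> (\<Sum>z\<in>p. ?f z)"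
    proof -
      have "\<sigma> b - \<sigma> a = (\<Sum>(x, K)\<in>p. \<sigma> (Sup K) - \<sigma> (Inf K))"
        using additive_tagged_division_1[OF ab p(1), of \<sigma>] by simp
      also have "\<dots> = (\<Sum>z\<in>p. \<sigma> (Sup (snd z)) - \<sigma> (Inf (snd z)))" by (simp add: case_prod_beta)
      finally show ?thesis using norm_sum by metis
    qed
    moreover have "(\<Sum>z\<in>p. ?f z) = (\<Sum>z\<in>p - P. ?f z) + (\<Sum>z\<in>P. ?f z)"
      using fin by (intro sum.subset_diff) (auto simp: P_def)
    ultimately show ?thesis by linarith
  qed
  show ?thesis
  proof (rule field_le_epsilon)
    fix e :: real assume e: "e > 0"
    define e' where "e' = e / (b - a + 1)"
    have "e' > 0" using e ab by (simp add: e'_def)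
    from main[OF this] have "norm (\<sigma> b - \<sigma> a) \<le> M * (b - a) + e' * (b - a + 1)" by (simp add: algebra_simps)
    thus "norm (\<sigma> b - \<sigma> a) \<le> M * (b - a) + e" using ab by (simp add: e'_def)
  qed
qed

section \<open>Holomorphic discs omitting two points\<close>

text \<open>Schottky's bound at radius \<open>sqrt t\<close> for functions of modulus at most 1 at
  the centre. The theorem wants a function on the closed disc, so the argument is scaled by
  \<open>sqrt t\<close>; points of modulus at most \<open>t\<close> then have modulus at most
  \<open>sqrt t\<close>.\<close>

definition schottky_bound :: "real \<Rightarrow> real" where
  "schottky_bound t = exp (pi * exp (pi * (2 + 2 * 1 + 12 * sqrt t / (1 - sqrt t))))"

lemma schottky_bound_pos: "0 < schottky_bound t"
  by (simp add: schottky_bound_def)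

text \<open>The affine map taking \<open>w\<close> to 0 and \<open>w'\<close> to 1 turns
  \<open>f\<close> into a function omitting 0 and 1 with value of modulus at most 1 at the
  centre.\<close>

lemma norm_diff_le_omitted:
  assumes f: "f holomorphic_on ball 0 1" and w: "w \<notin> f ` ball 0 1" "w' \<notin> f ` ball 0 1" "w \<noteq> w'"
    and f0: "norm (f 0 - w) \<le> norm (w' - w)" and t: "0 < t" "t < 1" "norm z \<le> t"
  shows "norm (f z - w) \<le> schottky_bound t * norm (w' - w)"
proof -
  define s where "s = sqrt t"
  have s: "0 < s" "s < 1" using t by (auto simp: s_def)
  have s2: "s * s = t" using t by (simp add: s_def)
  define F where "F \<zeta> = (f (of_real s * \<zeta>) - w) / (w' - w)" for \<zeta>
  have mem: "of_real s * \<zeta> \<in> ball 0 1" if "\<zeta> \<in> cball 0 1" for \<zeta> :: complex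
  proof -
    have "s * norm \<zeta> \<le> s * 1" using that s by (intro mult_left_mono) auto
    hence "s * norm \<zeta> < 1" using s by linarith
    thus ?thesis using s by (simp add: norm_mult)
  qed
  have "(f \<circ> (\<lambda>\<zeta>. of_real s * \<zeta>)) holomorphic_on cball 0 1"
    using mem by (intro holomorphic_on_compose_gen[OF _ f] holomorphic_intros) auto
  hence F: "F holomorphic_on cball 0 1"
    unfolding F_def o_def using w(3) by (intro holomorphic_intros) auto
  have "norm (F (z / of_real s)) \<le> exp (pi * exp (pi * (2 + 2 * 1 + 12 * s / (1 - s))))"
  proof (rule Schottky[OF F])
    show "norm (F 0) \<le> 1" using f0 w(3) by (simp add: F_def norm_divide divide_le_eq_1)
    show "norm (z / of_real s) \<le> s" using t s by (simp add: norm_divide divide_le_eq s2)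
    show "\<not> (F \<zeta> = 0 \<or> F \<zeta> = 1)" if "\<zeta> \<in> cball 0 1" for \<zeta>
      using mem[OF that] w by (auto simp: F_def)
  qed (use s in auto)
  hence "norm (F (z / of_real s)) \<le> schottky_bound t" by (simp add: schottky_bound_def s_def)
  moreover have "f z - w = F (z / of_real s) * (w' - w)" using s w(3) by (simp add: F_def)
  ultimately show ?thesis by (simp add: norm_mult mult_right_mono)
qed

lemma norm_deriv_le_omitted:
  assumes f: "f holomorphic_on ball 0 1" and w: "w \<notin> f ` ball 0 1" "w' \<notin> f ` ball 0 1" "w \<noteq> w'"
    and f0: "norm (f 0 - w) \<le> norm (w' - w)"
  shows "norm (deriv f 0) \<le> 2 * schottky_bound (1/2) * norm (w' - w)"
proof -
  have hol: "(\<lambda>z. f z - w) holomorphic_on ball 0 1" using f by (intro holomorphic_intros)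
  have "norm ((deriv ^^ 1) (\<lambda>z. f z - w) 0) \<le> fact 1 * (schottky_bound (1/2) * norm (w' - w)) / (1/2) ^ 1"
  proof (rule Cauchy_inequality)
    show "(\<lambda>z. f z - w) holomorphic_on ball 0 (1/2)" using hol by (rule holomorphic_on_subset) auto
    show "continuous_on (cball 0 (1/2)) (\<lambda>z. f z - w)"
      using holomorphic_on_imp_continuous_on[OF hol] by (rule continuous_on_subset) auto
    show "norm (f x - w) \<le> schottky_bound (1/2) * norm (w' - w)" if "norm (0 - x) = 1/2" for x
      using that by (intro norm_diff_le_omitted[OF f w f0]) auto
  qed simp
  moreover have "deriv (\<lambda>z. f z - w) 0 = deriv f 0"
    using holomorphic_on_imp_differentiable_at[OF f, of 0] by simp
  ultimately show ?thesis by simp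
qed

section \<open>Boundary points on a nondegenerate continuum\<close>

text \<open>\<open>P\<close> fills the boundary near \<open>p\<close> and reaches out to distance
  \<epsilon>. Its size supplies a second boundary point at a prescribed small distance, and it
  excludes holes in the components of \<Omega> near \<open>p\<close>.\<close>

locale continuum_boundary_point =
  fixes \<Omega> P :: "complex set" and p :: complex and \<epsilon> :: real
  assumes open_\<Omega>: "open \<Omega>" and p: "p \<in> frontier \<Omega>" and \<epsilon>: "0 < \<epsilon>"
    and near: "frontier \<Omega> \<inter> ball p \<epsilon> \<subseteq> P" and conn_P: "connected P" and P_sub: "P \<subseteq> frontier \<Omega>"
    and far: "\<exists>q\<in>P. \<epsilon> \<le> dist p q"
begin

definition bdist :: "complex \<Rightarrow> real" where "bdist z = infdist z (frontier \<Omega>)"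

lemma disjoint_frontier: "z \<in> \<Omega> \<Longrightarrow> z \<notin> frontier \<Omega>"
  using open_\<Omega> by (simp add: frontier_def interior_open)

lemma bdist_pos: "z \<in> \<Omega> \<Longrightarrow> 0 < bdist z"
  using disjoint_frontier p infdist_pos_not_in_closed[of "frontier \<Omega>" z] by (auto simp: bdist_def)

lemma bdist_le: "bdist z \<le> dist z p"
  unfolding bdist_def using p by (rule infdist_le)

lemma bdist_lipschitz: "bdist z \<le> bdist w + dist z w"
  unfolding bdist_def by (rule infdist_triangle)

lemma ball_bdist_subset:
  assumes "z \<in> \<Omega>" shows "ball z (bdist z) \<subseteq> \<Omega>"
proof (rule ccontr)
  assume "\<not> ?thesis"
  moreover have "ball z (bdist z) \<inter> \<Omega> \<noteq> {}" using assms bdist_pos[OF assms] by force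
  ultimately have "ball z (bdist z) \<inter> frontier \<Omega> \<noteq> {}"
    using connected_Int_frontier[of "ball z (bdist z)" \<Omega>] by auto
  then obtain w where "w \<in> frontier \<Omega>" "dist z w < bdist z" by auto
  thus False using infdist_le[of w "frontier \<Omega>" z] by (simp add: bdist_def)
qed

text \<open>The nearest boundary point \<open>w\<close> lies on \<open>P\<close>, within
  \<epsilon>/2 of \<open>p\<close>, so \<open>P\<close> also has a point at distance at least
  \<epsilon>/2 from \<open>w\<close>. By connectedness the distance to \<open>w\<close> takes every
  intermediate value on \<open>P\<close>, in particular \<open>bdist z\<close>.\<close>

lemma two_boundary_points:
  assumes z: "z \<in> \<Omega>" "dist p z < \<epsilon> / 4"
  obtains w w' where "w \<in> frontier \<Omega>" "w' \<in> frontier \<Omega>" "norm (z - w) = bdist z" "norm (w' - w) = bdist z"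
proof -
  obtain w where w: "w \<in> frontier \<Omega>" "bdist z = dist z w"
    using infdist_attains_inf[of "frontier \<Omega>" z] p unfolding bdist_def by auto
  have zw: "dist z w < \<epsilon> / 4" using w bdist_le[of z] z by (simp add: dist_commute)
  have "dist p w < \<epsilon> / 2" using dist_triangle[of p w z] zw z by simp
  hence wP: "w \<in> P" using near w \<epsilon> by auto
  obtain q where q: "q \<in> P" "\<epsilon> \<le> dist p q" using far by blast
  have qw: "\<epsilon> / 2 \<le> dist w q" using dist_triangle[of p q w] q \<open>dist p w < \<epsilon> / 2\<close> by simp
  have "connected (dist w ` P)"
    by (intro connected_continuous_image continuous_intros conn_P)
  hence "{dist w w..dist w q} \<subseteq> dist w ` P"
    by (rule connected_contains_Icc) (use wP q in auto)
  hence "dist z w \<in> dist w ` P" using zw qw \<epsilon> by auto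
  then obtain w' where "w' \<in> P" "dist w w' = dist z w" by auto
  thus ?thesis using that[of w w'] w P_sub by (auto simp: dist_norm norm_minus_commute)
qed

lemma norm_deriv_le_bdist:
  assumes f: "f holomorphic_on ball 0 1" "f ` ball 0 1 \<subseteq> \<Omega>" and z: "dist p (f 0) < \<epsilon> / 4"
  shows "norm (deriv f 0) \<le> 2 * schottky_bound (1/2) * bdist (f 0)"
proof -
  have f0: "f 0 \<in> \<Omega>" using f(2) by auto
  obtain w w' where w: "w \<in> frontier \<Omega>" "w' \<in> frontier \<Omega>" "norm (f 0 - w) = bdist (f 0)" "norm (w' - w) = bdist (f 0)"
    using two_boundary_points[OF f0 z] .
  have "w \<noteq> w'" using w(4) bdist_pos[OF f0] by auto
  thus ?thesis
    using norm_deriv_le_omitted[OF f(1), of w w'] w f(2) disjoint_frontier by auto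
qed

lemma norm_diff_le_bdist:
  assumes f: "f holomorphic_on ball 0 1" "f ` ball 0 1 \<subseteq> \<Omega>" and z: "dist p (f 0) < \<epsilon> / 4"
    and t: "0 < t" "t < 1" "norm \<zeta> \<le> t"
  shows "norm (f \<zeta> - f 0) \<le> (schottky_bound t + 1) * bdist (f 0)"
proof -
  have f0: "f 0 \<in> \<Omega>" using f(2) by auto
  obtain w w' where w: "w \<in> frontier \<Omega>" "w' \<in> frontier \<Omega>" "norm (f 0 - w) = bdist (f 0)" "norm (w' - w) = bdist (f 0)"
    using two_boundary_points[OF f0 z] .
  have "w \<noteq> w'" using w(4) bdist_pos[OF f0] by auto
  hence "norm (f \<zeta> - w) \<le> schottky_bound t * norm (w' - w)"
    using w f(2) disjoint_frontier by (intro norm_diff_le_omitted[OF f(1) _ _ _ _ t]) auto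
  moreover have "norm (f \<zeta> - f 0) \<le> norm (f \<zeta> - w) + norm (f 0 - w)"
    using norm_triangle_ineq4[of "f \<zeta> - w" "f 0 - w"] by simp
  ultimately show ?thesis using w by (simp add: algebra_simps)
qed

text \<open>Since the boundary near \<open>p\<close> lies on one continuum, a
  disc in \<open>\<Omega>\<close> omits two points at distance comparable to the distance of its centre to the boundary,
  and Schottky's theorem applies.\<close>

lemma norm_le_kobayashi_metric:
  assumes z: "z \<in> \<Omega>" "dist p z < \<epsilon> / 4"
  shows "norm v \<le> 2 * schottky_bound (1/2) * bdist z * kobayashi_metric \<Omega> z v"
proof -
  define A where "A = 2 * schottky_bound (1/2) * bdist z"
  have A: "A > 0" using bdist_pos[OF z(1)] schottky_bound_pos by (simp add: A_def)
  let ?S = "{norm \<xi> | \<xi> f. f holomorphic_on ball 0 1 \<and> f ` ball 0 1 \<subseteq> \<Omega> \<and> f 0 = z \<and> deriv f 0 * \<xi> = v}"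
  have "norm v / A \<le> Inf ?S"
  proof (rule cInf_greatest)
    \<comment> \<open>The inscribed round disc makes the set nonempty, so that \<open>Inf\<close> is
      a genuine infimum.\<close>
    define f where "f \<zeta> = z + of_real (bdist z) * \<zeta>" for \<zeta>
    have "f holomorphic_on ball 0 1" unfolding f_def by (intro holomorphic_intros)
    moreover have "f ` ball 0 1 \<subseteq> ball z (bdist z)"
      using bdist_pos[OF z(1)] by (auto simp: f_def dist_norm norm_mult)
    moreover have "deriv f 0 = of_real (bdist z)"
      unfolding f_def by (rule DERIV_imp_deriv) (auto intro!: derivative_eq_intros)
    moreover have "f 0 = z" by (simp add: f_def)
    moreover have "deriv f 0 * (v / of_real (bdist z)) = v"
      using \<open>deriv f 0 = of_real (bdist z)\<close> bdist_pos[OF z(1)] by simp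
    ultimately have "norm (v / of_real (bdist z)) \<in> ?S"
      using ball_bdist_subset[OF z(1)] by blast
    thus "?S \<noteq> {}" by blast
    fix x assume "x \<in> ?S"
    then obtain \<xi> f where f: "x = norm \<xi>" "f holomorphic_on ball 0 1" "f ` ball 0 1 \<subseteq> \<Omega>" "f 0 = z" "deriv f 0 * \<xi> = v"
      by auto
    have "norm v = norm (deriv f 0) * norm \<xi>" using f(5) by (simp add: norm_mult flip: f(5))
    also have "\<dots> \<le> A * norm \<xi>"
      unfolding A_def using norm_deriv_le_bdist[OF f(2,3)] f(4) z by (intro mult_right_mono) auto
    finally show "norm v / A \<le> x" using A f(1) by (simp add: divide_le_eq mult.commute)
  qed
  thus ?thesis unfolding kobayashi_metric_def A_def[symmetric] using A by (simp add: divide_le_eq mult.commute)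
qed

end

section \<open>The length-area estimate\<close>

lemma sum_squares_disjoint_balls:
  fixes c :: "'i \<Rightarrow> complex"
  assumes I: "finite I" and r: "\<And>i. i \<in> I \<Longrightarrow> 0 \<le> r i"
    and disj: "\<And>i j. i \<in> I \<Longrightarrow> j \<in> I \<Longrightarrow> i \<noteq> j \<Longrightarrow> ball (c i) (r i) \<inter> ball (c j) (r j) = {}"
    and sub: "\<And>i. i \<in> I \<Longrightarrow> ball (c i) (r i) \<subseteq> ball p R" and R: "0 \<le> R"
  shows "(\<Sum>i\<in>I. (r i)\<^sup>2) \<le> R\<^sup>2"
proof -
  have ball: "measure lborel (ball z \<rho>) = pi * \<rho>\<^sup>2" if "0 \<le> \<rho>" for z :: complex and \<rho>
    using content_ball[OF that, of z] by (simp add: unit_ball_vol_2)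
  have "(\<Sum>i\<in>I. pi * (r i)\<^sup>2) = (\<Sum>i\<in>I. measure lborel (ball (c i) (r i)))"
    using ball r by (intro sum.cong) auto
  also have "\<dots> = measure lborel (\<Union>i\<in>I. ball (c i) (r i))"
  proof (rule measure_finite_Union[symmetric])
    show "emeasure lborel (ball (c i) (r i)) \<noteq> \<infinity>" for i
      using emeasure_lborel_ball_finite[of "c i" "r i"] by (simp add: less_top)
  qed (use disj I in \<open>auto simp: disjoint_family_on_def\<close>)
  also have "\<dots> \<le> measure lborel (ball p R)"
    using sub I by (intro measure_mono_fmeasurable UN_least)
      (auto intro!: fmeasurableI emeasure_lborel_ball_finite)
  also have "\<dots> = pi * R\<^sup>2" using ball R by simp
  finally have "pi * (\<Sum>i\<in>I. (r i)\<^sup>2) \<le> pi * R\<^sup>2" by (simp only: sum_distrib_left)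
  thus ?thesis by simp
qed

lemma piecewise_lipschitz_sum:
  fixes g :: "real \<Rightarrow> 'a::real_normed_vector"
  assumes t: "0 < t" and L: "\<And>j. j < m \<Longrightarrow> 0 \<le> L j"
    and lip: "\<And>j x y. j < m \<Longrightarrow> x \<in> {a + real j * t..a + (real j + 1) * t} \<Longrightarrow>
                y \<in> {a + real j * t..a + (real j + 1) * t} \<Longrightarrow> norm (g x - g y) \<le> L j * t"
    and xy: "x \<in> {a..a + real m * t}" "y \<in> {a..a + real m * t}" "x \<le> y"
  shows "norm (g x - g y) \<le> (\<Sum>j<m. L j * t)"
  using L lip xy
proof (induction m arbitrary: x y)
  case 0
  then show ?case by simp
next
  case (Suc m)
  have Lm: "0 \<le> L m * t" using Suc.prems(1)[of m] t by simp
  have ge: "0 \<le> (\<Sum>j<m. L j * t)" using Suc.prems(1) t by (intro sum_nonneg) auto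
  let ?b = "a + real m * t"
  have IH: "norm (g x - g y) \<le> (\<Sum>j<m. L j * t)"
    if "x \<in> {a..?b}" "y \<in> {a..?b}" "x \<le> y" for x y
    using Suc.prems(1,2) that by (intro Suc.IH) auto
  have last: "norm (g x - g y) \<le> L m * t" if "x \<in> {?b..a + real (Suc m) * t}" "y \<in> {?b..a + real (Suc m) * t}" for x y
    using Suc.prems(2)[of m x y] that by (simp add: algebra_simps)
  consider "y \<le> ?b" | "?b \<le> x" | "x \<le> ?b" "?b \<le> y" by linarith
  then show ?case
  proof cases
    case 1
    then show ?thesis using IH[of x y] Suc.prems(3-5) Lm by simp
  next
    case 2
    then show ?thesis using last[of x y] Suc.prems(3-5) ge by simp
  next
    case 3
    have "norm (g x - g y) \<le> norm (g x - g ?b) + norm (g ?b - g y)"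
      using norm_triangle_ineq[of "g x - g ?b" "g ?b - g y"] by simp
    also have "norm (g x - g ?b) \<le> (\<Sum>j<m. L j * t)" using IH[of x ?b] 3 Suc.prems(3) t by simp
    also have "norm (g ?b - g y) \<le> L m * t" using last[of ?b y] 3 Suc.prems(4) t by (simp add: algebra_simps)
    finally show ?thesis by simp
  qed
qed

lemma sum_power2_le:
  fixes f :: "nat \<Rightarrow> real"
  shows "(\<Sum>j<m. f j)\<^sup>2 \<le> real m * (\<Sum>j<m. (f j)\<^sup>2)"
  using Cauchy_Schwarz_ineq_sum[of "\<lambda>_. 1" f "{..<m}"] by simp

text \<open>Squares of a fine grid are mapped onto sets containing pairwise disjoint discs of radius
  comparable to the diameter of the image (Bloch), so that no change of variables is needed.\<close>

lemma short_vertical_segment_compact: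
  assumes D: "open D" and hol: "F holomorphic_on D" and inj: "inj_on F D" and R: "F ` D \<subseteq> ball p R"
    and M: "0 < M" and h: "0 < h" and box: "\<And>x y. x \<in> {0..M} \<Longrightarrow> y \<in> {-h..h} \<Longrightarrow> Complex x y \<in> D"
  shows "\<exists>x\<in>{0..M}. \<forall>y\<in>{-h..h}. \<forall>y'\<in>{-h..h}.
           norm (F (Complex x y) - F (Complex x y')) \<le> 8 * R * sqrt (h / M) / (3 - 2 * sqrt 2)"
proof -
  \<comment> \<open>The constant of Bloch's lemma: if the derivative on a disc is at most twice that
    at its centre, the image contains a disc of radius \<open>k0\<close> times the radius times the
    central derivative.\<close>
  define k0 :: real where "k0 = 3 - 2 * sqrt 2"
  have "sqrt 2 < 3/2" by (rule real_less_lsqrt) (auto simp: power2_eq_square)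
  hence k0: "0 < k0" by (simp add: k0_def)
  have R0: "0 < R"
  proof -
    have "F (Complex 0 0) \<in> ball p R" using box[of 0 0] M h R by auto
    thus ?thesis by (metis ball_eq_empty empty_iff not_le)
  qed
  define K where "K = cbox (Complex 0 (-h)) (Complex M h)"
  have inK: "z \<in> K \<longleftrightarrow> Re z \<in> {0..M} \<and> Im z \<in> {-h..h}" for z
    by (auto simp: K_def in_cbox_complex_iff)
  have KD: "K \<subseteq> D"
  proof
    fix z assume "z \<in> K"
    thus "z \<in> D" using box[of "Re z" "Im z"] inK by simp
  qed
  have cK: "compact K" "convex K" by (simp_all add: K_def convex_box)
  have holD: "deriv F holomorphic_on D" using hol D by (rule holomorphic_deriv)
  have cd: "continuous_on K (deriv F)"
    using holD KD by (meson continuous_on_subset holomorphic_on_imp_continuous_on)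
  have nz: "deriv F z \<noteq> 0" if "z \<in> D" for z
    using holomorphic_injective_imp_regular[OF hol D inj] that by blast
  have Kne: "K \<noteq> {}" using inK[of 0] M h by auto
  \<comment> \<open>By injectivity the derivative has a positive minimal modulus \<mu> on the box.
    Oscillation below \<mu> thus means a ratio of at most 2 between nearby points, as Bloch's lemma
    requires.\<close>
  obtain z0 where z0: "z0 \<in> K" "\<And>z. z \<in> K \<Longrightarrow> norm (deriv F z0) \<le> norm (deriv F z)"
    using continuous_attains_inf[OF cK(1) Kne continuous_on_norm[OF cd]] by blast
  define \<mu> where "\<mu> = norm (deriv F z0)"
  have \<mu>: "\<mu> > 0" using nz z0 KD by (auto simp: \<mu>_def)
  obtain d where d: "d > 0" "\<And>z z'. z \<in> K \<Longrightarrow> z' \<in> K \<Longrightarrow> dist z' z < d \<Longrightarrow> dist (deriv F z') (deriv F z) < \<mu>"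
    using compact_uniformly_continuous[OF cd cK(1)] \<mu> unfolding uniformly_continuous_on_def by meson
  have ratio: "norm (deriv F z') \<le> 2 * norm (deriv F z)" if "z \<in> K" "z' \<in> K" "dist z' z < d" for z z'
  proof -
    have "norm (deriv F z') \<le> norm (deriv F z) + dist (deriv F z') (deriv F z)"
      unfolding dist_norm using norm_triangle_ineq2[of "deriv F z'" "deriv F z"] by linarith
    thus ?thesis using d(2)[OF that] z0(2)[OF that(1)] by (simp add: \<mu>_def)
  qed
  obtain n :: nat where n: "n > 0" "M / n < d / 2" "M / n < 2 * h"
  proof -
    obtain n :: nat where n: "max (2 * M / d) (M / (2 * h)) < real n" using reals_Archimedean2 by blast
    have "0 < M / (2 * h)" using M h by simp
    hence "n > 0" using n by (metis less_trans max_less_iff_conj of_nat_0_less_iff)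
    thus ?thesis using n M d h by (intro that[of n]) (auto simp: field_simps)
  qed
  \<comment> \<open>The box is cut into \<open>n\<close> columns of width \<open>s\<close> and
    \<open>m\<close> rows of height \<open>t\<close>. The height is at most the width, so discs of
    radius \<open>t / 2\<close> fit into the cells, and yet \<open>m\<close> is at most
    \<open>4 * h * n / M\<close>.\<close>
  define s where "s = M / n"
  define m where "m = nat \<lceil>2 * h / s\<rceil>"
  define t where "t = 2 * h / m"
  have s: "0 < s" "s < d / 2" "s < 2 * h" "real n * s = M" using n M by (auto simp: s_def)
  have m: "2 * h / s \<le> m" "m < 2 * h / s + 1"
  proof -
    have "0 \<le> 2 * h / s" using h s by simp
    thus "2 * h / s \<le> m" "m < 2 * h / s + 1" unfolding m_def by linarith+
  qed
  have m1: "1 < real m" using m(1) s h by (smt (verit) less_divide_eq_1_pos)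
  have t: "0 < t" "t \<le> s" "real m * t = 2 * h"
    using m m1 s h by (auto simp: t_def field_simps)
  have m4: "real m \<le> 4 * h * n / M"
  proof -
    have "1 < 2 * h / s" using s by simp
    hence "real m \<le> 2 * (2 * h / s)" using m(2) by linarith
    also have "\<dots> = 4 * h * n / M" using n M by (simp add: s_def)
    finally show ?thesis .
  qed
  define c where "c i j = Complex ((real i + 1/2) * s) (- h + (real j + 1/2) * t)" for i j :: nat
  have gridM: "(real i + 1) * s \<le> M" if "i < n" for i
  proof -
    have "(real i + 1) * s \<le> real n * s" using that s by (intro mult_right_mono) auto
    thus ?thesis using s by simp
  qed
  have gridh: "(real j + 1) * t \<le> 2 * h" if "j < m" for j
  proof -
    have "(real j + 1) * t \<le> real m * t" using that t by (intro mult_right_mono) auto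
    thus ?thesis using t by simp
  qed
  have cball: "cball (c i j) (t / 2) \<subseteq> K" if ij: "i < n" "j < m" for i j
  proof
    fix z assume "z \<in> cball (c i j) (t / 2)"
    hence z: "norm (z - c i j) \<le> t / 2" by (simp add: dist_norm norm_minus_commute)
    have "\<bar>Re (z - c i j)\<bar> \<le> t / 2" "\<bar>Im (z - c i j)\<bar> \<le> t / 2"
      using abs_Re_le_cmod[of "z - c i j"] abs_Im_le_cmod[of "z - c i j"] z by linarith+
    moreover have "Re (c i j) = real i * s + s / 2" "Im (c i j) = - h + real j * t + t / 2"
      by (simp_all add: c_def algebra_simps)
    ultimately have "\<bar>Re z - (real i * s + s / 2)\<bar> \<le> t / 2" "\<bar>Im z - (- h + real j * t + t / 2)\<bar> \<le> t / 2"
      by simp_all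
    moreover have "0 \<le> real i * s" "0 \<le> real j * t" using s t by auto
    moreover have "real i * s + s \<le> M" "real j * t + t \<le> 2 * h"
      using gridM[OF ij(1)] gridh[OF ij(2)] by (simp_all add: algebra_simps)
    ultimately have "0 \<le> Re z" "Re z \<le> M" "- h \<le> Im z" "Im z \<le> h"
      using t by linarith+
    thus "z \<in> K" unfolding inK by simp
  qed
  have cD: "c i j \<in> K" if "i < n" "j < m" for i j using cball[OF that] t by auto
  have bD: "ball (c i j) (t / 2) \<subseteq> D" if "i < n" "j < m" for i j
    using cball[OF that] KD ball_subset_cball by blast
  define r where "r i j = k0 * (t / 2) * norm (deriv F (c i j))" for i j
  have bloch: "ball (F (c i j)) (r i j) \<subseteq> F ` ball (c i j) (t / 2)" if ij: "i < n" "j < m" for i j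
    unfolding r_def k0_def
  proof (rule Bloch_lemma)
    show "F holomorphic_on cball (c i j) (t / 2)"
      using hol cball[OF ij] KD by (meson holomorphic_on_subset order_trans)
    fix z assume z: "z \<in> ball (c i j) (t / 2)"
    have "dist z (c i j) < d" using z t s by (simp add: dist_commute)
    moreover have "z \<in> K" using z cball[OF ij] by auto
    ultimately show "norm (deriv F z) \<le> 2 * norm (deriv F (c i j))"
      using cD[OF ij] by (intro ratio)
  qed (use t in auto)
  have apart: "t \<le> dist (c i j) (c i' j')" if "(i, j) \<noteq> (i', j')" for i j i' j'
  proof (cases "i = i'")
    case False
    hence "1 * s \<le> \<bar>real i - real i'\<bar> * s" using s by (intro mult_right_mono) auto
    also have "\<dots> = \<bar>Re (c i j - c i' j')\<bar>" using s by (simp add: c_def abs_mult flip: left_diff_distrib)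
    also have "\<dots> \<le> dist (c i j) (c i' j')" unfolding dist_norm by (rule abs_Re_le_cmod)
    finally show ?thesis using t by simp
  next
    case True
    hence "1 * t \<le> \<bar>real j - real j'\<bar> * t" using t that by (intro mult_right_mono) auto
    also have "\<dots> = \<bar>Im (c i j - c i' j')\<bar>" using t by (simp add: c_def abs_mult flip: left_diff_distrib)
    also have "\<dots> \<le> dist (c i j) (c i' j')" unfolding dist_norm by (rule abs_Im_le_cmod)
    finally show ?thesis by simp
  qed
  have "(\<Sum>(i, j)\<in>{..<n} \<times> {..<m}. (r i j)\<^sup>2) = (\<Sum>z\<in>{..<n} \<times> {..<m}. (r (fst z) (snd z))\<^sup>2)"
    by (simp add: case_prod_beta)
  also have "\<dots> \<le> R\<^sup>2"
  proof (rule sum_squares_disjoint_balls[where c = "\<lambda>z. F (c (fst z) (snd z))" and p = p])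
    fix z w assume zw: "z \<in> {..<n} \<times> {..<m}" "w \<in> {..<n} \<times> {..<m}" "z \<noteq> w"
    let ?z = "c (fst z) (snd z)" and ?w = "c (fst w) (snd w)"
    have "t \<le> dist ?z ?w" using zw(3) by (intro apart) (simp add: prod_eq_iff)
    hence "ball ?z (t / 2) \<inter> ball ?w (t / 2) = {}" by (intro disjoint_ballI) simp
    moreover have "ball ?z (t / 2) \<subseteq> D" "ball ?w (t / 2) \<subseteq> D"
      using bD zw by (auto simp: mem_Times_iff)
    ultimately have "F ` ball ?z (t / 2) \<inter> F ` ball ?w (t / 2) = {}"
      using inj_on_image_Int[OF inj] by (metis image_empty)
    moreover have "ball (F ?z) (r (fst z) (snd z)) \<subseteq> F ` ball ?z (t / 2)"
        "ball (F ?w) (r (fst w) (snd w)) \<subseteq> F ` ball ?w (t / 2)"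
      using bloch zw by (auto simp: mem_Times_iff)
    ultimately show "ball (F ?z) (r (fst z) (snd z)) \<inter> ball (F ?w) (r (fst w) (snd w)) = {}" by blast
  next
    fix z assume z: "z \<in> {..<n} \<times> {..<m}"
    have "ball (F (c (fst z) (snd z))) (r (fst z) (snd z)) \<subseteq> F ` ball (c (fst z) (snd z)) (t / 2)"
      using bloch z by (auto simp: mem_Times_iff)
    also have "\<dots> \<subseteq> F ` D"
      using bD[of "fst z" "snd z"] z by (intro image_mono) (auto simp: mem_Times_iff)
    finally show "ball (F (c (fst z) (snd z))) (r (fst z) (snd z)) \<subseteq> ball p R" using R by blast
  qed (use R0 k0 t in \<open>auto simp: r_def\<close>)
  finally have total: "(\<Sum>i<n. \<Sum>j<m. (r i j)\<^sup>2) \<le> R\<^sup>2" by (simp add: sum.cartesian_product)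
  \<comment> \<open>By averaging, some column carries at most its share of the total.\<close>
  obtain i where i: "i < n" "(\<Sum>j<m. (r i j)\<^sup>2) \<le> R\<^sup>2 / n"
  proof (rule ccontr)
    assume "\<not> thesis"
    hence "R\<^sup>2 / n < (\<Sum>j<m. (r i j)\<^sup>2)" if "i < n" for i using that \<open>\<And>i. _ \<Longrightarrow> _ \<Longrightarrow> thesis\<close> by force
    hence "(\<Sum>i<n. R\<^sup>2 / n) < (\<Sum>i<n. \<Sum>j<m. (r i j)\<^sup>2)" using n by (intro sum_strict_mono) auto
    thus False using total n by simp
  qed
  define x where "x = (real i + 1/2) * s"
  have x: "x \<in> {0..M}" using gridM[OF i(1)] s by (auto simp: x_def algebra_simps)
  define L where "L j = 2 * norm (deriv F (c i j))" for j
  \<comment> \<open>Cauchy-Schwarz over the \<open>m\<close> cells of this column; the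
    \<open>n\<close> in the bound for \<open>m\<close> cancels against the share
    \<open>R^2 / n\<close>.\<close>
  have sumL: "(\<Sum>j<m. L j * t) \<le> 8 * R * sqrt (h / M) / k0"
  proof (rule power2_le_imp_le)
    have Lr: "L j * t = (4 / k0) * r i j" for j using k0 by (simp add: L_def r_def)
    have "(\<Sum>j<m. L j * t)\<^sup>2 \<le> real m * (\<Sum>j<m. (L j * t)\<^sup>2)" by (rule sum_power2_le)
    also have "\<dots> = real m * ((4 / k0)\<^sup>2 * (\<Sum>j<m. (r i j)\<^sup>2))"
      unfolding Lr power_mult_distrib by (simp only: sum_distrib_left)
    also have "\<dots> \<le> (4 * h * n / M) * ((4 / k0)\<^sup>2 * (R\<^sup>2 / n))"
      using m4 i(2) M h by (intro mult_mono mult_left_mono mult_nonneg_nonneg sum_nonneg) auto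
    also have "\<dots> = 64 * R\<^sup>2 * (h / M) / k0\<^sup>2" using n by (simp add: power_divide)
    also have "\<dots> = (8 * R * sqrt (h / M) / k0)\<^sup>2"
      using h M by (simp add: power_mult_distrib power_divide)
    finally show "(\<Sum>j<m. L j * t)\<^sup>2 \<le> (8 * R * sqrt (h / M) / k0)\<^sup>2" .
    show "0 \<le> 8 * R * sqrt (h / M) / k0" using R0 k0 h M by simp
  qed
  have lip: "norm (F (Complex x y) - F (Complex x y')) \<le> L j * t"
    if j: "j < m" and y: "y \<in> {-h + real j * t..-h + (real j + 1) * t}" "y' \<in> {-h + real j * t..-h + (real j + 1) * t}" for j y y'
  proof -
    let ?B = "cbox (Complex x (-h + real j * t)) (Complex x (-h + (real j + 1) * t))"
    have inB: "z \<in> ?B \<longleftrightarrow> Re z = x \<and> Im z \<in> {-h + real j * t..-h + (real j + 1) * t}" for z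
      by (auto simp: in_cbox_complex_iff)
    have BK: "z \<in> K" if "z \<in> ?B" for z
    proof -
      have "0 \<le> real j * t" using t by simp
      hence "Im z \<in> {-h..h}" using that gridh[OF j] unfolding inB by auto
      thus ?thesis using that x unfolding inB inK by simp
    qed
    have "norm (F (Complex x y) - F (Complex x y')) \<le> L j * norm (Complex x y - Complex x y')"
    proof (rule field_differentiable_bound[where S = ?B])
      show "convex ?B" by (rule convex_box)
      fix z assume z: "z \<in> ?B"
      have "z \<in> D" using BK[OF z] KD by blast
      thus "(F has_field_derivative deriv F z) (at z within ?B)"
        using hol D by (meson has_field_derivative_at_within holomorphic_derivI)
      have "dist z (c i j) \<le> \<bar>Re (z - c i j)\<bar> + \<bar>Im (z - c i j)\<bar>" unfolding dist_norm by (rule cmod_le)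
      also have "Re (z - c i j) = 0" using z unfolding inB by (simp add: c_def x_def)
      also have "\<bar>Im (z - c i j)\<bar> \<le> t / 2"
      proof -
        have "Im (c i j) = - h + real j * t + t / 2" by (simp add: c_def algebra_simps)
        moreover have "Im z \<le> -h + real j * t + t" "-h + real j * t \<le> Im z"
          using z unfolding inB by (simp_all add: algebra_simps)
        ultimately show ?thesis unfolding minus_complex.sel by linarith
      qed
      finally have "dist z (c i j) < d" using t s by simp
      thus "norm (deriv F z) \<le> L j" unfolding L_def using BK[OF z] cD[OF i(1) j] by (intro ratio)
    next
      show "Complex x y \<in> ?B" "Complex x y' \<in> ?B" unfolding inB using y by simp_all
    qed
    also have "norm (Complex x y - Complex x y') = \<bar>y - y'\<bar>" by (simp add: complex_diff complex_norm)
    also have "L j * \<bar>y - y'\<bar> \<le> L j * t"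
      using y by (intro mult_left_mono) (auto simp: L_def algebra_simps abs_le_iff)
    finally show ?thesis .
  qed
  have le: "norm (F (Complex x y) - F (Complex x y')) \<le> (\<Sum>j<m. L j * t)"
    if "y \<in> {-h..h}" "y' \<in> {-h..h}" "y \<le> y'" for y y'
    using that t by (intro piecewise_lipschitz_sum[where a = "-h"] lip) (auto simp: L_def)
  have "norm (F (Complex x y) - F (Complex x y')) \<le> 8 * R * sqrt (h / M) / (3 - 2 * sqrt 2)"
    if "y \<in> {-h..h}" "y' \<in> {-h..h}" for y y'
    using le[of y y'] le[of y' y] that sumL unfolding k0_def
    by (cases "y \<le> y'") (auto simp: norm_minus_commute)
  thus ?thesis using x by blast
qed

text \<open>Boxes of half-height \<open>h k\<close> exhaust the strip, and their bounds stay below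
  the bound for half-height \<open>pi / 2\<close>. The abscissas found for the boxes accumulate in
  \<open>{0..M}\<close>; by continuity a limit abscissa serves every pair of heights.\<close>

lemma short_vertical_segment:
  fixes M R :: real
  defines "D \<equiv> {z. \<bar>Im z\<bar> < pi / 2}"
  assumes hol: "F holomorphic_on D" and inj: "inj_on F D" and R: "F ` D \<subseteq> ball p R" and M: "0 < M"
  shows "\<exists>x\<in>{0..M}. \<forall>z\<in>D. \<forall>z'\<in>D. Re z = x \<longrightarrow> Re z' = x \<longrightarrow>
           norm (F z - F z') \<le> 8 * R * sqrt (pi / (2 * M)) / (3 - 2 * sqrt 2)"
proof -
  let ?C = "8 * R * sqrt (pi / (2 * M)) / (3 - 2 * sqrt 2)"
  have "sqrt 2 < 3/2" by (rule real_less_lsqrt) (auto simp: power2_eq_square)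
  hence k0: "0 < 3 - 2 * sqrt 2" by simp
  have R0: "0 < R"
  proof -
    have "0 \<in> D" by (simp add: D_def)
    hence "F 0 \<in> ball p R" using R by blast
    thus ?thesis by (metis ball_eq_empty empty_iff not_le)
  qed
  have D: "open D" unfolding D_def by (intro open_Collect_less continuous_intros)
  define h where "h k = pi / 2 - pi / 2 / (real k + 2)" for k :: nat
  have h: "0 < h k" "h k < pi / 2" for k
  proof -
    have "pi / 2 / (real k + 2) < pi / 2 / 1" by (intro divide_strict_left_mono) auto
    thus "0 < h k" by (simp add: h_def)
    show "h k < pi / 2" by (simp add: h_def)
  qed
  have "\<exists>x\<in>{0..M}. \<forall>y\<in>{-h k..h k}. \<forall>y'\<in>{-h k..h k}. norm (F (Complex x y) - F (Complex x y')) \<le> ?C" for k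
  proof -
    have "\<exists>x\<in>{0..M}. \<forall>y\<in>{-h k..h k}. \<forall>y'\<in>{-h k..h k}.
        norm (F (Complex x y) - F (Complex x y')) \<le> 8 * R * sqrt (h k / M) / (3 - 2 * sqrt 2)"
    proof (rule short_vertical_segment_compact[OF D hol inj R M h(1)])
      show "Complex x y \<in> D" if "y \<in> {-h k..h k}" for x y
        using that h(2)[of k] by (auto simp: D_def abs_less_iff)
    qed
    moreover have "8 * R * sqrt (h k / M) / (3 - 2 * sqrt 2) \<le> ?C"
    proof (intro divide_right_mono mult_left_mono real_sqrt_le_mono)
      show "h k / M \<le> pi / (2 * M)" using h(2)[of k] M by (simp add: field_simps)
    qed (use R0 k0 in auto)
    ultimately show ?thesis by (meson order_trans)
  qed
  then obtain x where x: "\<And>k. x k \<in> {0..M}"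
    "\<And>k y y'. y \<in> {-h k..h k} \<Longrightarrow> y' \<in> {-h k..h k} \<Longrightarrow> norm (F (Complex (x k) y) - F (Complex (x k) y')) \<le> ?C"
    by metis
  obtain l \<rho> where l: "l \<in> {0..M}" "strict_mono \<rho>" "(x \<circ> \<rho>) \<longlonglongrightarrow> l"
    using compact_Icc[of 0 M] x(1) unfolding compact_def by meson
  have hlim: "h \<longlonglongrightarrow> pi / 2" unfolding h_def by real_asymp
  have "norm (F (Complex l y) - F (Complex l y')) \<le> ?C" if y: "\<bar>y\<bar> < pi / 2" "\<bar>y'\<bar> < pi / 2" for y y'
  proof (rule tendsto_upperbound)
    have lim: "(\<lambda>k. F (Complex (x (\<rho> k)) y)) \<longlonglongrightarrow> F (Complex l y)" if "\<bar>y\<bar> < pi / 2" for y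
    proof (rule continuous_on_tendsto_compose[OF holomorphic_on_imp_continuous_on[OF hol]])
      show "(\<lambda>k. Complex (x (\<rho> k)) y) \<longlonglongrightarrow> Complex l y"
        using l(3) by (intro tendsto_Complex tendsto_const) (simp add: o_def)
    qed (use that in \<open>auto simp: D_def\<close>)
    show "(\<lambda>k. norm (F (Complex (x (\<rho> k)) y) - F (Complex (x (\<rho> k)) y'))) \<longlonglongrightarrow> norm (F (Complex l y) - F (Complex l y'))"
      using y by (intro tendsto_norm tendsto_diff lim)
    have "(h \<circ> \<rho>) \<longlonglongrightarrow> pi / 2" using hlim l(2) by (rule LIMSEQ_subseq_LIMSEQ)
    from order_tendstoD(1)[OF this, of "max \<bar>y\<bar> \<bar>y'\<bar>"] y
    have "\<forall>\<^sub>F k in sequentially. max \<bar>y\<bar> \<bar>y'\<bar> < (h \<circ> \<rho>) k" by simp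
    thus "\<forall>\<^sub>F k in sequentially. norm (F (Complex (x (\<rho> k)) y) - F (Complex (x (\<rho> k)) y')) \<le> ?C"
      by eventually_elim (intro x(2), auto)
  qed simp
  thus ?thesis using l(1)
    by (intro bexI[of _ l]) (auto simp: D_def, metis complex_surj)
qed

section \<open>Conformal maps of the disc and of a strip\<close>

lemma pseudo_dist_eq_Moebius: "pseudo_dist a b = norm (Moebius_function 0 b a)"
  by (simp add: pseudo_dist_def Moebius_function_simple)

lemma Moebius_function_inverse:
  assumes "norm w < 1" "norm z < 1"
  shows "Moebius_function 0 (- w) (Moebius_function 0 w z) = z"
    and "Moebius_function 0 w (Moebius_function 0 (- w) z) = z"
  using Moebius_function_compose[of "- w" w z] Moebius_function_compose[of w "- w" z] assms by auto

text \<open>Schwarz-Pick seen from the centre of a round disc. It converts displacement relative to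
  the distance to the boundary into displacement in the unit disc.\<close>

lemma pseudo_dist_le_Schwarz:
  assumes g: "g holomorphic_on ball z d" "g ` ball z d \<subseteq> ball 0 1" and w: "dist z w < d"
  shows "pseudo_dist (g z) (g w) \<le> dist z w / d"
proof -
  have d: "0 < d" using w zero_le_dist[of z w] by linarith
  have gz: "norm (g z) < 1" 
  proof -
    have "g z \<in> g ` ball z d" using d by (intro imageI) simp
    hence "g z \<in> ball 0 1" using g(2) by blast
    thus ?thesis by simp
  qed
  let ?M = "Moebius_function 0 (g z)"
  define \<phi> where "\<phi> \<zeta> = ?M (g (z + of_real d * \<zeta>))" for \<zeta>
  have mem: "z + of_real d * \<zeta> \<in> ball z d" if "\<zeta> \<in> ball 0 1" for \<zeta>
    using that d by (simp add: dist_norm norm_mult)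
  have 1: "(g \<circ> (\<lambda>\<zeta>. z + of_real d * \<zeta>)) holomorphic_on ball 0 1"
    using mem by (intro holomorphic_on_compose_gen[OF _ g(1)] holomorphic_intros) auto
  have 2: "(?M \<circ> (g \<circ> (\<lambda>\<zeta>. z + of_real d * \<zeta>))) holomorphic_on ball 0 1"
    using mem g(2) by (intro holomorphic_on_compose_gen[OF 1 Moebius_function_holomorphic[OF gz]]) fastforce
  define \<zeta>0 where "\<zeta>0 = (w - z) / of_real d"
  have n0: "norm \<zeta>0 = dist z w / d" using d by (simp add: \<zeta>0_def norm_divide dist_norm norm_minus_commute)
  have "norm (\<phi> \<zeta>0) \<le> norm \<zeta>0"
  proof (rule Schwarz_Lemma(1))
    show "\<phi> holomorphic_on ball 0 1" using 2 unfolding \<phi>_def o_def .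
    show "\<phi> 0 = 0" by (simp add: \<phi>_def Moebius_function_eq_zero)
    show "norm (\<phi> \<zeta>) < 1" if "norm \<zeta> < 1" for \<zeta>
    proof -
      have "g (z + of_real d * \<zeta>) \<in> g ` ball z d" using mem[of \<zeta>] that by (intro imageI) simp
      hence "norm (g (z + of_real d * \<zeta>)) < 1" using g(2) by auto
      thus ?thesis unfolding \<phi>_def by (rule Moebius_function_norm_lt_1[OF gz])
    qed
    show "norm \<zeta>0 < 1" using n0 w d by simp
  qed
  moreover have "\<phi> \<zeta>0 = ?M (g w)" using d by (simp add: \<phi>_def \<zeta>0_def)
  moreover have "pseudo_dist (g z) (g w) = norm (?M (g w))"
    by (subst pseudo_dist_commute) (rule pseudo_dist_eq_Moebius)
  ultimately show ?thesis by (simp add: n0)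
qed

lemma kobayashi_dist_le_poincare_dist:
  assumes f: "f holomorphic_on ball 0 1" "f ` ball 0 1 \<subseteq> \<Omega>" and ab: "a \<in> ball 0 1" "b \<in> ball 0 1"
  shows "kobayashi_dist \<Omega> (f a) (f b) \<le> poincare_dist a b"
  unfolding kobayashi_dist_def
proof (rule cInf_lower)
  have "disc_chain \<Omega> (f a) (f b) 1 (\<lambda>_. f) (\<lambda>_. a) (\<lambda>_. b)" using f ab by (simp add: disc_chain_def)
  show "poincare_dist a b \<in> {\<Sum>i<n. poincare_dist (a' i) (b' i) | n fs a' b'. disc_chain \<Omega> (f a) (f b) n fs a' b'}"
    using \<open>disc_chain \<Omega> (f a) (f b) 1 (\<lambda>_. f) (\<lambda>_. a) (\<lambda>_. b)\<close>
    by (intro CollectI exI[of _ 1] exI[of _ "\<lambda>_. f"] exI[of _ "\<lambda>_. a"] exI[of _ "\<lambda>_. b"]) simp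
  show "bdd_below {\<Sum>i<n. poincare_dist (a' i) (b' i) | n fs a' b'. disc_chain \<Omega> (f a) (f b) n fs a' b'}"
    by (rule bdd_belowI[of _ 0]) (auto simp: disc_chain_def intro!: sum_nonneg poincare_dist_nonneg)
qed

section \<open>The strip as a model of the disc with a geodesic as real axis\<close>

definition strip :: "complex set" where "strip = {z. \<bar>Im z\<bar> < pi / 2}"

text \<open>This is \<open>tanh (z / 2)\<close>. It takes the real axis to the diameter from -1 to 1
  and vertical segments to the geodesics orthogonal to it.\<close>

definition strip_to_disc :: "complex \<Rightarrow> complex" where
  "strip_to_disc z = (exp z - 1) / (exp z + 1)"

lemma Re_exp_strip: "z \<in> strip \<Longrightarrow> 0 < Re (exp z)"
  by (auto simp: strip_def Re_exp abs_less_iff intro!: mult_pos_pos cos_gt_zero_pi)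

lemma exp_strip_nonzero: "z \<in> strip \<Longrightarrow> exp z + 1 \<noteq> 0"
  using Re_exp_strip[of z] by (auto simp: complex_eq_iff)

lemma holomorphic_strip_to_disc: "strip_to_disc holomorphic_on strip"
  unfolding strip_to_disc_def using exp_strip_nonzero by (intro holomorphic_intros)

lemma strip_to_disc_in_disc:
  assumes "z \<in> strip" shows "strip_to_disc z \<in> ball 0 1"
proof -
  have "(norm (exp z - 1))\<^sup>2 < (norm (exp z + 1))\<^sup>2"
    unfolding cmod_power2 using Re_exp_strip[OF assms] by (simp add: power2_eq_square algebra_simps)
  hence "norm (exp z - 1) < norm (exp z + 1)" by (rule power2_less_imp_less) simp
  thus ?thesis using exp_strip_nonzero[OF assms] by (simp add: strip_to_disc_def norm_divide)
qed

lemma inj_on_strip_to_disc: "inj_on strip_to_disc strip"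
proof (rule inj_onI)
  fix z w assume z: "z \<in> strip" "w \<in> strip" "strip_to_disc z = strip_to_disc w"
  hence "(exp z - 1) * (exp w + 1) = (exp w - 1) * (exp z + 1)"
    using exp_strip_nonzero by (simp add: strip_to_disc_def frac_eq_eq)
  hence "2 * exp z = 2 * exp w" by (simp add: algebra_simps)
  moreover have "\<bar>Im z - Im w\<bar> < 2 * pi" using z by (auto simp: strip_def)
  ultimately show "z = w" using exp_complex_eqI[of z w] by simp
qed

lemma strip_to_disc_surj:
  assumes w: "norm w < 1"
  shows "\<exists>z\<in>strip. strip_to_disc z = w"
proof -
  have nz: "1 - w \<noteq> 0" using w by auto
  have "(1 + w) * cnj (1 - w) = of_real (1 - (norm w)\<^sup>2) + (w - cnj w)"
    by (simp only: of_real_diff complex_norm_square of_real_1) (simp add: algebra_simps)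
  hence "Re ((1 + w) * cnj (1 - w)) = 1 - (norm w)\<^sup>2" by simp
  moreover have "(1 + w) / (1 - w) = (1 + w) * cnj (1 - w) / of_real ((norm (1 - w))\<^sup>2)"
    by (simp only: complex_div_cnj[of "1 + w" "1 - w"] of_real_power)
  ultimately have "Re ((1 + w) / (1 - w)) = (1 - (norm w)\<^sup>2) / (norm (1 - w))\<^sup>2"
    by (metis Re_divide_of_real)
  hence pos: "0 < Re ((1 + w) / (1 - w))"
    using w nz by (simp add: power_less_one_iff abs_square_less_1)
  let ?z = "Ln ((1 + w) / (1 - w))"
  have "?z \<in> strip" using Re_Ln_pos_lt_imp[OF pos] by (simp add: strip_def)
  moreover have "(1 + w) / (1 - w) \<noteq> 0" using pos by (metis less_irrefl zero_complex.simps(1))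
  hence "exp ?z = (1 + w) / (1 - w)" by (rule exp_Ln)
  hence "strip_to_disc ?z = ((1 + w) / (1 - w) - 1) / ((1 + w) / (1 - w) + 1)"
    unfolding strip_to_disc_def by simp
  hence "strip_to_disc ?z = w"
  proof -
    have "(1 + w) / (1 - w) - 1 = 2 * w / (1 - w)" "(1 + w) / (1 - w) + 1 = 2 / (1 - w)"
      using nz by (simp_all add: field_simps)
    thus ?thesis using nz \<open>strip_to_disc ?z = _\<close> by simp
  qed
  ultimately show ?thesis by blast
qed

lemma of_real_strip [simp]: "of_real x \<in> strip"
  by (simp add: strip_def)

lemma strip_to_disc_of_real: "strip_to_disc (of_real x) = of_real (tanh (x / 2))"
proof -
  have "(1 - 1 / E) / (1 + 1 / E) = (E - 1) / (E + 1)" if "0 < E" for E :: real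
  proof -
    have "1 - 1 / E = (E - 1) / E" "1 + 1 / E = (E + 1) / E" using that by (simp_all add: field_simps)
    thus ?thesis using that by simp
  qed
  hence "tanh (x / 2) = (exp x - 1) / (exp x + 1)"
    by (simp add: tanh_real_altdef exp_minus inverse_eq_divide)
  hence "of_real (tanh (x / 2)) = (of_real ((exp x - 1) / (exp x + 1)) :: complex)" by simp
  thus ?thesis by (simp add: strip_to_disc_def exp_of_real)
qed

text \<open>Composition with a disc automorphism and a rotation makes the geodesic between the two
  points the segment from 0 to \<open>Y\<close>.\<close>

lemma Riemann_map_normalized:
  assumes U: "open U" "simply_connected U" "U \<noteq> UNIV" and zw: "z \<in> U" "w \<in> U"
  obtains f g Y where "f holomorphic_on ball 0 1" "g holomorphic_on U"
    "\<And>x. x \<in> ball 0 1 \<Longrightarrow> f x \<in> U \<and> g (f x) = x" "\<And>x. x \<in> U \<Longrightarrow> g x \<in> ball 0 1 \<and> f (g x) = x"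
    "g z = 0" "g w = of_real Y" "0 \<le> Y"
proof -
  have "\<exists>f g. f holomorphic_on U \<and> g holomorphic_on ball 0 1 \<and>
      (\<forall>z\<in>U. f z \<in> ball 0 1 \<and> g (f z) = z) \<and> (\<forall>z\<in>ball 0 1. g z \<in> U \<and> f (g z) = z)"
    using iffD1[OF Riemann_mapping_theorem[of U] conjI[OF U(1,2)]] U(3) zw by (elim disjE) auto
  then obtain g0 f0 where h: "g0 holomorphic_on U" "f0 holomorphic_on ball 0 1"
    and gf: "\<And>x. x \<in> U \<Longrightarrow> g0 x \<in> ball 0 1 \<and> f0 (g0 x) = x" "\<And>x. x \<in> ball 0 1 \<Longrightarrow> f0 x \<in> U \<and> g0 (f0 x) = x"
    by (elim exE conjE) (rule that, blast+)
  define X where "X = g0 z"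
  have X: "norm X < 1" using gf(1)[OF zw(1)] by (simp add: X_def)
  let ?M = "Moebius_function 0 X" and ?N = "Moebius_function 0 (- X)"
  define W where "W = ?M (g0 w)"
  \<comment> \<open>The rotation that makes \<open>W\<close> nonnegative; the value 1 keeps its
    modulus equal to 1 when \<open>W\<close> is 0.\<close>
  define c where "c = (if W = 0 then 1 else cnj W / of_real (norm W))"
  have nc: "norm c = 1" by (simp add: c_def norm_divide)
  have cW: "c * W = of_real (norm W)"
  proof (cases "W = 0")
    case False
    have "c * W = (of_real (norm W))\<^sup>2 / of_real (norm W)"
      using False complex_norm_square[of W] by (simp add: c_def mult.commute)
    thus ?thesis using False by (simp add: power2_eq_square)
  qed (simp add: c_def)
  have cc: "cnj c * c = 1" using complex_norm_square[of c] nc by (simp add: mult.commute)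
  define g where "g x = c * ?M (g0 x)" for x
  define f where "f x = f0 (?N (cnj c * x))" for x
  have N: "norm (?N x) < 1" if "norm x < 1" for x using X that by (intro Moebius_function_norm_lt_1) auto
  have M: "norm (?M x) < 1" if "norm x < 1" for x using X that by (intro Moebius_function_norm_lt_1) auto
  have "(?M \<circ> g0) holomorphic_on U"
    using gf by (intro holomorphic_on_compose_gen[OF h(1) Moebius_function_holomorphic[OF X]]) auto
  hence g: "g holomorphic_on U" unfolding g_def o_def by (intro holomorphic_intros)
  have 1: "(?N \<circ> (\<lambda>x. cnj c * x)) holomorphic_on ball 0 1"
    using nc X by (intro holomorphic_on_compose_gen[OF _ Moebius_function_holomorphic] holomorphic_intros)
      (auto simp: norm_mult)
  have "(f0 \<circ> (?N \<circ> (\<lambda>x. cnj c * x))) holomorphic_on ball 0 1"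
    using nc N by (intro holomorphic_on_compose_gen[OF 1 h(2)]) (auto simp: norm_mult)
  hence f: "f holomorphic_on ball 0 1" unfolding f_def o_def .
  show ?thesis
  proof (rule that[OF f g, where Y = "norm W"])
    show "f x \<in> U \<and> g (f x) = x" if x: "x \<in> ball 0 1" for x
    proof -
      have n: "norm (cnj c * x) < 1" using x nc by (simp add: norm_mult)
      have "g (f x) = c * (cnj c * x)"
        unfolding g_def f_def using gf(2)[of "?N (cnj c * x)"] N[OF n] Moebius_function_inverse(2)[OF X n] by simp
      also have "\<dots> = x" using cc by (metis mult.assoc mult.commute mult_1)
      finally show ?thesis using gf(2)[of "?N (cnj c * x)"] N[OF n] by (simp add: f_def)
    qed
    show "g x \<in> ball 0 1 \<and> f (g x) = x" if x: "x \<in> U" for x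
    proof -
      have n: "norm (g0 x) < 1" using gf(1)[OF x] by simp
      have "cnj c * (c * ?M (g0 x)) = ?M (g0 x)" using cc by (metis mult.assoc mult_1)
      hence "f (g x) = f0 (?N (?M (g0 x)))" unfolding f_def g_def by (rule arg_cong)
      hence "f (g x) = x" using gf(1)[OF x] Moebius_function_inverse(1)[OF X n] by simp
      thus ?thesis using M[OF n] nc by (simp add: g_def norm_mult)
    qed
    show "g z = 0" by (simp add: g_def X_def[symmetric] Moebius_function_eq_zero)
    show "g w = of_real (norm W)" using cW by (simp add: g_def W_def)
  qed simp
qed

section \<open>Short crosscuts separate\<close>

text \<open>Janiszewski's theorem: if the two ends of a crosscut lie in a connected boundary piece \<open>N\<close> inside
  a disc, then one of its two sides lies inside that disc.\<close>

lemma crosscut_side_in_ball: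
  assumes F: "F holomorphic_on strip" "inj_on F strip" and N: "connected N" "N \<inter> F ` strip = {}" "N \<subseteq> cball p \<omega>"
    "closure N \<inter> F ` strip = {}"
    and seg: "F ` {z \<in> strip. Re z = v} \<subseteq> cball p \<omega>"
    and bd: "closure (F ` {z \<in> strip. Re z = v}) - F ` strip \<subseteq> N"
    and x: "x \<in> strip" "Re x < v" "\<omega> < dist p (F x)" and y: "y \<in> strip" "v < Re y" "\<omega> < dist p (F y)"
  shows False
proof -
  define U where "U = F ` strip"
  define l where "l = F ` {z \<in> strip. Re z < v}"
  define r where "r = F ` {z \<in> strip. v < Re z}"
  define sg where "sg = F ` {z \<in> strip. Re z = v}"
  have S: "open strip" unfolding strip_def by (intro open_Collect_less continuous_intros)
  have op: "open (F ` T)" if "open T" "T \<subseteq> strip" for T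
    using that F by (intro open_mapping_thm3) (auto intro: holomorphic_on_subset inj_on_subset)
  have hs: "open {z \<in> strip. Re z < v}" "open {z \<in> strip. v < Re z}"
    using open_Int[OF S open_halfspace_Re_lt[of v]] open_Int[OF S open_halfspace_Re_gt[of v]]
    by (simp_all add: Int_def)
  have ol: "open l" and orr: "open r" and oU: "open U"
    unfolding l_def r_def U_def using hs S by (auto intro!: op)
  have "strip = {z \<in> strip. Re z < v} \<union> {z \<in> strip. Re z = v} \<union> {z \<in> strip. v < Re z}" by auto
  hence Uc: "U = l \<union> sg \<union> r" unfolding U_def l_def r_def sg_def by (metis image_Un)
  have disj: "F ` A \<inter> F ` B = {}" if "A \<subseteq> strip" "B \<subseteq> strip" "A \<inter> B = {}" for A B
    using inj_on_image_Int[OF F(2) that(1,2)] that(3) by simp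
  have dj: "l \<inter> r = {}" "sg \<inter> l = {}" "sg \<inter> r = {}"
    unfolding l_def r_def sg_def by (intro disj; auto)+
  have "convex strip"
  proof -
    have "strip = {z. Im z < pi / 2} \<inter> {z. - (pi / 2) < Im z}" by (auto simp: strip_def)
    moreover have "convex \<dots>" by (intro convex_Int convex_halfspace_Im_lt convex_halfspace_Im_gt)
    ultimately show ?thesis by simp
  qed
  hence cU: "connected U" unfolding U_def
    by (intro connected_continuous_image holomorphic_on_imp_continuous_on F convex_connected)
  \<comment> \<open>\<open>F x\<close> and \<open>F y\<close> can be joined off \<open>Q\<close>,
    outside the disc, and also within \<open>U\<close>. Since \<open>Q\<close> meets the complement
    of \<open>U\<close> in the connected set \<open>closure N\<close>, Janiszewski's theorem joins
    them avoiding both.\<close>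
  define Q where "Q = closure sg \<union> closure N"
  have Qsub: "Q \<subseteq> cball p \<omega>"
    unfolding Q_def sg_def using seg N by (intro Un_least closure_minimal) auto
  have "compact Q" unfolding Q_def
    using bounded_subset[OF bounded_cball Qsub] by (simp add: compact_eq_bounded_closed Q_def closed_Un)
  moreover have "closed (- U)" using oU by (simp add: closed_Compl)
  moreover have "connected (Q \<inter> - U)"
  proof -
    have "Q \<inter> - U = closure N"
      using bd N(4) closure_subset[of N] unfolding Q_def U_def sg_def by auto
    thus ?thesis using N(1) by (simp add: connected_imp_connected_closure)
  qed
  moreover have "connected_component (- Q) (F x) (F y)"
  proof -
    have "connected (- cball p \<omega>)"
      by (intro connected_complement_bounded_convex) auto
    moreover have "F x \<in> - cball p \<omega>" "F y \<in> - cball p \<omega>" using x y by auto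
    ultimately show ?thesis using Qsub
      by (meson Compl_anti_mono connected_component_def)
  qed
  moreover have "connected_component (- (- U)) (F x) (F y)"
    using cU x y unfolding connected_component_def by (intro exI[of _ U]) (auto simp: U_def)
  ultimately have "connected_component (- (Q \<union> - U)) (F x) (F y)" by (rule Janiszewski)
  then obtain C where C: "connected C" "C \<subseteq> - (Q \<union> - U)" "F x \<in> C" "F y \<in> C"
    unfolding connected_component_def by blast
  \<comment> \<open>A connected subset of \<open>U\<close> missing the crosscut cannot pass from
    \<open>l\<close> to \<open>r\<close>.\<close>
  have "sg \<subseteq> Q" using closure_subset[of sg] by (auto simp: Q_def)
  hence "C \<subseteq> l \<union> r" using C(2) Uc by auto
  moreover have "F x \<in> l" "F y \<in> r" using x y by (auto simp: l_def r_def)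
  ultimately show False
    using connectedD[OF C(1) ol orr] dj C(3,4) by blast
qed

section \<open>Almost-geodesics near a boundary point\<close>

lemma absolutely_continuous_path_continuous_on:
  assumes "absolutely_continuous_path I \<sigma>" shows "continuous_on I \<sigma>"
  unfolding continuous_on_iff
proof (intro ballI allI impI)
  fix x and e :: real assume x: "x \<in> I" and e: "0 < e"
  obtain d where d: "d > 0" and bound: "\<forall>(n::nat) a b. (\<forall>i<n. a i \<in> I \<and> b i \<in> I \<and> a i \<le> b i) \<and>
        (\<forall>i<n. \<forall>j<n. i \<noteq> j \<longrightarrow> {a i<..<b i} \<inter> {a j<..<b j} = {}) \<and>
        (\<Sum>i<n. b i - a i) < d \<longrightarrow> (\<Sum>i<n. norm (\<sigma> (b i) - \<sigma> (a i))) < e"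
    using assms e unfolding absolutely_continuous_path_def by blast
  have "dist (\<sigma> y) (\<sigma> x) < e" if y: "y \<in> I" "dist y x < d" for y
    using bound[rule_format, of 1 "\<lambda>_. min x y" "\<lambda>_. max x y"] x y
    by (cases "x \<le> y") (auto simp: dist_norm norm_minus_commute)
  thus "\<exists>d>0. \<forall>x'\<in>I. dist x' x < d \<longrightarrow> dist (\<sigma> x') (\<sigma> x) < e" using d by blast
qed

lemma first_time:
  fixes f :: "real \<Rightarrow> real"
  assumes f: "continuous_on {u..b} f" and ub: "u \<le> b" "f u \<le> c" "c \<le> f b"
  shows "\<exists>t\<in>{u..b}. f t = c \<and> (\<forall>x\<in>{u..t}. f x \<le> c)"
proof -
  define S where "S = {u..b} \<inter> f -` {c..}"
  have "closed S" unfolding S_def by (rule continuous_closed_preimage[OF f]) auto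
  hence "compact ({u..b} \<inter> S)" by (intro compact_Int_closed) auto
  moreover have "{u..b} \<inter> S = S" by (auto simp: S_def)
  moreover have "S \<noteq> {}" using ub by (auto simp: S_def)
  ultimately obtain t where t: "t \<in> S" "\<And>x. x \<in> S \<Longrightarrow> t \<le> x"
    using compact_attains_inf[of S] by auto
  have t': "u \<le> t" "t \<le> b" "c \<le> f t" using t(1) by (auto simp: S_def)
  obtain y where y: "u \<le> y" "y \<le> t" "f y = c"
    using IVT'[of f u c t] ub t' continuous_on_subset[OF f, of "{u..t}"] by auto
  hence "y = t" using t(2)[of y] t' by (auto simp: S_def)
  moreover have "f x \<le> c" if "x \<in> {u..t}" for x
  proof (rule ccontr)
    assume "\<not> f x \<le> c"
    hence "x \<in> S" using that t' by (auto simp: S_def)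
    hence "x = t" using t(2)[of x] that by simp
    thus False using \<open>\<not> f x \<le> c\<close> \<open>y = t\<close> y by simp
  qed
  ultimately show ?thesis using y t' by (intro bexI[of _ t]) auto
qed

lemma last_time:
  fixes f :: "real \<Rightarrow> real"
  assumes f: "continuous_on {a..u} f" and au: "a \<le> u" "f u \<le> c" "c \<le> f a"
  shows "\<exists>t\<in>{a..u}. f t = c \<and> (\<forall>x\<in>{t..u}. f x \<le> c)"
proof -
  have "continuous_on {-u..-a} (\<lambda>x. f (- x))"
    by (rule continuous_on_compose2[OF f]) (auto intro!: continuous_intros)
  then obtain t where t: "t \<in> {-u..-a}" "f (- t) = c" "\<And>x. x \<in> {-u..t} \<Longrightarrow> f (- x) \<le> c"
    using first_time[of "-u" "-a" "\<lambda>x. f (- x)" c] au by auto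
  have "f x \<le> c" if "x \<in> {-t..u}" for x using t(3)[of "- x"] that by simp
  thus ?thesis using t by (intro bexI[of _ "- t"]) auto
qed

section \<open>Speed, distortion and topology near the boundary point\<close>

context continuum_boundary_point
begin

definition cmetric :: real where "cmetric = 2 * schottky_bound (1/2)"

lemma cmetric_pos: "0 < cmetric"
  using schottky_bound_pos[of "1/2"] by (simp add: cmetric_def)

text \<open>Let \<open>E\<close> be the largest displacement from the starting point. Along the
  curve the distance to the boundary is at most \<open>bdist (\<sigma> s) + E\<close>, so the speed
  is at most \<open>cmetric * lam\<close> times this; for short times the resulting multiple of
  \<open>E\<close> is absorbed on the left.\<close>

lemma almost_geodesic_lipschitz:
  assumes ag: "almost_geodesic \<Omega> lam kap I \<sigma>" and st: "{s..t} \<subseteq> I" "s \<le> t"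
    and near: "\<And>x. x \<in> {s..t} \<Longrightarrow> dist p (\<sigma> x) < \<epsilon> / 4"
    and lam: "0 < lam" and small: "cmetric * lam * (t - s) \<le> 1/2"
  shows "norm (\<sigma> t - \<sigma> s) \<le> 2 * cmetric * lam * bdist (\<sigma> s) * (t - s)"
proof -
  have AC: "absolutely_continuous_path I \<sigma>" and im: "\<sigma> ` I \<subseteq> \<Omega>"
    and AE: "AE t in lborel. t \<in> I \<longrightarrow>
        (\<exists>v. (\<sigma> has_vector_derivative v) (at t within I) \<and> kobayashi_metric \<Omega> (\<sigma> t) v \<le> lam)"
    using ag unfolding almost_geodesic_def by blast+
  have inO: "\<sigma> x \<in> \<Omega>" if "x \<in> {s..t}" for x using im st that by blast
  have cont: "continuous_on {s..t} (\<lambda>x. norm (\<sigma> x - \<sigma> s))"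
    using continuous_on_subset[OF absolutely_continuous_path_continuous_on[OF AC] st(1)]
    by (intro continuous_intros)
  obtain m where m: "m \<in> {s..t}" "\<And>x. x \<in> {s..t} \<Longrightarrow> norm (\<sigma> x - \<sigma> s) \<le> norm (\<sigma> m - \<sigma> s)"
    using continuous_attains_sup[OF compact_Icc _ cont] st(2) by auto
  define E \<delta> h where "E = norm (\<sigma> m - \<sigma> s)" and "\<delta> = bdist (\<sigma> s)" and "h = t - s"
  have h: "0 \<le> h" using st by (simp add: h_def)
  have \<delta>: "0 < \<delta>" using bdist_pos[OF inO] st(2) by (simp add: \<delta>_def)
  define c where "c = cmetric * lam"
  have c: "0 < c" using cmetric_pos lam by (simp add: c_def)
  have "norm (\<sigma> m - \<sigma> s) \<le> (c * (\<delta> + E)) * (m - s)"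
  proof (rule absolutely_continuous_path_lipschitz[OF AC])
    show "{s..m} \<subseteq> I" "s \<le> m" using m(1) st by auto
    show "0 \<le> c * (\<delta> + E)" using c \<delta> by (simp add: E_def)
    show "AE x in lborel. x \<in> {s..m} \<longrightarrow> (\<exists>v. (\<sigma> has_vector_derivative v) (at x within I) \<and> norm v \<le> c * (\<delta> + E))"
      using AE
    proof eventually_elim
      case (elim x)
      show ?case
      proof
        assume x: "x \<in> {s..m}"
        hence x': "x \<in> {s..t}" using m(1) by auto
        then obtain v where v: "(\<sigma> has_vector_derivative v) (at x within I)" "kobayashi_metric \<Omega> (\<sigma> x) v \<le> lam"
          using elim st by blast
        have "norm v \<le> cmetric * bdist (\<sigma> x) * kobayashi_metric \<Omega> (\<sigma> x) v"
          unfolding cmetric_def by (rule norm_le_kobayashi_metric[OF inO[OF x'] near[OF x']])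
        also have "\<dots> \<le> cmetric * bdist (\<sigma> x) * lam"
          using v(2) cmetric_pos bdist_pos[OF inO[OF x']] by (intro mult_left_mono) auto
        also have "\<dots> \<le> cmetric * (\<delta> + E) * lam"
        proof -
          have "bdist (\<sigma> x) \<le> \<delta> + E"
            using bdist_lipschitz[of "\<sigma> x" "\<sigma> s"] m(2)[OF x'] by (simp add: E_def \<delta>_def dist_norm)
          thus ?thesis using cmetric_pos lam by (intro mult_right_mono mult_left_mono) auto
        qed
        finally show "\<exists>v. (\<sigma> has_vector_derivative v) (at x within I) \<and> norm v \<le> c * (\<delta> + E)"
          using v(1) by (auto simp: c_def mult_ac)
      qed
    qed
  qed
  also have "\<dots> \<le> (c * (\<delta> + E)) * h"
    using m(1) c \<delta> by (intro mult_left_mono) (auto simp: h_def E_def)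
  finally have *: "E \<le> c * h * \<delta> + c * h * E" by (simp add: E_def algebra_simps)
  have "c * h \<le> 1/2" using small by (simp add: c_def h_def)
  hence "c * h * E \<le> 1/2 * E" by (intro mult_right_mono) (auto simp: E_def)
  hence "E \<le> 2 * (c * h * \<delta>)" using * by linarith
  moreover have "norm (\<sigma> t - \<sigma> s) \<le> E" using m(2)[of t] st(2) by (simp add: E_def)
  ultimately show ?thesis by (simp add: c_def h_def \<delta>_def mult_ac)
qed

text \<open>After moving \<open>a\<close> to 0 by an automorphism, a hyperbolic ball of fixed radius
  has an image whose size is a multiple of the distance from its centre to the boundary; so it is
  small when that centre is near the boundary.\<close>

lemma norm_diff_le_bdist_poincare:
  assumes f: "f holomorphic_on ball 0 1" "f ` ball 0 1 \<subseteq> \<Omega>" and ab: "norm a < 1" "norm b < 1"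
    and z: "dist p (f a) < \<epsilon> / 4" and D: "0 < D" "poincare_dist a b \<le> D"
  shows "norm (f b - f a) \<le> (schottky_bound (tanh D) + 1) * bdist (f a)"
proof -
  let ?N = "Moebius_function 0 (- a)"
  have na: "norm (- a) < 1" using ab by simp
  have N: "norm (?N x) < 1" if "norm x < 1" for x using that by (intro Moebius_function_norm_lt_1[OF na])
  have F: "(f \<circ> ?N) holomorphic_on ball 0 1"
    using N by (intro holomorphic_on_compose_gen[OF Moebius_function_holomorphic[OF na] f(1)]) auto
  have im: "(f \<circ> ?N) ` ball 0 1 \<subseteq> \<Omega>" using f(2) N by auto
  have 0: "(f \<circ> ?N) 0 = f a" by (simp add: Moebius_function_simple)
  have "norm (Moebius_function 0 a b) \<le> tanh D"
    using D(2) poincare_dist_le_iff[OF ab] by (simp add: pseudo_dist_eq_Moebius[symmetric] pseudo_dist_commute)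
  from norm_diff_le_bdist[OF F im _ _ _ this] show ?thesis
    unfolding 0 using z D tanh_real_lt_1 Moebius_function_inverse(1)[OF ab] by simp
qed

text \<open>For simple connectedness: a complementary component inside the ball would have a
  frontier point on \<open>P\<close>, hence contain the whole connected set \<open>P\<close>, which
  leaves the ball. Any other complementary component contains the outside of the ball and is
  unbounded.\<close>

lemma component_near_boundary:
  assumes z: "z \<in> \<Omega>" "dist p z < \<epsilon>"
  defines "U \<equiv> connected_component_set (\<Omega> \<inter> ball p \<epsilon>) z"
  shows "open U" "z \<in> U" "U \<subseteq> \<Omega> \<inter> ball p \<epsilon>" "frontier U \<inter> ball p \<epsilon> \<subseteq> frontier \<Omega>" "simply_connected U"
proof -
  show oU: "open U" unfolding U_def by (intro open_connected_component open_Int open_\<Omega> open_ball)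
  show zU: "z \<in> U" unfolding U_def using z by simp
  show sub: "U \<subseteq> \<Omega> \<inter> ball p \<epsilon>" unfolding U_def by (rule connected_component_subset)
  have "frontier U \<subseteq> frontier \<Omega> \<union> frontier (ball p \<epsilon>)"
    unfolding U_def using frontier_of_connected_component_subset frontier_Int_subset by fast
  moreover have "frontier (ball p \<epsilon>) \<inter> ball p \<epsilon> = {}"
    by (simp add: frontier_def interior_open Diff_Int_distrib2)
  ultimately show fr: "frontier U \<inter> ball p \<epsilon> \<subseteq> frontier \<Omega>" by blast
  have "\<not> bounded C" if C: "C \<in> components (- U)" for C
  proof (cases "C \<inter> - ball p \<epsilon> = {}")
    case False
    have "connected (- ball p \<epsilon>)" by (intro connected_complement_bounded_convex) auto
    hence "- ball p \<epsilon> \<subseteq> C" using components_maximal[OF C, of "- ball p \<epsilon>"] sub False by blast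
    moreover have "\<not> bounded (- ball p \<epsilon>)"
      using cobounded_imp_unbounded[of "- ball p \<epsilon>"] by simp
    ultimately show ?thesis using bounded_subset by blast
  next
    case True
    have cC: "closed C" using C closed_components oU by (metis closed_Compl)
    have "C \<noteq> {}" using C by (rule in_components_nonempty)
    moreover have "C \<noteq> UNIV" using C zU in_components_subset by blast
    ultimately obtain x where x: "x \<in> frontier C" using frontier_eq_empty by blast
    have "x \<in> C" using x cC frontier_subset_closed by blast
    moreover have "x \<in> frontier U" using x frontier_of_components_subset[OF C] by (auto simp: frontier_complement)
    ultimately have "x \<in> P" using fr near True by blast
    hence "P \<inter> C \<noteq> {}" using \<open>x \<in> C\<close> by blast
    moreover have "P \<subseteq> - U" using P_sub sub disjoint_frontier by blast
    ultimately have "P \<subseteq> C" using components_maximal[OF C conn_P] by blast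
    moreover obtain q where "q \<in> P" "\<epsilon> \<le> dist p q" using far by blast
    ultimately show ?thesis using True by force
  qed
  thus "simply_connected U"
    using simply_connected_eq_unbounded_complement_components[OF oU] unfolding U_def by simp
qed

end

context continuum_boundary_point
begin

text \<open>The curve is pulled back to the disc by a Riemann map \<open>f\<close> of the component \<open>U\<close> containing it.
  There it is a quasi-geodesic, so a point of the geodesic between its ends is mapped close to \<open>p\<close>;
  a short crosscut through that geodesic then separates the two ends.\<close>

lemma almost_geodesic_avoids_point:
  assumes lc: "\<And>\<rho>. 0 < \<rho> \<Longrightarrow> \<exists>d>0. \<exists>N. connected N \<and> frontier \<Omega> \<inter> ball p d \<subseteq> N \<and> N \<subseteq> frontier \<Omega> \<inter> ball p \<rho>"
    and lam: "0 < lam" and kap: "0 \<le> kap" and r: "0 < r"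
  shows "\<exists>\<tau>>0. \<forall>\<sigma> T a u b. almost_geodesic \<Omega> lam kap {0..T} \<sigma> \<longrightarrow> 0 \<le> a \<longrightarrow> a \<le> u \<longrightarrow> u \<le> b \<longrightarrow> b \<le> T \<longrightarrow>
           r \<le> dist p (\<sigma> a) \<longrightarrow> r \<le> dist p (\<sigma> b) \<longrightarrow> \<tau> \<le> dist p (\<sigma> u)"
proof -
  \<comment> \<open>A sub-arc within \<open>r'\<close> of \<open>p\<close> stays in the disc of
    radius \<epsilon>/4 where the metric is controlled.\<close>
  define r' where "r' = min r (\<epsilon> / 8)"
  have r': "0 < r'" "r' \<le> r" "r' < \<epsilon> / 4" using r \<epsilon> by (auto simp: r'_def)
  define L where "L = 2 * cmetric * lam"
  have L: "0 < L" using cmetric_pos lam by (simp add: L_def)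
  \<comment> \<open>Over times up to \<open>h\<close> the curve moves by at most half of its
    distance to the boundary.\<close>
  define h where "h = 1 / (2 * L)"
  have h: "0 < h" "L * h = 1/2" using L by (auto simp: h_def)
  obtain N where N: "2 \<le> N" "\<And>S. N \<le> S \<Longrightarrow> morse_bound L lam kap S < 1/2"
    using exists_Morse_constant[of L lam kap] by blast
  define N1 where "N1 = N + (lam * (2 * N + kap) / h + 1)"
  have N1: "0 < N1" using N h lam kap by (simp add: N1_def add_pos_nonneg)
  obtain d0 Nc where d0: "d0 > 0" and Nc: "connected Nc" "frontier \<Omega> \<inter> ball p d0 \<subseteq> Nc" "Nc \<subseteq> frontier \<Omega> \<inter> ball p (r' / 2)"
    using lc[of "r' / 2"] r' by auto
  define d where "d = min d0 (r' / 2)"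
  \<comment> \<open>Room for a crosscut of diameter at most \<eta> through a point within \<eta> of
    \<open>p\<close>: it stays within \<open>2 * \<eta> < d\<close> of \<open>p\<close>, so its ends
    fall into \<open>Nc\<close>.\<close>
  define \<eta> where "\<eta> = d / 3"
  have d: "0 < d" "d \<le> d0" "d \<le> r' / 2" "0 < \<eta>" "3 * \<eta> = d" using d0 r' by (auto simp: d_def \<eta>_def)
  have "sqrt 2 < 3/2" by (rule real_less_lsqrt) (auto simp: power2_eq_square)
  hence k0: "0 < 3 - 2 * sqrt 2" by simp
  obtain M where M: "0 < M" "8 * \<epsilon> * sqrt (pi / (2 * M)) / (3 - 2 * sqrt 2) \<le> \<eta>"
  proof -
    have "((\<lambda>M::real. pi / (2 * M)) \<longlongrightarrow> 0) at_top" by real_asymp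
    hence "((\<lambda>M. 8 * \<epsilon> * sqrt (pi / (2 * M)) / (3 - 2 * sqrt 2)) \<longlongrightarrow> 8 * \<epsilon> * sqrt 0 / (3 - 2 * sqrt 2)) at_top"
      using k0 by (intro tendsto_intros) auto
    hence "\<forall>\<^sub>F M in at_top. 8 * \<epsilon> * sqrt (pi / (2 * M)) / (3 - 2 * sqrt 2) < \<eta>"
      using d by (intro order_tendstoD) auto
    hence "\<forall>\<^sub>F M in at_top. 8 * \<epsilon> * sqrt (pi / (2 * M)) / (3 - 2 * sqrt 2) < \<eta> \<and> 0 < M"
      using eventually_gt_at_top by (rule eventually_conj)
    then obtain M where "8 * \<epsilon> * sqrt (pi / (2 * M)) / (3 - 2 * sqrt 2) < \<eta>" "0 < M"
      using eventually_happens'[OF trivial_limit_at_top_linorder] by blast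
    thus ?thesis using that by simp
  qed
  \<comment> \<open>The distortion over the whole stretch, whose points are at Poincare distance at
    most \<open>M / 2 + N1\<close> from the pulled-back curve point. As \<open>B\<close> depends on
    \<open>M\<close>, \<tau> is chosen last.\<close>
  define B where "B = schottky_bound (tanh (M / 2 + N1)) + 1"
  have B: "1 \<le> B" using schottky_bound_pos[of "tanh (M / 2 + N1)"] by (simp add: B_def)
  define \<tau> where "\<tau> = min (\<eta> / (B + 1)) r'"
  have \<tau>: "0 < \<tau>" "\<tau> \<le> r'" "(B + 1) * \<tau> \<le> \<eta>"
  proof -
    have "(B + 1) * \<tau> \<le> (B + 1) * (\<eta> / (B + 1))" using B by (intro mult_left_mono) (auto simp: \<tau>_def)
    thus "0 < \<tau>" "\<tau> \<le> r'" "(B + 1) * \<tau> \<le> \<eta>" using B d r' by (auto simp: \<tau>_def)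
  qed
  have False if ag: "almost_geodesic \<Omega> lam kap {0..T} \<sigma>" and abu: "0 \<le> a0" "a0 \<le> u" "u \<le> b0" "b0 \<le> T"
    and ends: "r \<le> dist p (\<sigma> a0)" "r \<le> dist p (\<sigma> b0)" and close: "dist p (\<sigma> u) < \<tau>" for \<sigma> T a0 u b0
  proof -
    have AC: "absolutely_continuous_path {0..T} \<sigma>" and im: "\<sigma> ` {0..T} \<subseteq> \<Omega>"
      and lower: "\<And>s t. s \<in> {0..T} \<Longrightarrow> t \<in> {0..T} \<Longrightarrow> \<bar>s - t\<bar> / lam - kap \<le> kobayashi_dist \<Omega> (\<sigma> s) (\<sigma> t)"
      using ag unfolding almost_geodesic_def by blast+
    have cont: "continuous_on {0..T} \<sigma>" using absolutely_continuous_path_continuous_on[OF AC] .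
    have cd: "continuous_on {x..y} (\<lambda>t. dist p (\<sigma> t))" if "0 \<le> x" "y \<le> T" for x y
      using that by (intro continuous_intros continuous_on_subset[OF cont]) auto
    \<comment> \<open>Cuts out a sub-arc around \<open>u\<close> that stays within \<open>r'\<close>
      of \<open>p\<close> and has both ends at distance exactly \<open>r'\<close>.\<close>
    obtain a where a: "a \<in> {a0..u}" "dist p (\<sigma> a) = r'" "\<And>x. x \<in> {a..u} \<Longrightarrow> dist p (\<sigma> x) \<le> r'"
      using last_time[OF cd, of a0 u r'] abu ends close \<tau> r' by auto
    obtain b where b: "b \<in> {u..b0}" "dist p (\<sigma> b) = r'" "\<And>x. x \<in> {u..b} \<Longrightarrow> dist p (\<sigma> x) \<le> r'"
      using first_time[OF cd, of u b0 r'] abu ends close \<tau> r' by auto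
    have ab: "a \<le> u" "u \<le> b" "a \<le> b" "{a..b} \<subseteq> {0..T}" using a(1) b(1) abu by auto
    have near': "dist p (\<sigma> x) \<le> r'" if "x \<in> {a..b}" for x
      using a(3)[of x] b(3)[of x] that by (cases "x \<le> u") auto
    have inO: "\<sigma> x \<in> \<Omega>" if "x \<in> {a..b}" for x using im ab that by blast
    have ue: "dist p (\<sigma> u) < \<epsilon> / 4" using near'[of u] ab r' by simp
    define U where "U = connected_component_set (\<Omega> \<inter> ball p \<epsilon>) (\<sigma> u)"
    have uu: "\<sigma> u \<in> \<Omega>" "dist p (\<sigma> u) < \<epsilon>" using inO[of u] ab ue \<epsilon> by auto
    have U: "open U" "\<sigma> u \<in> U" "U \<subseteq> \<Omega> \<inter> ball p \<epsilon>" "frontier U \<inter> ball p \<epsilon> \<subseteq> frontier \<Omega>" "simply_connected U"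
      unfolding U_def by (rule component_near_boundary[OF uu])+
    have maxU: "C \<subseteq> U" if C: "connected C" "C \<subseteq> \<Omega> \<inter> ball p \<epsilon>" "C \<inter> U \<noteq> {}" for C
    proof -
      obtain c where c: "c \<in> C" "c \<in> U" using C by blast
      hence "connected_component_set (\<Omega> \<inter> ball p \<epsilon>) c = U" unfolding U_def by (metis connected_component_eq)
      thus ?thesis using connected_component_maximal[OF c(1) C(1,2)] by simp
    qed
    have \<sigma>U: "\<sigma> x \<in> U" if "x \<in> {a..b}" for x
    proof -
      have "connected (\<sigma> ` {a..b})" using continuous_on_subset[OF cont ab(4)] by (intro connected_continuous_image) auto
      moreover have "\<sigma> ` {a..b} \<subseteq> \<Omega> \<inter> ball p \<epsilon>" using inO near' r' \<epsilon> by force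
      moreover have "\<sigma> u \<in> \<sigma> ` {a..b}" using ab by auto
      ultimately show ?thesis using maxU[of "\<sigma> ` {a..b}"] U(2) that by blast
    qed
    have ballU: "ball (\<sigma> x) (bdist (\<sigma> x)) \<subseteq> U" if x: "x \<in> {a..b}" for x
    proof (rule maxU)
      have "dist p (\<sigma> x) + bdist (\<sigma> x) < \<epsilon>" using near'[OF x] bdist_le[of "\<sigma> x"] r' by (simp add: dist_commute)
      moreover have "dist p y \<le> dist p (\<sigma> x) + dist (\<sigma> x) y" for y by (rule dist_triangle)
      ultimately have "ball (\<sigma> x) (bdist (\<sigma> x)) \<subseteq> ball p \<epsilon>"
        by (smt (verit) mem_ball subset_iff)
      thus "ball (\<sigma> x) (bdist (\<sigma> x)) \<subseteq> \<Omega> \<inter> ball p \<epsilon>" using ball_bdist_subset[OF inO[OF x]] by blast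
      show "ball (\<sigma> x) (bdist (\<sigma> x)) \<inter> U \<noteq> {}" using \<sigma>U[OF x] bdist_pos[OF inO[OF x]] by force
    qed simp
    have "U \<noteq> UNIV" using U(3) bounded_subset[OF bounded_ball, of U p \<epsilon>] by (metis le_inf_iff not_bounded_UNIV)
    then obtain f g Y where f: "f holomorphic_on ball 0 1" and g: "g holomorphic_on U"
      and fg: "\<And>x. x \<in> ball 0 1 \<Longrightarrow> f x \<in> U \<and> g (f x) = x" "\<And>x. x \<in> U \<Longrightarrow> g x \<in> ball 0 1 \<and> f (g x) = x"
      and gab: "g (\<sigma> a) = 0" "g (\<sigma> b) = of_real Y" "0 \<le> Y"
      using Riemann_map_normalized[OF U(1,5) _ \<sigma>U[of a] \<sigma>U[of b]] ab by (metis atLeastAtMost_iff order_refl)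
    have f\<Omega>: "f ` ball 0 1 \<subseteq> \<Omega>" using fg(1) U(3) by blast
    define G where "G = g \<circ> \<sigma>"
    have Gn: "norm (G x) < 1" "f (G x) = \<sigma> x" if "x \<in> {a..b}" for x
      using fg(2)[OF \<sigma>U[OF that]] by (auto simp: G_def)
    interpret qg: disc_quasi_geodesic G a b L h lam kap
    proof
      show "pseudo_dist (G s) (G t) \<le> L * (t - s)"
        if st: "s \<in> {a..b}" "t \<in> {a..b}" "s \<le> t" "t - s \<le> h" for s t
      proof -
        define \<delta> where "\<delta> = bdist (\<sigma> s)"
        have \<delta>: "0 < \<delta>" using bdist_pos[OF inO[OF st(1)]] by (simp add: \<delta>_def)
        have "L * (t - s) \<le> L * h" using st L by (intro mult_left_mono) auto
        hence Ls: "L * (t - s) \<le> 1/2" using h by simp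
        have "norm (\<sigma> t - \<sigma> s) \<le> 2 * cmetric * lam * bdist (\<sigma> s) * (t - s)"
        proof (rule almost_geodesic_lipschitz[OF ag _ st(3) _ lam])
          show "{s..t} \<subseteq> {0..T}" using st ab by auto
          show "dist p (\<sigma> x) < \<epsilon> / 4" if "x \<in> {s..t}" for x using near'[of x] that st r' by auto
          show "cmetric * lam * (t - s) \<le> 1/2" using Ls cmetric_pos lam st by (simp add: L_def)
        qed
        also have "2 * cmetric * lam * bdist (\<sigma> s) * (t - s) = L * (t - s) * \<delta>"
          by (simp only: L_def \<delta>_def mult_ac)
        finally have D: "dist (\<sigma> s) (\<sigma> t) \<le> L * (t - s) * \<delta>"
          by (simp add: dist_norm norm_minus_commute)
        also have "L * (t - s) * \<delta> \<le> 1/2 * \<delta>" using Ls \<delta> by (intro mult_right_mono) auto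
        finally have "dist (\<sigma> s) (\<sigma> t) < \<delta>" using \<delta> by linarith
        \<comment> \<open>A step shorter than the distance to the boundary stays in a round disc
          inside \<open>U\<close>, on which \<open>g\<close> is defined.\<close>
        hence "pseudo_dist (g (\<sigma> s)) (g (\<sigma> t)) \<le> dist (\<sigma> s) (\<sigma> t) / \<delta>"
          using ballU[OF st(1)] fg(2) holomorphic_on_subset[OF g]
          by (intro pseudo_dist_le_Schwarz) (auto simp: \<delta>_def subset_iff)
        also have "\<dots> \<le> L * (t - s)" using D \<delta> by (simp add: divide_le_eq)
        finally show ?thesis by (simp add: G_def)
      qed
      show "\<bar>s - t\<bar> \<le> lam * (poincare_dist (G s) (G t) + kap)" if st: "s \<in> {a..b}" "t \<in> {a..b}" for s t
      proof -
        have "kobayashi_dist \<Omega> (f (G s)) (f (G t)) \<le> poincare_dist (G s) (G t)"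
          using Gn st by (intro kobayashi_dist_le_poincare_dist f f\<Omega>) auto
        moreover have "\<bar>s - t\<bar> / lam - kap \<le> kobayashi_dist \<Omega> (\<sigma> s) (\<sigma> t)"
          using st ab by (intro lower) auto
        ultimately have "\<bar>s - t\<bar> / lam \<le> poincare_dist (G s) (G t) + kap" using Gn st by simp
        thus ?thesis using lam by (simp add: divide_le_eq mult.commute)
      qed
    qed (use ab Gn h L lam kap in auto)
    have Gab: "G a = 0" "G b = of_real Y" "0 \<le> Y" using gab by (auto simp: G_def)
    have uab: "u \<in> {a..b}" "a \<in> {a..b}" "b \<in> {a..b}" using ab by auto
    obtain x where x: "x \<in> {0..Y}" "poincare_dist (of_real x) (G u) \<le> N1"
      using qg.close_to_geodesic[OF Gab N uab(1)] unfolding N1_def by blast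
    have Y1: "Y < 1" using Gn(1)[OF uab(3)] Gab by simp
    have nx: "norm (of_real x :: complex) < 1" "norm (- of_real x :: complex) < 1" using x(1) Y1 by auto
    let ?N = "Moebius_function 0 (- of_real x)" and ?M = "Moebius_function 0 (of_real x)"
    have Nn: "norm (?N z) < 1" if "norm z < 1" for z using that by (intro Moebius_function_norm_lt_1[OF nx(2)])
    have Mn: "norm (?M z) < 1" if "norm z < 1" for z using that by (intro Moebius_function_norm_lt_1[OF nx(1)])
    have NM: "?N (?M z) = z" "?M (?N z) = z" if "norm z < 1" for z
      using Moebius_function_inverse[OF nx(1) that] by auto
    \<comment> \<open>Recentred at the geodesic point \<open>x\<close> close to \<open>G u\<close>:
      0 is mapped to \<open>f x\<close>, and the real axis onto the geodesic through both ends of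
      the sub-arc.\<close>
    define F where "F z = f (?N (strip_to_disc z))" for z
    have sn: "norm (strip_to_disc z) < 1" if "z \<in> strip" for z using strip_to_disc_in_disc[OF that] by simp
    have F1: "(?N \<circ> strip_to_disc) holomorphic_on strip"
      using sn by (intro holomorphic_on_compose_gen[OF holomorphic_strip_to_disc Moebius_function_holomorphic[OF nx(2)]]) auto
    have "(f \<circ> (?N \<circ> strip_to_disc)) holomorphic_on strip"
      using sn Nn by (intro holomorphic_on_compose_gen[OF F1 f]) auto
    hence Fh: "F holomorphic_on strip" unfolding F_def o_def .
    have Finj: "inj_on F strip"
    proof (rule inj_onI)
      fix z w assume zw: "z \<in> strip" "w \<in> strip" "F z = F w"
      have "g (F z) = g (F w)" using zw by simp
      hence "?N (strip_to_disc z) = ?N (strip_to_disc w)"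
        unfolding F_def using fg(1)[of "?N (strip_to_disc z)"] fg(1)[of "?N (strip_to_disc w)"] Nn[OF sn] zw by simp
      hence "?M (?N (strip_to_disc z)) = ?M (?N (strip_to_disc w))" by simp
      hence "strip_to_disc z = strip_to_disc w" using NM(2) sn zw by simp
      thus "z = w" using inj_on_strip_to_disc zw by (auto dest: inj_onD)
    qed
    have Fim: "F ` strip = U"
    proof
      show "F ` strip \<subseteq> U" using fg(1) Nn sn by (auto simp: F_def)
      show "U \<subseteq> F ` strip"
      proof
        fix y assume y: "y \<in> U"
        have "norm (g y) < 1" using fg(2)[OF y] by simp
        moreover obtain z where "z \<in> strip" "strip_to_disc z = ?M (g y)"
          using strip_to_disc_surj[OF Mn[OF \<open>norm (g y) < 1\<close>]] by blast
        ultimately show "y \<in> F ` strip" using NM(1) fg(2)[OF y] by (auto simp: F_def image_iff intro!: bexI[of _ z])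
      qed
    qed
    have real_point: "F (of_real (2 * artanh y)) = f (?N (of_real y))" if "\<bar>y\<bar> < 1" for y
      using tanh_artanh_real[OF that] by (simp only: F_def strip_to_disc_of_real) simp
    \<comment> \<open>\<open>sa\<close> and \<open>sb\<close> are the positions of the two ends on
      the real axis of the strip.\<close>
    define sa where "sa = 2 * artanh (- x)"
    define sb where "sb = 2 * artanh ((Y - x) / (1 - x * Y))"
    have x1: "0 \<le> x" "x < 1" "x \<le> Y" using x(1) Y1 by auto
    have Fsa: "F (of_real sa) = \<sigma> a"
    proof -
      have "?M 0 = of_real (- x)" by (simp add: Moebius_function_simple)
      hence "?N (of_real (- x)) = 0" using NM(1)[of 0] by simp
      thus ?thesis unfolding sa_def using real_point[of "- x"] x1 Gn(2)[OF uab(2)] Gab by simp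
    qed
    have MY: "?M (of_real Y) = of_real ((Y - x) / (1 - x * Y))" by (simp add: Moebius_function_simple)
    have yb: "0 \<le> (Y - x) / (1 - x * Y)" "\<bar>(Y - x) / (1 - x * Y)\<bar> < 1"
    proof -
      have nY: "norm (of_real Y :: complex) < 1" using Y1 Gab by simp
      show "\<bar>(Y - x) / (1 - x * Y)\<bar> < 1" using Mn[OF nY] unfolding MY by (simp only: norm_of_real)
      have "x * Y \<le> 1" using x1 Y1 Gab by (intro mult_le_one) auto
      thus "0 \<le> (Y - x) / (1 - x * Y)" using x1 by simp
    qed
    have Fsb: "F (of_real sb) = \<sigma> b"
    proof -
      have nY: "norm (of_real Y :: complex) < 1" using Y1 Gab by simp
      have "?N (of_real ((Y - x) / (1 - x * Y))) = of_real Y" using NM(1)[OF nY] unfolding MY .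
      thus ?thesis unfolding sb_def using real_point[OF yb(2)] Gn(2)[OF uab(3)] Gab by simp
    qed
    have artanh_nonneg: "0 \<le> artanh y" if "0 \<le> y" "\<bar>y\<bar> < 1" for y :: real
      using that tanh_artanh_real[OF that(2)] tanh_real_nonneg_iff[of "artanh y"] by simp
    have sa0: "sa \<le> 0" using artanh_nonneg[of x] x1 by (simp add: sa_def)
    have sb0: "0 \<le> sb" using artanh_nonneg[OF yb] by (simp add: sb_def)
    have Fv: "dist p (F (of_real v)) < \<eta>" if v: "v \<in> {0..M}" for v
    proof -
      let ?y = "?N (of_real (tanh (v / 2)))"
      have nt: "norm (of_real (tanh (v / 2)) :: complex) < 1"
        using tanh_real_bounds[of "v / 2"] by (simp add: abs_less_iff)
      have "poincare_dist ?y (of_real x) = poincare_dist ?y (?N 0)" by (simp add: Moebius_function_simple)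
      also have "\<dots> = poincare_dist (of_real (tanh (v / 2))) 0"
        using Moebius_pseudo_dist[OF nx(2) nt, of 0] by (simp add: poincare_dist_alt)
      also have "\<dots> = v / 2" using v by (simp add: poincare_dist_alt artanh_tanh_real)
      finally have "poincare_dist ?y (G u) \<le> v / 2 + N1"
        using poincare_dist_triangle[OF Nn[OF nt] Gn(1)[OF uab(1)] nx(1)] x(2) by simp
      hence "poincare_dist (G u) ?y \<le> M / 2 + N1" using v by (simp add: poincare_dist_commute)
      hence "norm (f ?y - f (G u)) \<le> B * bdist (f (G u))"
        unfolding B_def using Gn[OF uab(1)] ue M N1 by (intro norm_diff_le_bdist_poincare f f\<Omega> Nn[OF nt]) auto
      hence "dist (F (of_real v)) (\<sigma> u) \<le> B * bdist (\<sigma> u)"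
        using Gn[OF uab(1)] by (simp add: F_def strip_to_disc_of_real dist_norm)
      moreover have "B * bdist (\<sigma> u) \<le> B * dist p (\<sigma> u)"
        using bdist_le[of "\<sigma> u"] B by (intro mult_left_mono) (auto simp: dist_commute)
      moreover have "dist p (F (of_real v)) \<le> dist p (\<sigma> u) + dist (\<sigma> u) (F (of_real v))" by (rule dist_triangle)
      ultimately have "dist p (F (of_real v)) \<le> (B + 1) * dist p (\<sigma> u)"
        by (simp add: algebra_simps dist_commute)
      also have "\<dots> < (B + 1) * \<tau>" using close B by (intro mult_strict_left_mono) auto
      finally show ?thesis using \<tau> by simp
    qed
    have "F ` strip \<subseteq> ball p \<epsilon>" using Fim U(3) by blast
    then obtain v where v: "v \<in> {0..M}"
      "\<And>z z'. z \<in> strip \<Longrightarrow> z' \<in> strip \<Longrightarrow> Re z = v \<Longrightarrow> Re z' = v \<Longrightarrow>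
        norm (F z - F z') \<le> 8 * \<epsilon> * sqrt (pi / (2 * M)) / (3 - 2 * sqrt 2)"
      using short_vertical_segment[folded strip_def, OF Fh Finj _ M(1), of p \<epsilon>] by blast
    have seg: "F ` {z \<in> strip. Re z = v} \<subseteq> cball p (2 * \<eta>)"
    proof
      fix y assume "y \<in> F ` {z \<in> strip. Re z = v}"
      then obtain z where z: "z \<in> strip" "Re z = v" "y = F z" by auto
      have "dist (F (of_real v)) (F z) \<le> \<eta>" using v(2)[of "of_real v" z] z M(2) by (simp add: dist_norm)
      thus "y \<in> cball p (2 * \<eta>)" using Fv[OF v(1)] dist_triangle[of p "F z" "F (of_real v)"] z by simp
    qed
    \<comment> \<open>Over \<open>{0..M}\<close> the axis stays within \<eta> of \<open>p\<close>,
      whereas the ends are at distance \<open>r'\<close>. Together with \<open>sa \<le> 0\<close>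
      and \<open>0 \<le> sb\<close> this puts \<open>v\<close> strictly between them.\<close>
    have "dist p (\<sigma> a) \<noteq> dist p (F (of_real v))" "dist p (\<sigma> b) > dist p (F (of_real t))" if "t \<in> {0..M}" for t
      using a(2) b(2) Fv[OF v(1)] Fv[OF that] d r' by auto
    hence ne: "sa \<noteq> v" "sb \<notin> {0..M}" using Fsa Fsb v(1) by force+
    hence lr: "sa < v" "v < sb" using sa0 sb0 v(1) by auto
    have dr: "2 * \<eta> \<le> r' / 2" "2 * \<eta> < d0" using d by linarith+
    show False
    proof (rule crosscut_side_in_ball[OF Fh Finj Nc(1)])
      have frU: "frontier \<Omega> \<inter> U = {}" using U(3) disjoint_frontier by blast
      show "Nc \<inter> F ` strip = {}" using Nc(3) frU Fim by blast
      show "Nc \<subseteq> cball p (r' / 2)" using Nc(3) ball_subset_cball by blast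
      have "closure Nc \<subseteq> frontier \<Omega>" using Nc(3) by (intro closure_minimal) auto
      thus "closure Nc \<inter> F ` strip = {}" using frU Fim by blast
      show "F ` {z \<in> strip. Re z = v} \<subseteq> cball p (r' / 2)" using seg subset_cball[OF dr(1)] by blast
      show "closure (F ` {z \<in> strip. Re z = v}) - F ` strip \<subseteq> Nc"
      proof
        fix y assume y: "y \<in> closure (F ` {z \<in> strip. Re z = v}) - F ` strip"
        have "y \<in> closure U" using y Fim closure_mono[of "F ` {z \<in> strip. Re z = v}" U] by blast
        hence yf: "y \<in> frontier U" using y Fim U(1) by (simp add: frontier_def interior_open)
        have "closure (F ` {z \<in> strip. Re z = v}) \<subseteq> cball p (2 * \<eta>)" using seg by (intro closure_minimal) auto
        hence yb: "dist p y \<le> 2 * \<eta>" using y by auto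
        hence "y \<in> frontier \<Omega>" using U(4) yf dr r' by auto
        thus "y \<in> Nc" using Nc(2) yb dr by auto
      qed
      show "of_real sa \<in> strip" "Re (of_real sa) < v" "of_real sb \<in> strip" "v < Re (of_real sb)" using lr by auto
      show "r' / 2 < dist p (F (of_real sa))" "r' / 2 < dist p (F (of_real sb))"
        using Fsa Fsb a b r' by auto
    qed
  qed
  thus ?thesis using \<tau>(1) by (intro exI[of _ \<tau>]) (metis not_le)
qed

end

section \<open>Limits of connected sets\<close>

text \<open>The upper limit of a sequence of sets in the sense of Kuratowski.\<close>

definition limit_set :: "(nat \<Rightarrow> 'a::metric_space set) \<Rightarrow> 'a set" where
  "limit_set g = {z. \<forall>e>0. \<exists>\<^sub>F n in sequentially. g n \<inter> ball z e \<noteq> {}}"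

lemma limit_setD: "z \<in> limit_set g \<Longrightarrow> 0 < e \<Longrightarrow> \<exists>\<^sub>F n in sequentially. g n \<inter> ball z e \<noteq> {}"
  by (simp add: limit_set_def)

text \<open>Otherwise every point of \<open>K\<close> has a ball that \<open>g n\<close> misses for
  all large \<open>n\<close>, and finitely many of these balls cover \<open>K\<close>.\<close>

lemma limit_set_meets_compact:
  assumes K: "compact K" and fr: "\<exists>\<^sub>F n in sequentially. g n \<inter> K \<noteq> {}"
  shows "limit_set g \<inter> K \<noteq> {}"
proof (rule ccontr)
  assume "\<not> ?thesis"
  hence "\<forall>z\<in>K. \<exists>e>0. \<forall>\<^sub>F n in sequentially. g n \<inter> ball z e = {}"
    by (auto simp: limit_set_def frequently_def)
  then obtain e where e: "\<And>z. z \<in> K \<Longrightarrow> e z > 0" "\<And>z. z \<in> K \<Longrightarrow> \<forall>\<^sub>F n in sequentially. g n \<inter> ball z (e z) = {}"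
    by metis
  obtain C where C: "C \<subseteq> K" "finite C" "K \<subseteq> (\<Union>z\<in>C. ball z (e z))"
    using compactE_image[OF K, of K "\<lambda>z. ball z (e z)"] e(1) by force
  have "\<forall>\<^sub>F n in sequentially. \<forall>z\<in>C. g n \<inter> ball z (e z) = {}"
    using C e(2) by (intro eventually_ball_finite) auto
  hence "\<forall>\<^sub>F n in sequentially. g n \<inter> K = {}" by eventually_elim (use C(3) in blast)
  thus False using fr by (simp add: frequently_def)
qed

lemma closed_limit_set: "closed (limit_set g)"
  unfolding closed_limpt
proof (intro allI impI)
  fix z assume z: "z islimpt limit_set g"
  show "z \<in> limit_set g"
    unfolding limit_set_def
  proof (intro CollectI allI impI)
    fix e :: real assume e: "0 < e"
    obtain w where w: "w \<in> limit_set g" "dist w z < e / 2"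
      using z e unfolding islimpt_approachable by (metis half_gt_zero)
    have "ball w (e / 2) \<subseteq> ball z e"
    proof
      fix y assume "y \<in> ball w (e / 2)"
      thus "y \<in> ball z e" using w(2) dist_triangle[of z y w] by (simp add: dist_commute)
    qed
    thus "\<exists>\<^sub>F n in sequentially. g n \<inter> ball z e \<noteq> {}"
      using limit_setD[OF w(1), of "e / 2"] e by (auto elim!: frequently_elim1)
  qed
qed

lemma limit_set_subset_closed:
  assumes "closed A" "\<And>n. g n \<subseteq> A"
  shows "limit_set g \<subseteq> A"
proof (rule ccontr)
  assume "\<not> ?thesis"
  then obtain z where z: "z \<in> limit_set g" "z \<in> - A" by blast
  obtain e where "e > 0" "ball z e \<subseteq> - A" using z(2) assms(1) by (meson open_Compl openE)
  hence "g n \<inter> ball z e = {}" for n using assms(2)[of n] by blast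
  thus False using limit_setD[OF z(1) \<open>e > 0\<close>] by simp
qed

text \<open>Without a convergent selection \<open>x\<close> an upper limit can split, as for
  singletons alternating between two points. If disjoint open sets \<open>V\<close> and
  \<open>W\<close> separate the limit set, then \<open>g n\<close> eventually lies in their union by
  compactness; meeting the side of \<open>l\<close>, it misses the other side, which then contains
  no limit point.\<close>

lemma connected_limit_set:
  fixes g :: "nat \<Rightarrow> 'a::euclidean_space set"
  assumes conn: "\<And>n. connected (g n)" and x: "\<And>n. x n \<in> g n" "x \<longlonglongrightarrow> l"
    and bdd: "\<And>n. g n \<subseteq> cball c R"
  shows "connected (limit_set g)"
proof (rule ccontr)
  let ?L = "limit_set g"
  have cL: "compact (?L \<inter> A)" if "closed A" for A
  proof -
    have "?L \<subseteq> cball c R" by (rule limit_set_subset_closed[OF closed_cball]) (rule bdd)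
    hence "?L \<inter> A = cball c R \<inter> (?L \<inter> A)" by blast
    thus ?thesis by (metis closed_Int closed_limit_set compact_Int_closed compact_cball that)
  qed
  have ev: "\<forall>\<^sub>F n in sequentially. x n \<in> V" if "open V" "l \<in> V" for V
    using x(2) that by (rule topological_tendstoD)
  assume "\<not> connected ?L"
  then obtain A B where AB: "closed A" "closed B" "?L \<subseteq> A \<union> B" "A \<inter> B \<inter> ?L = {}" "A \<inter> ?L \<noteq> {}" "B \<inter> ?L \<noteq> {}"
    unfolding connected_closed by auto
  have lL: "l \<in> ?L"
    unfolding limit_set_def
  proof (intro CollectI allI impI eventually_frequently)
    fix e :: real assume "0 < e"
    have "\<forall>\<^sub>F n in sequentially. x n \<in> ball l e" using \<open>0 < e\<close> by (intro ev) auto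
    thus "\<forall>\<^sub>F n in sequentially. g n \<inter> ball l e \<noteq> {}" by eventually_elim (use x(1) in blast)
  qed simp
  \<comment> \<open>Stated for arbitrary \<open>A\<close> and \<open>B\<close>, as \<open>l\<close>
    may lie on either side.\<close>
  have False if AB: "closed A" "closed B" "?L \<subseteq> A \<union> B" "A \<inter> B \<inter> ?L = {}" "B \<inter> ?L \<noteq> {}" and lA: "l \<in> A" for A B
  proof -
    have "(?L \<inter> A) \<inter> (?L \<inter> B) = {}" using AB by blast
    then obtain V W where VW: "open V" "open W" "?L \<inter> A \<subseteq> V" "?L \<inter> B \<subseteq> W" "V \<inter> W = {}"
      using separation_normal[OF compact_imp_closed[OF cL[OF AB(1)]] compact_imp_closed[OF cL[OF AB(2)]]] by metis
    have "\<not> (\<exists>\<^sub>F n in sequentially. g n \<inter> (cball c R - (V \<union> W)) \<noteq> {})"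
    proof
      assume "\<exists>\<^sub>F n in sequentially. g n \<inter> (cball c R - (V \<union> W)) \<noteq> {}"
      hence "?L \<inter> (cball c R - (V \<union> W)) \<noteq> {}"
        using VW by (intro limit_set_meets_compact compact_diff) auto
      thus False using AB VW by blast
    qed
    hence "\<forall>\<^sub>F n in sequentially. g n \<inter> (cball c R - (V \<union> W)) = {}" by (simp add: frequently_def)
    moreover have "\<forall>\<^sub>F n in sequentially. x n \<in> V" using VW lA lL by (intro ev) auto
    ultimately have "\<forall>\<^sub>F n in sequentially. g n \<inter> W = {}"
    proof eventually_elim
      case (elim n)
      have "g n \<subseteq> V \<union> W" using elim bdd[of n] by blast
      thus ?case using connectedD[OF conn[of n] VW(1,2)] VW(5) elim x(1)[of n] by blast
    qed
    moreover obtain b where b: "b \<in> ?L" "b \<in> B" using AB by blast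
    moreover obtain e where "e > 0" "ball b e \<subseteq> W" using VW b openE by blast
    ultimately have "\<forall>\<^sub>F n in sequentially. g n \<inter> ball b e = {}" by (auto elim!: eventually_mono)
    thus False using limit_setD[OF b(1) \<open>e > 0\<close>] by (simp add: frequently_def)
  qed
  from this[of A B] this[of B A] AB lL show False by (auto simp: Int_commute Un_commute)
qed

text \<open>Besides \<open>l\<close> the limit set has a point at distance at least \<rho> from
  \<open>l\<close>, supplied by compactness from the points \<open>y n\<close>.\<close>

lemma limit_set_not_totally_disconnected:
  fixes g :: "nat \<Rightarrow> 'a::euclidean_space set"
  assumes conn: "\<And>n. connected (g n)" and x: "\<And>n. x n \<in> g n" "x \<longlonglongrightarrow> l"
    and y: "\<And>n. y n \<in> g n" "\<And>n. \<rho> \<le> dist l (y n)" "0 < \<rho>"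
    and bdd: "\<And>n. g n \<subseteq> cball c R" and S: "totally_disconnected S"
  shows "connected (limit_set g)" "l \<in> limit_set g" "\<not> limit_set g \<subseteq> S"
proof -
  show con: "connected (limit_set g)" using connected_limit_set[OF conn x bdd] .
  show l: "l \<in> limit_set g"
    unfolding limit_set_def
  proof (intro CollectI allI impI eventually_frequently)
    fix e :: real assume "0 < e"
    hence "\<forall>\<^sub>F n in sequentially. x n \<in> ball l e" using x(2) by (intro topological_tendstoD) auto
    thus "\<forall>\<^sub>F n in sequentially. g n \<inter> ball l e \<noteq> {}" by eventually_elim (use x(1) in blast)
  qed simp
  have "compact (cball c R - ball l \<rho>)" by (intro compact_diff) auto
  moreover have "\<exists>\<^sub>F n in sequentially. g n \<inter> (cball c R - ball l \<rho>) \<noteq> {}"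
  proof (intro eventually_frequently always_eventually allI)
    fix n
    have "y n \<in> g n \<inter> (cball c R - ball l \<rho>)" using y(1,2)[of n] bdd[of n] by auto
    thus "g n \<inter> (cball c R - ball l \<rho>) \<noteq> {}" by blast
  qed simp
  ultimately obtain z where z: "z \<in> limit_set g" "z \<notin> ball l \<rho>" using limit_set_meets_compact by blast
  show "\<not> limit_set g \<subseteq> S"
  proof
    assume sub: "limit_set g \<subseteq> S"
    hence "limit_set g \<subseteq> connected_component_set S l" using con l by (intro connected_component_maximal)
    also have "\<dots> = {l}" using S l sub by (auto simp: totally_disconnected_def)
    finally show False using z y(3) by auto
  qed
qed

section \<open>Domains with locally connected boundary outside a totally disconnected set\<close>

locale tame_boundary =
  fixes \<Omega> S :: "complex set"
  assumes open_\<Omega>: "open \<Omega>" and connected_\<Omega>: "connected \<Omega>" and td: "totally_disconnected S"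
    and lc: "\<And>p. p \<in> frontier \<Omega> - S \<Longrightarrow> locally_connected_at p (top_of_set (frontier \<Omega>))"
    and nondeg: "\<And>p. p \<in> frontier \<Omega> - S \<Longrightarrow> connected_component_set (frontier \<Omega>) p \<noteq> {p}"
begin

lemma connected_frontier_neighbourhood:
  assumes p: "p \<in> frontier \<Omega> - S" and \<rho>: "0 < \<rho>"
  shows "\<exists>d>0. \<exists>N. connected N \<and> p \<in> N \<and> frontier \<Omega> \<inter> ball p d \<subseteq> N \<and> N \<subseteq> frontier \<Omega> \<inter> ball p \<rho>"
proof -
  have "openin (top_of_set (frontier \<Omega>)) (frontier \<Omega> \<inter> ball p \<rho>)" by (intro openin_open_Int open_ball)
  moreover have "p \<in> frontier \<Omega> \<inter> ball p \<rho>" using p \<rho> by simp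
  ultimately obtain U N where UN: "openin (top_of_set (frontier \<Omega>)) U" "connectedin (top_of_set (frontier \<Omega>)) N"
    "p \<in> U" "U \<subseteq> N" "N \<subseteq> frontier \<Omega> \<inter> ball p \<rho>"
    using lc[OF p] unfolding locally_connected_at_def neighbourhood_base_at_def by meson
  have "connected N" using UN(2) by (simp add: connectedin_subtopology)
  moreover obtain d where "d > 0" "ball p d \<inter> frontier \<Omega> \<subseteq> U"
    using UN(1,3) unfolding openin_contains_ball by blast
  ultimately show ?thesis using UN by (intro exI[of _ d] conjI exI[of _ N]) auto
qed

text \<open>Local connectedness puts the whole boundary near \<open>p\<close> into the component of
  \<open>p\<close>, which has a further point \<open>q\<close>; \<epsilon> is kept at most the
  distance to \<open>q\<close>.\<close>

lemma frontier_point_on_continuum: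
  assumes p: "p \<in> frontier \<Omega> - S"
  shows "\<exists>P \<epsilon>. continuum_boundary_point \<Omega> P p \<epsilon>"
proof -
  let ?P = "connected_component_set (frontier \<Omega>) p"
  have pP: "p \<in> ?P" using p by simp
  obtain q where q: "q \<in> ?P" "q \<noteq> p" using nondeg[OF p] pP by blast
  obtain d N where d: "d > 0" and N: "connected N" "p \<in> N" "frontier \<Omega> \<inter> ball p d \<subseteq> N" "N \<subseteq> frontier \<Omega> \<inter> ball p 1"
    using connected_frontier_neighbourhood[OF p, of 1] by auto
  have "N \<subseteq> ?P" using N by (intro connected_component_maximal) auto
  moreover have "frontier \<Omega> \<inter> ball p (min d (dist p q)) \<subseteq> N" using N(3) by auto
  ultimately have "continuum_boundary_point \<Omega> ?P p (min d (dist p q))"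
    using open_\<Omega> p q d by unfold_locales (auto intro!: bexI[of _ q] dest: connected_component_in)
  thus ?thesis by blast
qed

lemma almost_geodesic_avoids_boundary_point:
  assumes pS: "p \<in> frontier \<Omega> - S" and "0 < lam" "0 \<le> kap" "0 < r"
  shows "\<exists>\<tau>>0. \<forall>\<sigma> T a u b. almost_geodesic \<Omega> lam kap {0..T} \<sigma> \<longrightarrow> 0 \<le> a \<longrightarrow> a \<le> u \<longrightarrow> u \<le> b \<longrightarrow> b \<le> T \<longrightarrow>
           r \<le> dist p (\<sigma> a) \<longrightarrow> r \<le> dist p (\<sigma> b) \<longrightarrow> \<tau> \<le> dist p (\<sigma> u)"
proof -
  obtain P \<epsilon> where "continuum_boundary_point \<Omega> P p \<epsilon>" using frontier_point_on_continuum[OF pS] by blast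
  then interpret continuum_boundary_point \<Omega> P p \<epsilon> .
  show ?thesis
  proof (rule almost_geodesic_avoids_point[OF _ assms(2-4)])
    fix \<rho> :: real assume "0 < \<rho>"
    from connected_frontier_neighbourhood[OF pS this]
    show "\<exists>d>0. \<exists>N. connected N \<and> frontier \<Omega> \<inter> ball p d \<subseteq> N \<and> N \<subseteq> frontier \<Omega> \<inter> ball p \<rho>" by blast
  qed
qed

end

text \<open>The times \<open>s\<close> and \<open>t\<close> are arbitrary and in either order, since
  for two ends the condition is applied at an interior time, when the curve crosses a compact
  set.\<close>

definition separating_compact ::
  "complex set \<Rightarrow> real \<Rightarrow> real \<Rightarrow> complex \<Rightarrow> real \<Rightarrow> complex set \<Rightarrow> real \<Rightarrow> bool" where
  "separating_compact D lam kap q \<rho> C e \<longleftrightarrow> compact C \<and> C \<subseteq> D \<and> 0 < e \<and>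
    (\<forall>\<sigma> T s t. almost_geodesic D lam kap {0..T} \<sigma> \<longrightarrow> s \<in> {0..T} \<longrightarrow> t \<in> {0..T} \<longrightarrow>
       dist q (\<sigma> s) < e \<longrightarrow> \<rho> \<le> dist q (\<sigma> t) \<longrightarrow> \<sigma> ` {0..T} \<inter> C \<noteq> {})"

lemma separating_compactD:
  assumes "separating_compact D lam kap q \<rho> C e"
  shows "compact C" "C \<subseteq> D" "0 < e"
    "\<And>\<sigma> T s t. almost_geodesic D lam kap {0..T} \<sigma> \<Longrightarrow> s \<in> {0..T} \<Longrightarrow> t \<in> {0..T} \<Longrightarrow>
       dist q (\<sigma> s) < e \<Longrightarrow> \<rho> \<le> dist q (\<sigma> t) \<Longrightarrow> \<sigma> ` {0..T} \<inter> C \<noteq> {}"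
  using assms unfolding separating_compact_def by blast+

text \<open>Applied to the distance from a point: limit points of sub-arcs in an annulus stay away
  from the curve points at the times \<open>s\<close> and \<open>t\<close>.\<close>

lemma crosses_annulus:
  fixes f :: "real \<Rightarrow> real"
  assumes f: "continuous_on {0..T} f" and st: "s \<in> {0..T}" "t \<in> {0..T}" and ab: "f s \<le> \<alpha>" "\<alpha> \<le> \<beta>" "\<beta> \<le> f t"
  shows "\<exists>c d. min s t \<le> c \<and> c \<le> d \<and> d \<le> max s t \<and> (\<forall>x\<in>{c..d}. \<alpha> \<le> f x \<and> f x \<le> \<beta>) \<and>
           (\<exists>x\<in>{c..d}. f x = \<alpha>) \<and> (\<exists>x\<in>{c..d}. f x = \<beta>)"
proof (cases "s \<le> t")
  case True
  have "continuous_on {s..t} f" using f st by (rule_tac continuous_on_subset) auto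
  then obtain d where d: "d \<in> {s..t}" "f d = \<beta>" "\<forall>x\<in>{s..d}. f x \<le> \<beta>"
    using first_time[of s t f \<beta>] True ab by auto
  have "continuous_on {s..d} (\<lambda>x. - f x)"
    using f st d by (intro continuous_on_minus) (rule continuous_on_subset, auto)
  then obtain c where c: "c \<in> {s..d}" "f c = \<alpha>" "\<forall>x\<in>{c..d}. \<alpha> \<le> f x"
    using last_time[of s d "\<lambda>x. - f x" "- \<alpha>"] d ab by auto
  have "\<forall>x\<in>{c..d}. \<alpha> \<le> f x \<and> f x \<le> \<beta>" using c d by simp
  moreover have "c \<in> {c..d}" "d \<in> {c..d}" "min s t \<le> c" "c \<le> d" "d \<le> max s t" using c d True by simp_all
  ultimately show ?thesis using c(2) d(2) by blast
next
  case False
  have "continuous_on {t..s} f" using f st by (rule_tac continuous_on_subset) auto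
  then obtain c where c: "c \<in> {t..s}" "f c = \<beta>" "\<forall>x\<in>{c..s}. f x \<le> \<beta>"
    using last_time[of t s f \<beta>] False ab by auto
  have "continuous_on {c..s} (\<lambda>x. - f x)"
    using f st c by (intro continuous_on_minus) (rule continuous_on_subset, auto)
  then obtain d where d: "d \<in> {c..s}" "f d = \<alpha>" "\<forall>x\<in>{c..d}. \<alpha> \<le> f x"
    using first_time[of c s "\<lambda>x. - f x" "- \<alpha>"] c ab by auto
  have "\<forall>x\<in>{c..d}. \<alpha> \<le> f x \<and> f x \<le> \<beta>" using c d by simp
  moreover have "c \<in> {c..d}" "d \<in> {c..d}" "min s t \<le> c" "c \<le> d" "d \<le> max s t" using c d False by simp_all
  ultimately show ?thesis using c(2) d(2) by blast
qed

context tame_boundary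
begin

text \<open>Otherwise almost-geodesics escaping from every compact subset of \<open>\<Omega>\<close> accumulate at a
  nondegenerate continuum in the boundary, which contains a point outside \<open>S\<close>.\<close>

lemma almost_geodesic_meets_compact:
  assumes lam: "0 < lam" and kap: "0 \<le> kap" and \<rho>: "0 < \<rho>"
  shows "\<exists>C e. separating_compact \<Omega> lam kap q \<rho> C e"
proof (rule ccontr)
  assume neg: "\<not> ?thesis"
  obtain C :: "nat \<Rightarrow> complex set" where C: "\<And>n. compact (C n)" "\<And>n. C n \<subseteq> \<Omega>"
    "\<And>K. compact K \<Longrightarrow> K \<subseteq> \<Omega> \<Longrightarrow> \<exists>N. \<forall>n\<ge>N. K \<subseteq> C n"
    using open_Union_compact_subsets[OF open_\<Omega>] by metis
  \<comment> \<open>With \<rho>/6 there is a gap: limit points of arcs in the annulus from \<rho>/3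
    to \<open>2 * \<rho> / 3\<close> keep distance at least \<rho>/6 from the points at the times
    \<open>s\<close> and \<open>t\<close>.\<close>
  have "\<exists>\<sigma> T s t. almost_geodesic \<Omega> lam kap {0..T} \<sigma> \<and> s \<in> {0..T} \<and> t \<in> {0..T} \<and>
        dist q (\<sigma> s) < \<rho> / 6 \<and> \<rho> \<le> dist q (\<sigma> t) \<and> \<sigma> ` {0..T} \<inter> C n = {}" for n
  proof -
    have "\<not> separating_compact \<Omega> lam kap q \<rho> (C n) (\<rho> / 6)" using neg by blast
    moreover have "compact (C n)" "C n \<subseteq> \<Omega>" "0 < \<rho> / 6" using C(1,2)[of n] \<rho> by auto
    ultimately show ?thesis
      unfolding separating_compact_def by (simp only: not_all not_imp not_not simp_thms)
  qed
  then obtain \<sigma> T s t where ag: "\<And>n. almost_geodesic \<Omega> lam kap {0..T n} (\<sigma> n)"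
    and st: "\<And>n. s n \<in> {0..T n}" "\<And>n. t n \<in> {0..T n}"
    and ds: "\<And>n. dist q (\<sigma> n (s n)) < \<rho> / 6" and dt: "\<And>n. \<rho> \<le> dist q (\<sigma> n (t n))"
    and avoid: "\<And>n. \<sigma> n ` {0..T n} \<inter> C n = {}" by metis
  have cont: "continuous_on {0..T n} (\<sigma> n)" for n
    using ag[of n] absolutely_continuous_path_continuous_on unfolding almost_geodesic_def by blast
  have im: "\<sigma> n ` {0..T n} \<subseteq> \<Omega>" for n using ag[of n] unfolding almost_geodesic_def by blast
  have "\<exists>c d. min (s n) (t n) \<le> c \<and> c \<le> d \<and> d \<le> max (s n) (t n) \<and>
      (\<forall>x\<in>{c..d}. \<rho> / 3 \<le> dist q (\<sigma> n x) \<and> dist q (\<sigma> n x) \<le> 2 * \<rho> / 3) \<and>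
      (\<exists>x\<in>{c..d}. dist q (\<sigma> n x) = \<rho> / 3) \<and> (\<exists>x\<in>{c..d}. dist q (\<sigma> n x) = 2 * \<rho> / 3)" for n
    using ds[of n] dt[of n] \<rho>
    by (intro crosses_annulus[where T = "T n"] continuous_on_dist continuous_on_const cont st) auto
  then obtain c d where cd: "\<And>n. min (s n) (t n) \<le> c n" "\<And>n. c n \<le> d n" "\<And>n. d n \<le> max (s n) (t n)"
    and ann: "\<And>n x. x \<in> {c n..d n} \<Longrightarrow> \<rho> / 3 \<le> dist q (\<sigma> n x) \<and> dist q (\<sigma> n x) \<le> 2 * \<rho> / 3"
    and inner: "\<And>n. \<exists>x\<in>{c n..d n}. dist q (\<sigma> n x) = \<rho> / 3" and outer: "\<And>n. \<exists>x\<in>{c n..d n}. dist q (\<sigma> n x) = 2 * \<rho> / 3"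
    by metis
  have sub: "{c n..d n} \<subseteq> {0..T n}" for n using cd[of n] st[of n] by auto
  define g where "g n = \<sigma> n ` {c n..d n}" for n
  have conn: "connected (g n)" for n
    unfolding g_def by (intro connected_continuous_image continuous_on_subset[OF cont sub]) auto
  have g\<Omega>: "g n \<subseteq> \<Omega>" "g n \<inter> C n = {}" for n
    using im[of n] avoid[of n] sub[of n] unfolding g_def by blast+
  have gann: "\<rho> / 3 \<le> dist q w \<and> dist q w \<le> 2 * \<rho> / 3" if "w \<in> g n" for w n
    using that ann unfolding g_def by blast
  have "\<exists>x y. x \<in> g n \<and> y \<in> g n \<and> dist q x = \<rho> / 3 \<and> dist q y = 2 * \<rho> / 3" for n
    using inner[of n] outer[of n] unfolding g_def by blast
  then obtain x y where xy: "\<And>n. x n \<in> g n" "\<And>n. y n \<in> g n" "\<And>n. dist q (x n) = \<rho> / 3" "\<And>n. dist q (y n) = 2 * \<rho> / 3"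
    by metis
  have "x n \<in> cball q \<rho>" for n using xy(3)[of n] \<rho> by simp
  hence "\<forall>n. x n \<in> cball q \<rho>" ..
  then obtain l r where l: "strict_mono r" "(x \<circ> r) \<longlonglongrightarrow> l"
    using compact_cball[of q \<rho>] unfolding compact_def by blast
  have "(\<lambda>n. dist q ((x \<circ> r) n)) \<longlonglongrightarrow> dist q l" using l(2) by (intro tendsto_intros)
  hence "dist q l = \<rho> / 3" by (simp add: xy LIMSEQ_const_iff)
  hence yl: "\<rho> / 3 \<le> dist l ((y \<circ> r) n)" for n
    using dist_triangle[of q "y (r n)" l] xy(4)[of "r n"] by simp
  let ?L = "limit_set (g \<circ> r)"
  have ball: "(g \<circ> r) n \<subseteq> cball q \<rho>" for n
  proof
    fix w assume "w \<in> (g \<circ> r) n"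
    thus "w \<in> cball q \<rho>" using gann[of w "r n"] \<rho> by simp
  qed
  have "\<not> ?L \<subseteq> S"
  proof (rule limit_set_not_totally_disconnected(3)[OF _ _ l(2) _ yl _ ball td])
    show "connected ((g \<circ> r) n)" "(x \<circ> r) n \<in> (g \<circ> r) n" "(y \<circ> r) n \<in> (g \<circ> r) n" for n
      using conn xy by auto
  qed (use \<rho> in simp)
  then obtain z where z: "z \<in> ?L" "z \<notin> S" by blast
  have "closed (cball q (2 * \<rho> / 3) - ball q (\<rho> / 3))" by (intro closed_Diff) auto
  moreover have "(g \<circ> r) n \<subseteq> cball q (2 * \<rho> / 3) - ball q (\<rho> / 3)" for n
  proof
    fix w assume "w \<in> (g \<circ> r) n"
    thus "w \<in> cball q (2 * \<rho> / 3) - ball q (\<rho> / 3)" using gann[of w "r n"] by simp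
  qed
  ultimately have "?L \<subseteq> cball q (2 * \<rho> / 3) - ball q (\<rho> / 3)" by (rule limit_set_subset_closed)
  hence zq: "dist q z \<le> 2 * \<rho> / 3" "\<rho> / 3 \<le> dist q z" using z(1) by auto
  have "(g \<circ> r) n \<subseteq> closure \<Omega>" for n
    using g\<Omega>(1)[of "r n"] closure_subset[of \<Omega>] unfolding comp_def by (rule order_trans)
  hence "z \<in> closure \<Omega>" using limit_set_subset_closed[of "closure \<Omega>" "g \<circ> r"] z(1) by auto
  \<comment> \<open>A compact neighbourhood of \<open>z\<close> in \<Omega> would lie in
    \<open>C n\<close> for all large \<open>n\<close>, but the curves avoid
    \<open>C n\<close>.\<close>
  moreover have "z \<notin> \<Omega>"
  proof
    assume "z \<in> \<Omega>"
    then obtain e where e: "e > 0" "cball z e \<subseteq> \<Omega>" using open_\<Omega> open_contains_cball by blast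
    then obtain N where N: "\<And>n. N \<le> n \<Longrightarrow> cball z e \<subseteq> C n" using C(3)[of "cball z e"] by auto
    have "(g \<circ> r) n \<inter> ball z e = {}" if "N \<le> n" for n
    proof -
      have "cball z e \<subseteq> C (r n)" using seq_suble[OF l(1), of n] that by (intro N) simp
      thus ?thesis using g\<Omega>(2)[of "r n"] ball_subset_cball[of z e] unfolding comp_def by blast
    qed
    hence "\<forall>\<^sub>F n in sequentially. (g \<circ> r) n \<inter> ball z e = {}" unfolding eventually_sequentially by blast
    thus False using limit_setD[OF z(1) e(1)] by (simp add: frequently_def)
  qed
  ultimately have zf: "z \<in> frontier \<Omega> - S" using z(2) open_\<Omega> by (simp add: frontier_def interior_open)
  obtain \<tau> where \<tau>: "\<tau> > 0" "\<And>\<sigma> T a u b. almost_geodesic \<Omega> lam kap {0..T} \<sigma> \<Longrightarrow> 0 \<le> a \<Longrightarrow> a \<le> u \<Longrightarrow> u \<le> b \<Longrightarrow> b \<le> T \<Longrightarrow>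
           \<rho> / 6 \<le> dist z (\<sigma> a) \<Longrightarrow> \<rho> / 6 \<le> dist z (\<sigma> b) \<Longrightarrow> \<tau> \<le> dist z (\<sigma> u)"
    using almost_geodesic_avoids_boundary_point[OF zf lam kap, of "\<rho> / 6"] \<rho> by auto
  obtain n where n: "(g \<circ> r) n \<inter> ball z \<tau> \<noteq> {}"
    using frequently_ex[OF limit_setD[OF z(1) \<tau>(1)]] by blast
  define m where "m = r n"
  obtain w where w: "w \<in> g m" "w \<in> ball z \<tau>" using n unfolding m_def comp_def by blast
  then obtain u where "u \<in> {c m..d m}" "w = \<sigma> m u" unfolding g_def by blast
  hence u: "u \<in> {c m..d m}" "dist z (\<sigma> m u) < \<tau>" using w(2) by simp_all
  have 1: "\<rho> / 6 \<le> dist z (\<sigma> m (s m))"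
    using dist_triangle[of q z "\<sigma> m (s m)"] ds[of m] zq by (simp add: dist_commute)
  have 2: "\<rho> / 6 \<le> dist z (\<sigma> m (t m))"
    using dist_triangle[of q "\<sigma> m (t m)" z] dt[of m] zq \<rho> by simp
  have "\<tau> \<le> dist z (\<sigma> m u)"
  proof (rule \<tau>(2)[OF ag])
    show "0 \<le> min (s m) (t m)" "min (s m) (t m) \<le> u" "u \<le> max (s m) (t m)" "max (s m) (t m) \<le> T m"
      using st[of m] cd[of m] u by auto
    show "\<rho> / 6 \<le> dist z (\<sigma> m (min (s m) (t m)))" "\<rho> / 6 \<le> dist z (\<sigma> m (max (s m) (t m)))"
      using 1 2 by (auto simp: min_def max_def)
  qed
  thus False using u by simp
qed

section \<open>Local connectedness of the closure\<close>

text \<open>At a boundary point \<open>y\<close>, take \<open>x\<close> in \<Omega> close to it. The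
  component of \<open>x\<close> in a small ball about \<open>y\<close> does not contain
  \<open>y\<close>, so it has a frontier point inside the ball. That point belongs to the boundary
  of \<Omega>, hence to the connected piece \<open>N\<close>, which links \<open>x\<close> to
  \<open>y\<close>.\<close>

lemma connected_closure_neighbourhood:
  assumes y: "y \<in> closure \<Omega>" "y \<notin> S" and \<rho>: "0 < \<rho>"
  shows "\<exists>d>0. \<exists>V. connected V \<and> y \<in> V \<and> closure \<Omega> \<inter> ball y d \<subseteq> V \<and> V \<subseteq> closure \<Omega> \<inter> ball y \<rho>"
proof (cases "y \<in> \<Omega>")
  case True
  then obtain e where e: "e > 0" "ball y e \<subseteq> \<Omega>" using open_\<Omega> openE by blast
  hence "ball y (min e \<rho>) \<subseteq> closure \<Omega> \<inter> ball y \<rho>" using closure_subset by fastforce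
  thus ?thesis using e \<rho> by (intro exI[of _ "min e \<rho>"] conjI exI[of _ "ball y (min e \<rho>)"]) auto
next
  case False
  hence yf: "y \<in> frontier \<Omega> - S" using y open_\<Omega> by (simp add: frontier_def interior_open)
  obtain d0 N where d0: "d0 > 0" and N: "connected N" "y \<in> N" "frontier \<Omega> \<inter> ball y d0 \<subseteq> N" "N \<subseteq> frontier \<Omega> \<inter> ball y \<rho>"
    using connected_frontier_neighbourhood[OF yf \<rho>] by blast
  define d where "d = min d0 \<rho>"
  have d: "0 < d" "d \<le> d0" "d \<le> \<rho>" using d0 \<rho> by (auto simp: d_def)
  let ?X = "closure \<Omega> \<inter> ball y \<rho>"
  let ?V = "connected_component_set ?X y"
  have NX: "N \<subseteq> ?X" using N(4) by (auto simp: frontier_def)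
  have NV: "N \<subseteq> ?V" using N NX by (intro connected_component_maximal)
  have "x \<in> ?V" if x: "x \<in> closure \<Omega> \<inter> ball y d" for x
  proof (cases "x \<in> \<Omega>")
    case False
    hence "x \<in> frontier \<Omega>" using x open_\<Omega> by (simp add: frontier_def interior_open)
    thus ?thesis using x N(3) NV d by auto
  next
    case True
    let ?D = "connected_component_set (\<Omega> \<inter> ball y d) x"
    have xD: "x \<in> ?D" using x True by simp
    have Dsub: "?D \<subseteq> \<Omega> \<inter> ball y d" by (rule connected_component_subset)
    have "ball y d \<inter> frontier ?D \<noteq> {}"
    proof (rule connected_Int_frontier)
      show "ball y d \<inter> ?D \<noteq> {}" using xD x by auto
      have "y \<in> ball y d - ?D" using Dsub \<open>y \<notin> \<Omega>\<close> d by (metis DiffI IntD1 centre_in_ball subsetD)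
      thus "ball y d - ?D \<noteq> {}" by blast
    qed simp
    then obtain w where w: "w \<in> ball y d" "w \<in> frontier ?D" by blast
    have "w \<in> frontier (\<Omega> \<inter> ball y d)" using w frontier_of_connected_component_subset by blast
    hence "w \<in> frontier \<Omega>" using w(1) frontier_Int_subset[of \<Omega> "ball y d"]
      by (auto simp: frontier_def interior_open)
    hence wN: "w \<in> N" using w N(3) d by auto
    have "w \<in> closure ?D" using w by (simp add: frontier_def)
    have "connected (insert w ?D)"
    proof (rule connected_intermediate_closure)
      show "connected ?D" by (rule connected_connected_component)
      show "?D \<subseteq> insert w ?D" by (rule subset_insertI)
      show "insert w ?D \<subseteq> closure ?D" using \<open>w \<in> closure ?D\<close> closure_subset by blast
    qed
    moreover have "insert w ?D \<subseteq> ?X"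
    proof -
      have "ball y d \<subseteq> ball y \<rho>" using d(3) by (rule subset_ball)
      thus ?thesis using Dsub wN NX closure_subset[of \<Omega>] by blast
    qed
    moreover have "w \<in> ?V" using wN NV by blast
    ultimately have "insert w ?D \<subseteq> ?V"
      by (metis connected_component_eq connected_component_maximal insertI1)
    thus ?thesis using xD by blast
  qed
  moreover have "?V \<subseteq> ?X" by (rule connected_component_subset)
  moreover have "y \<in> ?V" using N(2) NV by blast
  ultimately show ?thesis using d(1) by (intro exI[of _ d] conjI exI[of _ ?V]) auto
qed

text \<open>The closure may fail to be locally connected at points of \<open>S\<close>, so openness
  of its components needs an argument. If it failed at \<open>x\<close>, components of \<Omega> in a
  ball about \<open>x\<close> that are disjoint from \<open>F\<close> would come close to
  \<open>x\<close> and extend far out. Their limit set lies in \<open>F\<close> and has a point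
  outside \<open>S\<close>, where the closure is locally connected, a contradiction.\<close>

lemma component_openin_closure:
  assumes unb: "\<not> bounded \<Omega>" and K: "compact K" and F: "F \<in> components (closure \<Omega> - K)" and x: "x \<in> F"
  shows "\<exists>d>0. closure \<Omega> \<inter> ball x d \<subseteq> F"
proof (rule ccontr)
  assume neg: "\<not> ?thesis"
  let ?Z = "closure \<Omega> - K"
  have xZ: "x \<in> ?Z" using F x in_components_subset by blast
  have room: "\<exists>\<rho>>0. cball z \<rho> \<inter> K = {}" if zK: "z \<notin> K" for z
  proof -
    have "open (- K)" using compact_imp_closed[OF K] by (rule open_Compl)
    then obtain e where "e > 0" "cball z e \<subseteq> - K" using zK open_contains_cball by (metis ComplI)
    thus ?thesis by blast
  qed
  have maxF: "C \<subseteq> F" if "connected C" "C \<subseteq> ?Z" "C \<inter> F \<noteq> {}" for C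
    using components_maximal[OF F that(1,2)] that(3) by blast
  have closedF: "w \<in> F" if "w \<in> closure F" "w \<in> ?Z" for w
  proof -
    have "connected (insert w F)"
    proof (rule connected_intermediate_closure)
      show "connected F" using F by (rule in_components_connected)
      show "F \<subseteq> insert w F" by (rule subset_insertI)
      show "insert w F \<subseteq> closure F" using that(1) closure_subset by blast
    qed
    thus ?thesis using maxF[of "insert w F"] that in_components_subset[OF F] x by blast
  qed
  obtain \<rho> where \<rho>: "\<rho> > 0" "cball x \<rho> \<inter> K = {}" using room xZ by blast
  \<comment> \<open>The nearby points outside \<open>F\<close> can be taken in \<Omega>, which is
    dense in its closure, because \<open>F\<close> is closed in \<open>?Z\<close>.\<close>
  have "\<exists>w. w \<in> \<Omega> \<and> w \<notin> F \<and> dist x w < min \<rho> (1 / real (Suc n)) / 2" for n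
  proof (rule ccontr)
    assume none: "\<not> ?thesis"
    define e where "e = min \<rho> (1 / real (Suc n)) / 2"
    have e: "0 < e" "e < \<rho>" using \<rho> by (auto simp: e_def)
    have sub: "\<Omega> \<inter> ball x e \<subseteq> F" using none by (auto simp: e_def)
    have "closure \<Omega> \<inter> ball x e \<subseteq> F"
    proof
      fix w assume w: "w \<in> closure \<Omega> \<inter> ball x e"
      have "w \<in> closure (\<Omega> \<inter> ball x e)" using w open_Int_closure_subset[of "ball x e" \<Omega>] by (auto simp: Int_commute)
      hence "w \<in> closure F" using closure_mono[OF sub] by blast
      moreover have "w \<in> cball x \<rho>" using w e by simp
      hence "w \<in> ?Z" using w \<rho>(2) by blast
      ultimately show "w \<in> F" by (rule closedF)
    qed
    thus False using neg e by blast
  qed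
  then obtain w where w: "\<And>n. w n \<in> \<Omega>" "\<And>n. w n \<notin> F" "\<And>n. dist x (w n) < min \<rho> (1 / real (Suc n)) / 2" by metis
  define g where "g n = connected_component_set (\<Omega> \<inter> ball x \<rho>) (w n)" for n
  have w\<rho>: "dist x (w n) < \<rho> / 2" for n using w(3)[of n] by auto
  have wg: "w n \<in> g n" for n using w(1)[of n] w\<rho>[of n] \<rho>(1) by (simp add: g_def)
  have gsub: "g n \<subseteq> \<Omega> \<inter> ball x \<rho>" for n unfolding g_def by (rule connected_component_subset)
  have conn: "connected (g n)" for n unfolding g_def by (rule connected_connected_component)
  have gZ: "g n \<subseteq> ?Z" for n using gsub[of n] closure_subset[of \<Omega>] \<rho>(2) ball_subset_cball[of x \<rho>] by blast
  have gF: "g n \<inter> F = {}" for n using maxF[OF conn[of n] gZ[of n]] wg[of n] w(2)[of n] by blast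
  \<comment> \<open>A component confined to the half ball would have a frontier point in \<Omega>,
    as \<Omega> is connected and unbounded. But a component of an open set has no frontier point in
    that set.\<close>
  have "\<exists>y\<in>g n. \<rho> / 2 \<le> dist x y" for n
  proof (rule ccontr)
    assume "\<not> ?thesis"
    hence sub: "g n \<subseteq> cball x (\<rho> / 2)" by auto
    have "\<not> \<Omega> \<subseteq> g n" using unb bounded_subset[OF bounded_cball, of \<Omega>] sub by (meson order_trans)
    hence "\<Omega> \<inter> frontier (g n) \<noteq> {}"
      using w(1)[of n] wg[of n] by (intro connected_Int_frontier connected_\<Omega>) auto
    then obtain v where v: "v \<in> \<Omega>" "v \<in> frontier (g n)" by blast
    have "v \<in> frontier (\<Omega> \<inter> ball x \<rho>)"
      using v(2) frontier_of_connected_component_subset unfolding g_def by blast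
    moreover have "v \<in> cball x (\<rho> / 2)"
      using v(2) closure_minimal[OF sub closed_cball] by (auto simp: frontier_def)
    hence "v \<in> \<Omega> \<inter> ball x \<rho>" using v \<rho>(1) by auto
    ultimately show False using open_\<Omega> by (simp add: frontier_def interior_open open_Int)
  qed
  then obtain y where y: "\<And>n. y n \<in> g n" "\<And>n. \<rho> / 2 \<le> dist x (y n)" by metis
  have lim: "w \<longlonglongrightarrow> x"
  proof (rule metric_LIMSEQ_I)
    fix e :: real assume "0 < e"
    then obtain N where N: "inverse (real (Suc N)) < e" using reals_Archimedean by blast
    have "dist (w n) x < e" if "N \<le> n" for n
    proof -
      define v where "v = 1 / real (Suc n)"
      have v: "0 < v" "v \<le> inverse (real (Suc N))" using that by (simp_all add: v_def field_simps)
      have "min \<rho> v / 2 \<le> v / 2" by (intro divide_right_mono) auto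
      moreover have "dist (w n) x < min \<rho> v / 2" using w(3)[of n] unfolding v_def by (simp only: dist_commute)
      ultimately show ?thesis using v N by linarith
    qed
    thus "\<exists>N. \<forall>n\<ge>N. dist (w n) x < e" by blast
  qed
  have bdd: "g n \<subseteq> cball x \<rho>" for n using gsub[of n] ball_subset_cball by blast
  note ls = limit_set_not_totally_disconnected[OF conn wg lim y _ bdd td]
  have L: "connected (limit_set g)" "x \<in> limit_set g" "\<not> limit_set g \<subseteq> S" using ls \<rho>(1) by auto
  have "closed (closure \<Omega> \<inter> cball x \<rho>)" by (intro closed_Int) auto
  moreover have "g n \<subseteq> closure \<Omega> \<inter> cball x \<rho>" for n using gZ[of n] bdd[of n] by blast
  ultimately have "limit_set g \<subseteq> closure \<Omega> \<inter> cball x \<rho>" by (rule limit_set_subset_closed)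
  hence "limit_set g \<subseteq> ?Z" using \<rho>(2) by blast
  hence LF: "limit_set g \<subseteq> F" using maxF[OF L(1)] L(2) x by blast
  obtain z where z: "z \<in> limit_set g" "z \<notin> S" using L(3) by blast
  have zZ: "z \<in> F" "z \<in> closure \<Omega>" "z \<notin> K" using z(1) LF in_components_subset[OF F] by blast+
  obtain \<rho>' where \<rho>': "\<rho>' > 0" "cball z \<rho>' \<inter> K = {}" using room zZ(3) by blast
  \<comment> \<open>A whole neighbourhood of \<open>z\<close> in the closure belongs to
    \<open>F\<close>, yet some \<open>g n\<close> comes within \<open>d\<close> of
    \<open>z\<close>.\<close>
  obtain d V where V: "d > 0" "connected V" "z \<in> V" "closure \<Omega> \<inter> ball z d \<subseteq> V" "V \<subseteq> closure \<Omega> \<inter> ball z \<rho>'"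
    using connected_closure_neighbourhood[OF zZ(2) z(2) \<rho>'(1)] by blast
  have "V \<subseteq> ?Z" using V(5) \<rho>'(2) ball_subset_cball[of z \<rho>'] by blast
  hence "V \<subseteq> F" using maxF[OF V(2)] V(3) zZ(1) by blast
  moreover obtain n where "g n \<inter> ball z d \<noteq> {}" using frequently_ex[OF limit_setD[OF z(1) V(1)]] by blast
  ultimately show False using gF[of n] V(4) gZ[of n] by blast
qed

end

section \<open>Neighbourhoods in the end compactification\<close>

text \<open>The relative interiors of the sets \<open>K (Suc j)\<close> cover \<open>C\<close>, and
  the sets \<open>K j\<close> increase.\<close>

lemma exhaustion_compact_subset:
  assumes K: "exhaustion X K" and C: "compact C" "C \<subseteq> X"
  shows "\<exists>j. C \<subseteq> K j"
proof -
  have sub: "K j \<subseteq> (top_of_set X) interior_of (K (Suc j))" for j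
    using K unfolding exhaustion_def by blast
  have inc: "i \<le> j \<Longrightarrow> K i \<subseteq> K j" for i j
  proof (rule lift_Suc_mono_le[where f = K])
    show "K n \<subseteq> K (Suc n)" for n using sub[of n] interior_of_subset by (rule order_trans)
  qed
  have KX: "(\<Union>j. K j) = X" using K unfolding exhaustion_def by (elim conjE)
  have "\<exists>V. open V \<and> (top_of_set X) interior_of (K (Suc j)) = X \<inter> V" for j
    using openin_interior_of[of "top_of_set X" "K (Suc j)"] unfolding openin_open .
  then obtain V where V: "\<And>j. open (V j)" "\<And>j. (top_of_set X) interior_of (K (Suc j)) = X \<inter> V j" by metis
  have "C \<subseteq> (\<Union>j. V j)"
  proof
    fix z assume "z \<in> C"
    hence "z \<in> (\<Union>j. K j)" using KX C(2) by blast
    then obtain j where "z \<in> K j" by blast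
    thus "z \<in> (\<Union>j. V j)" using sub[of j] V(2)[of j] by blast
  qed
  then obtain J where J: "finite J" "C \<subseteq> (\<Union>j\<in>J. V j)"
    using compactE_image[OF C(1), of UNIV V] V(1) by auto
  have "C \<subseteq> K (Suc (Max (insert 0 J)))"
  proof
    fix z assume z: "z \<in> C"
    then obtain j where j: "j \<in> J" "z \<in> V j" using J by blast
    hence "z \<in> (top_of_set X) interior_of (K (Suc j))" using V(2)[of j] z C(2) by blast
    hence "z \<in> K (Suc j)" by (rule subsetD[OF interior_of_subset])
    moreover have "Suc j \<le> Suc (Max (insert 0 J))" using j(1) J(1) by simp
    ultimately show "z \<in> K (Suc (Max (insert 0 J)))" using inc by blast
  qed
  thus ?thesis ..
qed

lemma end_components:
  assumes "F \<in> ends D K" shows "F j \<in> components (closure D - K j)" "\<not> bounded D"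
  using assms by (auto simp: ends_def split: if_splits)

text \<open>\<open>H \<nu>\<close> and \<open>F \<nu>\<close> are components of the same set, and
  both contain \<open>H j \<inter> F j\<close>.\<close>

lemma end_eq_of_component_eq:
  assumes F: "F \<in> ends D K" and H: "H \<in> ends D K" and j: "H j \<inter> F j \<noteq> {}" and \<nu>: "\<nu> \<le> j"
  shows "H \<nu> = F \<nu>"
proof -
  have "H \<nu> \<inter> F \<nu> \<noteq> {}" using ends_antimono[OF F \<nu>] ends_antimono[OF H \<nu>] j by blast
  thus ?thesis using components_nonoverlap end_components(1)[OF F] end_components(1)[OF H] by blast
qed

abbreviation end_closure :: "complex set \<Rightarrow> (nat \<Rightarrow> complex set) \<Rightarrow> end_point set \<Rightarrow> end_point set" where
  "end_closure D K A \<equiv> (end_compactification D K) closure_of A"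

abbreviation end_neighbourhood :: "complex set \<Rightarrow> (nat \<Rightarrow> complex set) \<Rightarrow> end_point \<Rightarrow> end_point set \<Rightarrow> bool" where
  "end_neighbourhood D K \<equiv> neighbourhood_in (end_compactification D K)"

lemma end_open_ball: "end_open D K (Pt ` (ball q e \<inter> closure D))"
proof (rule end_openI)
  fix x assume "Pt x \<in> Pt ` (ball q e \<inter> closure D)"
  hence x: "x \<in> ball q e" by auto
  then obtain r where "r > 0" "ball x r \<subseteq> ball q e" by (meson open_ball openE)
  thus "\<exists>r>0. Pt ` (ball x r \<inter> closure D) \<subseteq> Pt ` (ball q e \<inter> closure D)" by blast
qed (auto simp: end_space_def)

lemma neighbourhood_in_ball:
  assumes "q \<in> closure D" "0 < e"
  shows "end_neighbourhood D K (Pt q) (Pt ` (ball q e \<inter> closure D))"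
  unfolding neighbourhood_in_def
proof (intro conjI exI[of _ "Pt ` (ball q e \<inter> closure D)"])
  show "openin (end_compactification D K) (Pt ` (ball q e \<inter> closure D))" using end_open_ball by simp
qed (use assms in \<open>auto simp: end_space_def\<close>)

text \<open>Openness of the basic sets about ends is a hypothesis because it depends on the boundary
  of the domain. No end is a limit of a bounded set: the closed ball lies in some \<open>K j\<close>
  within the closure of \<open>D\<close>, and \<open>F j\<close> misses \<open>K j\<close>.\<close>

lemma closure_of_ball:
  assumes K: "exhaustion (closure D) K"
    and H: "\<And>H j. H \<in> ends D K \<Longrightarrow> end_open D K (end_nbhd D K H j)"
  shows "end_closure D K (Pt ` (ball q e \<inter> closure D)) \<subseteq> Pt ` (cball q e \<inter> closure D)"
proof
  fix z assume z: "z \<in> end_closure D K (Pt ` (ball q e \<inter> closure D))"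
  hence zs: "z \<in> end_space D K"
    and meet: "\<And>U. z \<in> U \<Longrightarrow> end_open D K U \<Longrightarrow> U \<inter> Pt ` (ball q e \<inter> closure D) \<noteq> {}"
    by (auto simp: in_closure_of)
  show "z \<in> Pt ` (cball q e \<inter> closure D)"
  proof (cases z)
    case (Pt x)
    hence x: "x \<in> closure D" using zs by (auto simp: end_space_def)
    have "x \<in> closure (ball q e)"
    proof (rule closure_approachable[THEN iffD2], intro allI impI)
      fix r :: real assume "0 < r"
      hence "Pt ` (ball x r \<inter> closure D) \<inter> Pt ` (ball q e \<inter> closure D) \<noteq> {}"
        using x Pt by (intro meet end_open_ball) auto
      thus "\<exists>y\<in>ball q e. dist y x < r" by (auto simp: dist_commute)
    qed
    hence "x \<in> cball q e" using closure_minimal[OF ball_subset_cball closed_cball] by blast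
    thus ?thesis using x Pt by blast
  next
    case (End F)
    hence F: "F \<in> ends D K" using zs by (auto simp: end_space_def)
    obtain j where j: "cball q e \<inter> closure D \<subseteq> K j"
      using exhaustion_compact_subset[OF K, of "cball q e \<inter> closure D"] by (auto simp: compact_Int_closed)
    have "end_nbhd D K F j \<inter> Pt ` (ball q e \<inter> closure D) \<noteq> {}"
      using End F by (intro meet H) (auto simp: end_nbhd_def)
    hence "\<exists>x. x \<in> F j \<and> x \<in> ball q e \<inter> closure D" unfolding end_nbhd_def by blast
    then obtain x where "x \<in> F j" "x \<in> ball q e \<inter> closure D" by blast
    thus ?thesis using ball_subset_cball[of q e] j in_components_subset[OF end_components(1)[OF F, of j]] by blast
  qed
qed

text \<open>The index drops by one because a limit point of \<open>F (Suc j)\<close> may lie on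
  \<open>K (Suc j)\<close>. It cannot lie on \<open>K j\<close>, which is in the relative interior
  of \<open>K (Suc j)\<close>.\<close>

lemma closure_of_end_nbhd:
  assumes K: "exhaustion (closure D) K" and F: "F \<in> ends D K"
    and H: "\<And>H j. H \<in> ends D K \<Longrightarrow> end_open D K (end_nbhd D K H j)"
  shows "end_closure D K (end_nbhd D K F (Suc j)) \<subseteq> end_nbhd D K F j"
proof
  fix z assume z: "z \<in> end_closure D K (end_nbhd D K F (Suc j))"
  hence zs: "z \<in> end_space D K"
    and meet: "\<And>U. z \<in> U \<Longrightarrow> end_open D K U \<Longrightarrow> U \<inter> end_nbhd D K F (Suc j) \<noteq> {}"
    by (auto simp: in_closure_of)
  have Fj: "F (Suc j) \<subseteq> closure D - K (Suc j)" using in_components_subset[OF end_components(1)[OF F]] .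
  show "z \<in> end_nbhd D K F j"
  proof (cases z)
    case (Pt x)
    hence x: "x \<in> closure D" using zs by (auto simp: end_space_def)
    have near: "ball x r \<inter> F (Suc j) \<noteq> {}" if "0 < r" for r
    proof -
      have "Pt ` (ball x r \<inter> closure D) \<inter> end_nbhd D K F (Suc j) \<noteq> {}"
        using x Pt that by (intro meet end_open_ball) auto
      thus ?thesis by (auto simp: end_nbhd_def)
    qed
    have xc: "x \<in> closure (F (Suc j))"
      by (rule closure_approachable[THEN iffD2]) (use near in \<open>force simp: dist_commute\<close>)
    have "x \<notin> K j"
    proof
      assume "x \<in> K j"
      hence xi: "x \<in> (top_of_set (closure D)) interior_of (K (Suc j))" using K unfolding exhaustion_def by blast
      have "openin (top_of_set (closure D)) ((top_of_set (closure D)) interior_of (K (Suc j)))"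
        by (rule openin_interior_of)
      then obtain r where "r > 0" "ball x r \<inter> closure D \<subseteq> (top_of_set (closure D)) interior_of (K (Suc j))"
        using xi unfolding openin_contains_ball by blast
      thus False using near[of r] Fj interior_of_subset[of "top_of_set (closure D)" "K (Suc j)"] by blast
    qed
    have "connected (insert x (F (Suc j)))"
    proof (rule connected_intermediate_closure)
      show "connected (F (Suc j))" using end_components(1)[OF F] in_components_connected by blast
      show "F (Suc j) \<subseteq> insert x (F (Suc j))" by (rule subset_insertI)
      show "insert x (F (Suc j)) \<subseteq> closure (F (Suc j))" using xc closure_subset by blast
    qed
    moreover have "F (Suc j) \<subseteq> F j" using ends_antimono[OF F, of j "Suc j"] by simp
    moreover have "F (Suc j) \<noteq> {}" using end_components(1)[OF F] in_components_nonempty by blast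
    moreover have "F j \<subseteq> closure D - K j" using in_components_subset[OF end_components(1)[OF F]] .
    ultimately have "insert x (F (Suc j)) \<subseteq> F j"
      using x \<open>x \<notin> K j\<close> by (intro components_maximal[OF end_components(1)[OF F]]) blast+
    thus ?thesis using Pt by (auto simp: end_nbhd_def)
  next
    case (End G)
    hence G: "G \<in> ends D K" using zs by (auto simp: end_space_def)
    have "end_nbhd D K G (Suc j) \<inter> end_nbhd D K F (Suc j) \<noteq> {}"
      using End G by (intro meet H) (auto simp: end_nbhd_def)
    then consider y where "y \<in> G (Suc j) \<inter> F (Suc j)"
      | E where "\<forall>\<nu>\<le>Suc j. E \<nu> = G \<nu>" "\<forall>\<nu>\<le>Suc j. E \<nu> = F \<nu>"
      by (auto simp: end_nbhd_def)
    hence "\<forall>\<nu>\<le>j. G \<nu> = F \<nu>"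
    proof cases
      case 1
      hence "G (Suc j) \<inter> F (Suc j) \<noteq> {}" by blast
      thus ?thesis using end_eq_of_component_eq[OF F G] by (meson le_SucI)
    next
      case 2
      thus ?thesis by (metis le_Suc_eq)
    qed
    thus ?thesis using End G by (simp add: end_nbhd_def)
  qed
qed

section \<open>Visibility\<close>

text \<open>The crossing hypothesis allows either order of the times, so it yields both orders of
  the two boundary points.\<close>

lemma visibility_propertyI:
  assumes "end_neighbourhood D K \<zeta> V" "end_neighbourhood D K \<eta> W"
    and "end_closure D K V \<subseteq> V'" "end_closure D K W \<subseteq> W'" "V' \<inter> W' = {}"
    and "compact C" "C \<subseteq> D"
    and "\<And>\<sigma> T s t. almost_geodesic D lam kap {0..T} \<sigma> \<Longrightarrow> s \<in> {0..T} \<Longrightarrow> t \<in> {0..T} \<Longrightarrow>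
      Pt (\<sigma> s) \<in> V \<Longrightarrow> Pt (\<sigma> t) \<in> W \<Longrightarrow> \<sigma> ` {0..T} \<inter> C \<noteq> {}"
  shows "visibility_property D K lam kap \<zeta> \<eta>" "visibility_property D K lam kap \<eta> \<zeta>"
proof -
  have mem: "0 \<in> {0..T}" "T \<in> {0..T}" if "0 \<le> T" for T :: real using that by auto
  have dj: "end_closure D K V \<inter> end_closure D K W = {}"
    "end_closure D K W \<inter> end_closure D K V = {}"
    using assms(3-5) by blast+
  show "visibility_property D K lam kap \<zeta> \<eta>"
    unfolding visibility_property_def
    by (rule exI[of _ V], rule exI[of _ W], rule exI[of _ C])
       (intro conjI allI impI assms(1,2,6,7) dj, elim conjE, rule assms(8)[OF _ mem], assumption+)
  show "visibility_property D K lam kap \<eta> \<zeta>"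
    unfolding visibility_property_def
    by (rule exI[of _ W], rule exI[of _ V], rule exI[of _ C])
       (intro conjI allI impI assms(1,2,6,7) dj, elim conjE, rule assms(8)[OF _ mem(2,1)], assumption+)
qed

context tame_boundary
begin

lemma end_open_end_nbhd:
  assumes K: "exhaustion (closure \<Omega>) K" and F: "F \<in> ends \<Omega> K"
  shows "end_open \<Omega> K (end_nbhd \<Omega> K F j)"
proof (rule end_openI)
  have Fj: "F j \<subseteq> closure \<Omega>" using in_components_subset[OF end_components(1)[OF F, of j]] by blast
  thus "end_nbhd \<Omega> K F j \<subseteq> end_space \<Omega> K" by (auto simp: end_nbhd_def end_space_def)
  fix x assume "Pt x \<in> end_nbhd \<Omega> K F j"
  hence x: "x \<in> F j" by (auto simp: end_nbhd_def)
  have "compact (K j)" using K by (simp add: exhaustion_def)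
  then obtain d where "d > 0" "closure \<Omega> \<inter> ball x d \<subseteq> F j"
    using component_openin_closure[OF end_components(2)[OF F] _ end_components(1)[OF F] x] by blast
  thus "\<exists>r>0. Pt ` (ball x r \<inter> closure \<Omega>) \<subseteq> end_nbhd \<Omega> K F j" by (auto simp: end_nbhd_def)
next
  fix G assume "End G \<in> end_nbhd \<Omega> K F j"
  hence G: "G \<in> ends \<Omega> K" "\<forall>\<nu>\<le>j. G \<nu> = F \<nu>" by (auto simp: end_nbhd_def)
  have "end_nbhd \<Omega> K G j \<subseteq> end_nbhd \<Omega> K F j" using G(2) by (auto simp: end_nbhd_def)
  thus "\<exists>i. end_nbhd \<Omega> K G i \<subseteq> end_nbhd \<Omega> K F j" ..
qed

lemma neighbourhood_in_end_nbhd: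
  assumes K: "exhaustion (closure \<Omega>) K" and F: "F \<in> ends \<Omega> K"
  shows "end_neighbourhood \<Omega> K (End F) (end_nbhd \<Omega> K F j)"
  unfolding neighbourhood_in_def
proof (intro conjI exI[of _ "end_nbhd \<Omega> K F j"])
  have o: "end_open \<Omega> K (end_nbhd \<Omega> K F j)" by (rule end_open_end_nbhd[OF K F])
  thus "openin (end_compactification \<Omega> K) (end_nbhd \<Omega> K F j)" by simp
  show "end_nbhd \<Omega> K F j \<subseteq> topspace (end_compactification \<Omega> K)" using end_open_subset[OF o] by simp
  show "End F \<in> end_nbhd \<Omega> K F j" using F by (auto simp: end_nbhd_def)
qed simp

section \<open>Visibility for two points, a point and an end, and two ends\<close>

lemma visibility_points:
  assumes K: "exhaustion (closure \<Omega>) K" and q: "q \<in> closure \<Omega>" "q' \<in> closure \<Omega>" "q \<noteq> q'"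
    and lam: "0 < lam" "0 \<le> kap"
  shows "visibility_property \<Omega> K lam kap (Pt q) (Pt q')"
proof -
  define d where "d = dist q q'"
  have d: "0 < d" using q by (simp add: d_def)
  have "0 < d / 2" using d by simp
  from almost_geodesic_meets_compact[OF lam this, of q]
  obtain C e where "separating_compact \<Omega> lam kap q (d / 2) C e" by blast
  note C = separating_compactD[OF this]
  \<comment> \<open>Radii of at most \<open>d / 4\<close> keep the two closed balls disjoint and the
    points near \<open>q'\<close> farther than \<open>d / 2\<close> from \<open>q\<close>.\<close>
  define e' where "e' = min e (d / 4)"
  have e': "0 < e'" "e' \<le> e" "e' \<le> d / 4" using C(3) d by (auto simp: e'_def)
  have tri: "d \<le> dist q x + dist q' x" for x
    unfolding d_def using dist_triangle[of q q' x] by (simp add: dist_commute)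
  show ?thesis
  proof (rule visibility_propertyI(1))
    show "end_neighbourhood \<Omega> K (Pt q) (Pt ` (ball q e' \<inter> closure \<Omega>))"
      by (intro neighbourhood_in_ball q e')
    show "end_neighbourhood \<Omega> K (Pt q') (Pt ` (ball q' (d / 4) \<inter> closure \<Omega>))"
      using d by (intro neighbourhood_in_ball q) simp
    show "end_closure \<Omega> K (Pt ` (ball q e' \<inter> closure \<Omega>)) \<subseteq> Pt ` (cball q e' \<inter> closure \<Omega>)"
      "end_closure \<Omega> K (Pt ` (ball q' (d / 4) \<inter> closure \<Omega>)) \<subseteq> Pt ` (cball q' (d / 4) \<inter> closure \<Omega>)"
      by (rule closure_of_ball[OF K], rule end_open_end_nbhd[OF K], assumption)+
    have "x \<notin> cball q' (d / 4)" if "x \<in> cball q e'" for x using tri[of x] that e' d by auto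
    thus "Pt ` (cball q e' \<inter> closure \<Omega>) \<inter> Pt ` (cball q' (d / 4) \<inter> closure \<Omega>) = {}" by blast
    fix \<sigma> :: "real \<Rightarrow> complex" and T s t :: real
    assume ag: "almost_geodesic \<Omega> lam kap {0..T} \<sigma>" "s \<in> {0..T}" "t \<in> {0..T}"
      and "Pt (\<sigma> s) \<in> Pt ` (ball q e' \<inter> closure \<Omega>)" "Pt (\<sigma> t) \<in> Pt ` (ball q' (d / 4) \<inter> closure \<Omega>)"
    hence "dist q (\<sigma> s) < e" "d / 2 \<le> dist q (\<sigma> t)" using e' tri[of "\<sigma> t"] by auto
    thus "\<sigma> ` {0..T} \<inter> C \<noteq> {}" by (rule C(4)[OF ag])
  qed (rule C)+
qed

lemma visibility_point_end:
  assumes K: "exhaustion (closure \<Omega>) K" and q: "q \<in> closure \<Omega>" and F: "F \<in> ends \<Omega> K"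
    and lam: "0 < lam" "0 \<le> kap"
  shows "visibility_property \<Omega> K lam kap (Pt q) (End F)" "visibility_property \<Omega> K lam kap (End F) (Pt q)"
proof -
  obtain C e where "separating_compact \<Omega> lam kap q 1 C e"
    using almost_geodesic_meets_compact[OF lam zero_less_one] by blast
  note C = separating_compactD[OF this]
  define e' where "e' = min e 1"
  have e': "0 < e'" "e' \<le> e" "e' \<le> 1" using C(3) by (auto simp: e'_def)
  \<comment> \<open>From index \<open>j\<close> on, the sets of the end are farther than 1 from
    \<open>q\<close>, the radius for which \<open>C\<close> was chosen.\<close>
  obtain j where j: "cball q 1 \<inter> closure \<Omega> \<subseteq> K j"
    using exhaustion_compact_subset[OF K, of "cball q 1 \<inter> closure \<Omega>"] by (auto simp: compact_Int_closed)
  have out: "x \<notin> cball q 1" if "x \<in> F j" for x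
    using that j in_components_subset[OF end_components(1)[OF F, of j]] by blast
  have FS: "F (Suc j) \<subseteq> F j" using ends_antimono[OF F, of j "Suc j"] by simp
  have 1: "end_neighbourhood \<Omega> K (Pt q) (Pt ` (ball q e' \<inter> closure \<Omega>))"
    by (intro neighbourhood_in_ball q e')
  have 2: "end_neighbourhood \<Omega> K (End F) (end_nbhd \<Omega> K F (Suc j))"
    by (rule neighbourhood_in_end_nbhd[OF K F])
  have 3: "end_closure \<Omega> K (Pt ` (ball q e' \<inter> closure \<Omega>)) \<subseteq> Pt ` (cball q e' \<inter> closure \<Omega>)"
    by (rule closure_of_ball[OF K]) (rule end_open_end_nbhd[OF K])
  have 4: "end_closure \<Omega> K (end_nbhd \<Omega> K F (Suc j)) \<subseteq> end_nbhd \<Omega> K F j"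
    by (rule closure_of_end_nbhd[OF K F]) (rule end_open_end_nbhd[OF K])
  have 5: "Pt ` (cball q e' \<inter> closure \<Omega>) \<inter> end_nbhd \<Omega> K F j = {}"
    using out subset_cball[OF e'(3), of q] by (auto simp: end_nbhd_def)
  have 6: "\<sigma> ` {0..T} \<inter> C \<noteq> {}"
    if ag: "almost_geodesic \<Omega> lam kap {0..T} \<sigma>" "s \<in> {0..T}" "t \<in> {0..T}"
      and V: "Pt (\<sigma> s) \<in> Pt ` (ball q e' \<inter> closure \<Omega>)" and W: "Pt (\<sigma> t) \<in> end_nbhd \<Omega> K F (Suc j)" for \<sigma> T s t
  proof (rule C(4)[OF ag])
    show "dist q (\<sigma> s) < e" using V e' by auto
    have "\<sigma> t \<in> F j" using W FS by (auto simp: end_nbhd_def)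
    thus "1 \<le> dist q (\<sigma> t)" using out[of "\<sigma> t"] by simp
  qed
  show "visibility_property \<Omega> K lam kap (Pt q) (End F)" "visibility_property \<Omega> K lam kap (End F) (Pt q)"
    by (rule visibility_propertyI(1)[OF 1 2 3 4 5 C(1,2)], rule 6, assumption+)
      (rule visibility_propertyI(2)[OF 1 2 3 4 5 C(1,2)], rule 6)
qed

text \<open>A curve from one end to the other must cross a compact set \<open>K i\<close> at which
  the ends separate. Finitely many balls cover \<open>K i\<close>, and the curve starts at distance
  at least 1 from their centres, so the separating compact set of one of these centres is
  met.\<close>

lemma visibility_ends:
  assumes K: "exhaustion (closure \<Omega>) K" and F: "F \<in> ends \<Omega> K" and G: "G \<in> ends \<Omega> K" "F \<noteq> G"
    and lam: "0 < lam" "0 \<le> kap"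
  shows "visibility_property \<Omega> K lam kap (End F) (End G)"
proof -
  obtain i where i: "F i \<noteq> G i" using G(2) by blast
  hence FGi: "F i \<inter> G i = {}" using end_eq_of_component_eq[OF F G(1), of i i] by blast
  have cK: "compact (K i)" "K i \<subseteq> closure \<Omega>" using K by (auto simp: exhaustion_def)
  have "\<forall>q. \<exists>C e. separating_compact \<Omega> lam kap q 1 C e"
    using almost_geodesic_meets_compact[OF lam zero_less_one] by blast
  then obtain C e where "\<And>q. separating_compact \<Omega> lam kap q 1 (C q) (e q)" by metis
  note C = separating_compactD[OF this]
  have cover: "K i \<subseteq> (\<Union>q\<in>K i. ball q (e q))"
  proof
    fix q assume "q \<in> K i"
    moreover have "q \<in> ball q (e q)" using C(3)[of q] by simp
    ultimately show "q \<in> (\<Union>q\<in>K i. ball q (e q))" by blast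
  qed
  obtain D where D: "D \<subseteq> K i" "finite D" "K i \<subseteq> (\<Union>q\<in>D. ball q (e q))"
    using compactE_image[OF cK(1) open_ball cover] by metis
  obtain R where R: "\<And>z. z \<in> K i \<Longrightarrow> norm z \<le> R"
    using compact_imp_bounded[OF cK(1)] unfolding bounded_iff by blast
  obtain j0 where j0: "cball 0 (R + 1) \<inter> closure \<Omega> \<subseteq> K j0"
    using exhaustion_compact_subset[OF K, of "cball 0 (R + 1) \<inter> closure \<Omega>"] by (auto simp: compact_Int_closed)
  \<comment> \<open>Index \<open>i\<close> separates the two ends; index \<open>j0\<close> puts the
    end \<open>F\<close> at distance at least 1 from \<open>K i\<close>.\<close>
  define j where "j = max i j0"
  have anti: "F (Suc j) \<subseteq> F i" "G (Suc j) \<subseteq> G i" "F (Suc j) \<subseteq> F j0" "F j \<subseteq> F i" "G j \<subseteq> G i"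
    by (auto intro!: ends_antimono[OF F] ends_antimono[OF G(1)] simp: j_def)
  have out: "1 \<le> dist q x" if "x \<in> F j0" "q \<in> K i" for x q
  proof -
    have "x \<notin> cball 0 (R + 1)" using that j0 in_components_subset[OF end_components(1)[OF F, of j0]] by blast
    moreover have "norm q \<le> R" using R that(2) by blast
    moreover have "norm x \<le> norm q + dist q x" using norm_triangle_sub[of x q] by (simp add: dist_norm norm_minus_commute)
    ultimately show ?thesis by simp
  qed
  show ?thesis
  proof (rule visibility_propertyI(1))
    show "end_neighbourhood \<Omega> K (End F) (end_nbhd \<Omega> K F (Suc j))"
      "end_neighbourhood \<Omega> K (End G) (end_nbhd \<Omega> K G (Suc j))"
      by (rule neighbourhood_in_end_nbhd[OF K], rule F, rule neighbourhood_in_end_nbhd[OF K], rule G)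
    show "end_closure \<Omega> K (end_nbhd \<Omega> K F (Suc j)) \<subseteq> end_nbhd \<Omega> K F j"
      by (rule closure_of_end_nbhd[OF K F]) (rule end_open_end_nbhd[OF K])
    show "end_closure \<Omega> K (end_nbhd \<Omega> K G (Suc j)) \<subseteq> end_nbhd \<Omega> K G j"
      by (rule closure_of_end_nbhd[OF K G(1)]) (rule end_open_end_nbhd[OF K])
    have ij: "i \<le> j" by (simp add: j_def)
    have "F j \<inter> G j = {}" using anti(4,5) FGi by blast
    moreover have "\<not> ((\<forall>\<nu>\<le>j. E \<nu> = F \<nu>) \<and> (\<forall>\<nu>\<le>j. E \<nu> = G \<nu>))" for E using i ij by metis
    ultimately show "end_nbhd \<Omega> K F j \<inter> end_nbhd \<Omega> K G j = {}" unfolding end_nbhd_def by blast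
    show "compact (\<Union>q\<in>D. C q)" using D C(1) by (intro compact_UN) auto
    show "(\<Union>q\<in>D. C q) \<subseteq> \<Omega>" using C(2) by blast
    fix \<sigma> :: "real \<Rightarrow> complex" and T s t :: real
    assume ag: "almost_geodesic \<Omega> lam kap {0..T} \<sigma>" and st: "s \<in> {0..T}" "t \<in> {0..T}"
      and V: "Pt (\<sigma> s) \<in> end_nbhd \<Omega> K F (Suc j)" and W: "Pt (\<sigma> t) \<in> end_nbhd \<Omega> K G (Suc j)"
    have \<sigma>s: "\<sigma> s \<in> F (Suc j)" and \<sigma>t: "\<sigma> t \<in> G (Suc j)" using V W by (auto simp: end_nbhd_def)
    have im: "\<sigma> ` {0..T} \<subseteq> \<Omega>" and AC: "absolutely_continuous_path {0..T} \<sigma>"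
      using ag unfolding almost_geodesic_def by blast+
    have conn: "connected (\<sigma> ` {0..T})"
      using absolutely_continuous_path_continuous_on[OF AC] by (intro connected_continuous_image) auto
    have "\<sigma> ` {0..T} \<inter> K i \<noteq> {}"
    proof
      assume "\<sigma> ` {0..T} \<inter> K i = {}"
      hence "\<sigma> ` {0..T} \<subseteq> closure \<Omega> - K i" using im closure_subset by blast
      moreover have "\<sigma> s \<in> F i" "\<sigma> t \<in> G i" using \<sigma>s \<sigma>t anti(1,2) by (auto dest: subsetD)
      moreover have "\<sigma> s \<in> \<sigma> ` {0..T}" "\<sigma> t \<in> \<sigma> ` {0..T}" using st by simp_all
      ultimately have "\<sigma> t \<in> F i"
        using components_maximal[OF end_components(1)[OF F, of i] conn] by blast
      thus False using \<open>\<sigma> t \<in> G i\<close> FGi by blast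
    qed
    then obtain v where v: "v \<in> {0..T}" "\<sigma> v \<in> K i" by blast
    then obtain q where q: "q \<in> D" "dist q (\<sigma> v) < e q" using D(3) by auto
    have "\<sigma> s \<in> F j0" "q \<in> K i" using \<sigma>s anti(3) q(1) D(1) by (auto dest: subsetD)
    hence "1 \<le> dist q (\<sigma> s)" by (rule out)
    hence "\<sigma> ` {0..T} \<inter> C q \<noteq> {}" using C(4)[OF ag v(1) st(1) q(2)] by blast
    thus "\<sigma> ` {0..T} \<inter> (\<Union>q\<in>D. C q) \<noteq> {}" using q(1) by blast
  qed
qed

lemma visibility_property_all:
  assumes K: "exhaustion (closure \<Omega>) K" and \<zeta>: "\<zeta> \<in> end_boundary \<Omega> K" and \<eta>: "\<eta> \<in> end_boundary \<Omega> K"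
    and ne: "\<zeta> \<noteq> \<eta>" and lam: "0 < lam" "0 \<le> kap"
  shows "visibility_property \<Omega> K lam kap \<zeta> \<eta>"
proof -
  have sp: "\<zeta> \<in> end_space \<Omega> K" "\<eta> \<in> end_space \<Omega> K" using \<zeta> \<eta> by (auto simp: end_boundary_def)
  have P: "q \<in> closure \<Omega>" if "Pt q \<in> end_space \<Omega> K" for q using that by (auto simp: end_space_def)
  have E: "F \<in> ends \<Omega> K" if "End F \<in> end_space \<Omega> K" for F using that by (auto simp: end_space_def)
  show ?thesis
  proof (cases \<zeta>; cases \<eta>)
    fix q q' assume z: "\<zeta> = Pt q" "\<eta> = Pt q'"
    have "q \<noteq> q'" using ne z by simp
    thus ?thesis using visibility_points[OF K P P _ lam, of q q'] sp z by simp
  next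
    fix q F assume z: "\<zeta> = Pt q" "\<eta> = End F"
    thus ?thesis using visibility_point_end(1)[OF K P E lam, of q F] sp by simp
  next
    fix F q assume z: "\<zeta> = End F" "\<eta> = Pt q"
    thus ?thesis using visibility_point_end(2)[OF K P E lam, of q F] sp by simp
  next
    fix F G assume z: "\<zeta> = End F" "\<eta> = End G"
    have "F \<noteq> G" using ne z by simp
    thus ?thesis using visibility_ends[OF K E E _ lam, of F G] sp z by simp
  qed
qed

end

theorem theorem1p13:
  fixes \<Omega> S :: "complex set"
  assumes "hyperbolic_domain \<Omega>"
    and "S \<subseteq> frontier \<Omega>"
    and "totally_disconnected S"
    and "\<And>p. p \<in> frontier \<Omega> - S \<Longrightarrow> locally_connected_at p (top_of_set (frontier \<Omega>))"
    and "\<And>p. p \<in> frontier \<Omega> - S \<Longrightarrow> connected_component_set (frontier \<Omega>) p \<noteq> {p}"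
  shows "visibility_domain \<Omega>"
proof -
  interpret tame_boundary \<Omega> S
    using assms by unfold_locales (auto simp: hyperbolic_domain_def)
  show ?thesis
    unfolding visibility_domain_def
  proof (intro conjI allI impI ballI)
    show "hyperbolic_domain \<Omega>" by (rule assms(1))
    fix K and lam kap :: real and \<zeta> \<eta>
    assume "exhaustion (closure \<Omega>) K" "1 \<le> lam" "0 < kap" "\<zeta> \<in> end_boundary \<Omega> K" "\<eta> \<in> end_boundary \<Omega> K" "\<zeta> \<noteq> \<eta>"
    thus "visibility_property \<Omega> K lam kap \<zeta> \<eta>" by (intro visibility_property_all) auto
  qed
qed


end
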